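(* Let $p\geq 1$ and let $(E,d)$ be a separable, locally compact geodesic space. Let $(\mathbb{P}_j)_{j\geq1}\subset\mathcal{W}_p(\mathcal{W}_p(E))$ and, for each $j$, let $\mu_j\in\mathcal{W}_p(E)$ be a barycenter of $\mathbb{P}_j$. Suppose there is $\mathbb{P}\in\mathcal{W}_p(\mathcal{W}_p(E))$ with $W_p(\mathbb{P}_j,\mathbb{P})\to0$ as $j\to\infty$. Then the sequence $(\mu_j)_{j\geq1}$ is precompact in $(\mathcal{W}_p(E),W_p)$, and every limit (in $W_p$) of a subsequence of $(\mu_j)$ is a barycenter of $\mathbb{P}$.
   Context: A geodesic space is a complete metric space $(E,d)$ in which every two points $x,y$ have a mid-point, i.e. a point $z$ with $d(x,z)=d(z,y)=\tfrac12 d(x,y)$. For a metric space $(E,d)$ and $p\geq1$, $\mathcal{W}_p(E)$ denotes the set of Borel probability measures $\mu$ on $E$ with $\int d^p(x,x_0)\,d\mu(x)<\infty$ for some (equivalently any) $x_0\in E$. For $\mu,\nu\in\mathcal{W}_p(E)$, $W_p(\mu,\nu)=\big(\inf_{\pi\in\Gamma(\mu,\nu)}\int d^p(x,y)\,d\pi(x,y)\big)^{1/p}$, where $\Gamma(\mu,\nu)$ is the set of probability measures on $E\times E$ with marginals $\mu$ and $\nu$. $\mathcal{W}_p(\mathcal{W}_p(E))$ denotes the set of probability measures on the metric space $(\mathcal{W}_p(E),W_p)$ with finite $p$-th moment, equipped with the Wasserstein distance (also denoted $W_p$) built from the metric $W_p$ on $\mathcal{W}_p(E)$. A barycenter of $\mathbb{P}\in\mathcal{W}_p(\mathcal{W}_p(E))$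 is any minimizer over $\nu\in\mathcal{W}_p(E)$ of $\int W_p^p(\nu,\mu)\,d\mathbb{P}(\mu)$. *)

theory Defs
  imports "HOL-Analysis.Analysis" "HOL-Probability.Probability"
begin

definition borel_of :: "'a topology \<Rightarrow> 'a measure" where
  "borel_of X = sigma (topspace X) {U. openin X U}"

definition geodesic_space :: "'a set \<Rightarrow> ('a \<Rightarrow> 'a \<Rightarrow> real) \<Rightarrow> bool" where
  "geodesic_space S d \<longleftrightarrow> Metric_space S d \<and> Metric_space.mcomplete S d \<and>
     (\<forall>x\<in>S. \<forall>y\<in>S. \<exists>z\<in>S. d x z = d x y / 2 \<and> d z y = d x y / 2)"

definition wp_space :: "'a set \<Rightarrow> ('a \<Rightarrow> 'a \<Rightarrow> real) \<Rightarrow> real \<Rightarrow> 'a measure set" where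
  "wp_space S d p = {\<mu>. sets \<mu> = sets (borel_of (Metric_space.mtopology S d)) \<and> prob_space \<mu> \<and>
      (\<exists>x0\<in>S. (\<integral>\<^sup>+ x. ennreal (d x x0 powr p) \<partial>\<mu>) < \<infinity>)}"

definition couplings :: "'a measure \<Rightarrow> 'a measure \<Rightarrow> ('a \<times> 'a) measure set" where
  "couplings \<mu> \<nu> = {\<pi>. sets \<pi> = sets (\<mu> \<Otimes>\<^sub>M \<nu>) \<and> prob_space \<pi> \<and>
      distr \<pi> \<mu> fst = \<mu> \<and> distr \<pi> \<nu> snd = \<nu>}"

definition wass :: "('a \<Rightarrow> 'a \<Rightarrow> real) \<Rightarrow> real \<Rightarrow> 'a measure \<Rightarrow> 'a measure \<Rightarrow> real" where
  "wass d p \<mu> \<nu> =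
     enn2real (INF \<pi>\<in>couplings \<mu> \<nu>. \<integral>\<^sup>+ xy. ennreal (d (fst xy) (snd xy) powr p) \<partial>\<pi>) powr (1 / p)"

definition barycenter :: "'a set \<Rightarrow> ('a \<Rightarrow> 'a \<Rightarrow> real) \<Rightarrow> real \<Rightarrow> 'a measure measure \<Rightarrow> 'a measure \<Rightarrow> bool" where
  "barycenter S d p P \<nu> \<longleftrightarrow> \<nu> \<in> wp_space S d p \<and>
     (\<forall>\<nu>'\<in>wp_space S d p.
        (\<integral>\<^sup>+ \<mu>. ennreal (wass d p \<nu> \<mu> powr p) \<partial>P) \<le> (\<integral>\<^sup>+ \<mu>. ennreal (wass d p \<nu>' \<mu> powr p) \<partial>P))"

end

theory Submission
  imports Defs
begin

text \<open>A geodesic locally compact space is proper (Hopf-Rinow), so the measures \<open>\<mu>\<^sub>j\<close>, whose \<open>p\<close>-th moments are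
  bounded, have a weak subsequential limit \<open>\<kappa>\<close>. By lower semicontinuity of \<open>W\<^sub>p\<close>, Fatou's lemma and minimality of
  the \<open>\<mu>\<^sub>j\<close>, the functionals converge and \<open>W\<^sub>p(\<mu>\<^sub>j, \<nu>) \<rightarrow> W\<^sub>p(\<kappa>, \<nu>)\<close> along a subsequence for some \<open>\<nu>\<close>. Together
  with weak convergence this makes the \<open>p\<close>-th moments uniformly integrable, whence \<open>W\<^sub>p(\<mu>\<^sub>j, \<kappa>) \<rightarrow> 0\<close>. That limits
  are barycenters follows from the triangle inequality in \<open>L\<^sup>p\<close>, as the functionals of \<open>P\<^sub>j\<close> and \<open>P\<close> differ by at
  most \<open>W\<^sub>p(P\<^sub>j, P)\<close>.

  Weak convergence enters through almost sure representations, obtained from Skorohod's theorem on the real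
  line by coding a proper space measurably into the reals. Gluing of couplings is only needed up to an
  arbitrarily small error, which allows to condition on a countable partition instead of disintegrating.\<close>

section \<open>Integral inequalities and discrete gluing\<close>

text \<open>The obstacle that shapes the development is the outer level. \<open>P\<close> and
  \<open>PP j\<close> live on \<open>wp_space E d p\<close>, about which nothing beyond the metric
  axioms is established. Without separability the distance there is not known to be measurable on
  the product, so neither the gluing argument nor an exact change of variables is at hand. Every
  comparison at that level therefore runs through \<open>pmean\<close>, the distance from a point
  mass to a measure, whose triangle inequalities only integrate distances to fixed points. For the
  same reason the lemmas on \<open>pmean\<close> are stated in an arbitrary metric space and then
  serve both levels.

  Minimality of each \<mu> j is tested against the weak limit \<kappa> itself, so no barycenter of
  \<open>P\<close> has to be at hand beforehand. Comparison with a single fixed \<nu> is enough to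
  pass from weak to Wasserstein convergence: the law \<nu> and the limit law have fixed finite
  moments, hence a cost to \<nu> that converges to its weak limit value leaves no mass with
  non-negligible moment to escape to infinity.\<close>

lemma powr_convex_nonneg:
  fixes x y u v p :: real
  assumes "1 \<le> p" "0 \<le> x" "0 \<le> y" "0 \<le> u" "0 \<le> v" "u + v = 1"
  shows "(u * x + v * y) powr p \<le> u * x powr p + v * y powr p"
proof -
  \<comment> \<open>This settles the case of a vanishing endpoint, where only one summand survives;
    it rests on \<open>w powr p \<le> w\<close> for w in [0,1].\<close>
  have *: "(w * z) powr p \<le> w * z powr p" if "0 \<le> w" "w \<le> 1" "0 \<le> z" for w z :: real
  proof -
    have "w powr p \<le> w"
    proof (cases "w = 0")
      case False
      then have "w powr p \<le> w powr 1"
        using that assms(1) by (intro powr_mono') auto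
      then show ?thesis using that by simp
    qed (use assms(1) in simp)
    then show ?thesis
      using that by (simp add: powr_mult mult_right_mono)
  qed
  show ?thesis
  proof (cases "x = 0 \<or> y = 0")
    case True
    then show ?thesis
      using *[of u x] *[of v y] assms by auto
  next
    case False
    have u: "u = 1 - v" using assms by simp
    show ?thesis
      using convex_onD[OF powr_convex[OF assms(1)], of v x y] False assms
      unfolding u by simp
  qed
qed

lemma powr_add_le:
  fixes a b p :: real
  assumes "0 \<le> a" "0 \<le> b" "1 \<le> p"
  shows "(a + b) powr p \<le> 2 powr p * (a powr p + b powr p)"
proof -
  have "(a + b) powr p \<le> (2 * max a b) powr p" using assms by (intro powr_mono2) auto
  also have "\<dots> = 2 powr p * max a b powr p" by (rule powr_mult)
  also have "max a b powr p \<le> a powr p + b powr p" by (simp add: max_def)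
  finally show ?thesis by simp
qed

lemma powr_add3_le:
  fixes a b c p :: real
  assumes "0 \<le> a" "0 \<le> b" "0 \<le> c" "1 \<le> p"
  shows "(a + b + c) powr p \<le> 3 powr p * (a powr p + b powr p + c powr p)"
proof -
  have "(a + b + c) powr p \<le> (3 * max a (max b c)) powr p" using assms by (intro powr_mono2) auto
  also have "\<dots> = 3 powr p * max a (max b c) powr p" by (rule powr_mult)
  also have "max a (max b c) powr p \<le> a powr p + b powr p + c powr p" by (simp add: max_def)
  finally show ?thesis by simp
qed

lemma tendsto_powr_nonneg:
  fixes f :: "nat \<Rightarrow> real"
  assumes "f \<longlonglongrightarrow> a" "\<And>n. 0 \<le> f n" "1 \<le> p"
  shows "(\<lambda>n. f n powr p) \<longlonglongrightarrow> a powr p"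
  using assms by (intro tendsto_powr') auto

text \<open>The quotient (a + b) / (A + B) is the convex combination of a / A and b / B with weights
  A / (A + B) and B / (A + B). If the p-th powers of a and b integrate to at most
  \<open>A powr p\<close> and \<open>B powr p\<close>, the right-hand side integrates to at most
  \<open>(A + B) powr p\<close>, which is Minkowski's inequality.\<close>

lemma powr_add_le_weighted:
  fixes a b A B p :: real
  assumes "1 \<le> p" "0 \<le> a" "0 \<le> b" "0 < A" "0 < B"
  shows "(a + b) powr p \<le>
    (A + B) powr p * A / (A + B) / A powr p * a powr p + (A + B) powr p * B / (A + B) / B powr p * b powr p"
proof -
  have "(a + b) powr p = ((A + B) * (A / (A + B) * (a / A) + B / (A + B) * (b / B))) powr p"
  proof -
    define S where "S = A + B"
    have "S \<noteq> 0" using assms by (simp add: S_def)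
    then have "a + b = S * (A / S * (a / A) + B / S * (b / B))"
      using assms(4,5) by (simp add: distrib_left)
    then show ?thesis by (simp add: S_def)
  qed
  also have "\<dots> = (A + B) powr p * (A / (A + B) * (a / A) + B / (A + B) * (b / B)) powr p"
    by (rule powr_mult)
  also have "\<dots> \<le> (A + B) powr p * (A / (A + B) * (a / A) powr p + B / (A + B) * (b / B) powr p)"
    using assms by (intro mult_left_mono powr_convex_nonneg) (auto simp: add_divide_distrib[symmetric])
  also have "\<dots> = (A + B) powr p * A / (A + B) / A powr p * a powr p + (A + B) powr p * B / (A + B) / B powr p * b powr p"
    using assms by (simp add: powr_divide algebra_simps)
  finally show ?thesis .
qed

text \<open>Strictly positive upper bounds A and B stand in for the norms, so that vanishing or
  infinite norms need no separate treatment; users add a small slack. The integral of h is only ever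
  bounded through monotonicity, which is valid for the lower integral and allows h to be a distance
  whose measurability is unknown.\<close>

lemma minkowski_nn_integral_powr:
  fixes f g h :: "'a \<Rightarrow> real"
  assumes p: "1 \<le> p" and [measurable]: "f \<in> borel_measurable M" "g \<in> borel_measurable M"
    and nonneg: "\<And>x. 0 \<le> f x" "\<And>x. 0 \<le> g x" "\<And>x. 0 \<le> h x"
    and le: "AE x in M. h x \<le> f x + g x"
    and A: "0 < A" "(\<integral>\<^sup>+ x. ennreal (f x powr p) \<partial>M) \<le> ennreal (A powr p)"
    and B: "0 < B" "(\<integral>\<^sup>+ x. ennreal (g x powr p) \<partial>M) \<le> ennreal (B powr p)"
  shows "(\<integral>\<^sup>+ x. ennreal (h x powr p) \<partial>M) \<le> ennreal ((A + B) powr p)"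
proof -
  define a where "a = (A + B) powr p * A / (A + B) / A powr p"
  define b where "b = (A + B) powr p * B / (A + B) / B powr p"
  have ab: "0 \<le> a" "0 \<le> b" using A B by (auto simp: a_def b_def)
  have "(\<integral>\<^sup>+ x. ennreal (h x powr p) \<partial>M)
      \<le> (\<integral>\<^sup>+ x. ennreal a * ennreal (f x powr p) + ennreal b * ennreal (g x powr p) \<partial>M)"
  proof (rule nn_integral_mono_AE, use le in eventually_elim)
    case (elim x)
    have "h x powr p \<le> (f x + g x) powr p"
      using elim nonneg p by (intro powr_mono2) auto
    also have "\<dots> \<le> a * f x powr p + b * g x powr p"
      unfolding a_def b_def using A B p nonneg by (intro powr_add_le_weighted) auto
    finally show ?case
      using ab by (simp add: ennreal_mult'[symmetric] ennreal_plus[symmetric] del: ennreal_plus)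
  qed
  also have "\<dots> = ennreal a * (\<integral>\<^sup>+ x. ennreal (f x powr p) \<partial>M) + ennreal b * (\<integral>\<^sup>+ x. ennreal (g x powr p) \<partial>M)"
    by (simp add: nn_integral_add nn_integral_cmult)
  also have "\<dots> \<le> ennreal a * ennreal (A powr p) + ennreal b * ennreal (B powr p)"
    using A B by (intro add_mono mult_left_mono) auto
  also have "\<dots> = ennreal (a * A powr p + b * B powr p)"
    using ab by (simp add: ennreal_mult'[symmetric])
  also have "a * A powr p + b * B powr p = (A + B) powr p"
  proof -
    have "a * A powr p + b * B powr p = (A + B) powr p * ((A + B) / (A + B))"
      using A(1) B(1) unfolding a_def b_def by (simp add: add_divide_distrib distrib_left del: divide_self divide_self_if)
    moreover have "(A + B) / (A + B) = 1" using A(1) B(1) by (intro divide_self) auto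
    ultimately show ?thesis by (metis mult.right_neutral)
  qed
  finally show ?thesis .
qed

text \<open>For a nonmeasurable integrand \<^const>\<open>nn_integral\<close> is a lower integral, and only an inequality holds.\<close>

lemma nn_integral_distr_le:
  assumes [measurable]: "T \<in> measurable M N"
  shows "integral\<^sup>N (distr M N T) f \<le> (\<integral>\<^sup>+ x. f (T x) \<partial>M)"
  unfolding nn_integral_def[of "distr M N T"]
proof (rule SUP_least, clarify)
  fix g assume g: "simple_function (distr M N T) g" "g \<le> f"
  have "g \<in> borel_measurable (distr M N T)"
    using g by (intro borel_measurable_simple_function)
  then have "integral\<^sup>S (distr M N T) g = (\<integral>\<^sup>+ x. g (T x) \<partial>M)"
    using g by (subst nn_integral_eq_simple_integral[symmetric]) (auto intro: nn_integral_distr)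
  also have "\<dots> \<le> (\<integral>\<^sup>+ x. f (T x) \<partial>M)"
    using g by (intro nn_integral_mono) (auto simp: le_fun_def)
  finally show "integral\<^sup>S (distr M N T) g \<le> (\<integral>\<^sup>+ x. f (T x) \<partial>M)" .
qed

text \<open>Gluing along a discrete random variable: the product measure is reweighted by the density
  \<open>1[f x = g y] / P(f = f x)\<close>. This replaces the disintegration in the usual gluing lemma.\<close>

lemma discrete_gluing:
  fixes f :: "'a \<Rightarrow> nat" and g :: "'b \<Rightarrow> nat"
  assumes "prob_space M" "prob_space N"
    and [measurable]: "f \<in> measurable M (count_space UNIV)" "g \<in> measurable N (count_space UNIV)"
    and eq: "distr M (count_space UNIV) f = distr N (count_space UNIV) g"
  obtains G where "sets G = sets (M \<Otimes>\<^sub>M N)" "prob_space G" "distr G M fst = M" "distr G N snd = N"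
    "AE z in G. f (fst z) = g (snd z)"
proof -
  interpret M: prob_space M by fact
  interpret N: prob_space N by fact
  interpret MN: pair_prob_space M N ..
  define m where "m i = emeasure M {x\<in>space M. f x = i}" for i
  have m_N: "m i = emeasure N {x\<in>space N. g x = i}" for i
  proof -
    have "m i = emeasure (distr M (count_space UNIV) f) {i}"
      unfolding m_def by (subst emeasure_distr) (auto intro!: arg_cong[where f="emeasure M"])
    also have "\<dots> = emeasure N {x\<in>space N. g x = i}"
      unfolding eq by (subst emeasure_distr) (auto intro!: arg_cong[where f="emeasure N"])
    finally show ?thesis .
  qed
  have m_fin: "m i \<noteq> \<infinity>" for i by (simp add: m_def)
  define w :: "'a \<times> 'b \<Rightarrow> ennreal" where "w z = (if f (fst z) = g (snd z) then inverse (m (f (fst z))) else 0)" for z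
  have [measurable]: "w \<in> borel_measurable (M \<Otimes>\<^sub>M N)"
  proof -
    have 1: "(\<lambda>z. f (fst z)) \<in> measurable (M \<Otimes>\<^sub>M N) (count_space UNIV)"
      "(\<lambda>z. g (snd z)) \<in> measurable (M \<Otimes>\<^sub>M N) (count_space UNIV)"
      using measurable_compose[OF measurable_fst assms(3)] measurable_compose[OF measurable_snd assms(4)] by auto
    have "(\<lambda>z. if i = g (snd z) then inverse (m i) else 0) \<in> borel_measurable (M \<Otimes>\<^sub>M N)" for i
      by (rule measurable_compose[OF 1(2), of "\<lambda>j. if i = j then inverse (m i) else 0"]) simp
    then show ?thesis unfolding w_def
      by (rule measurable_compose_countable) (rule 1)
  qed
  define G where "G = density (M \<Otimes>\<^sub>M N) w"
  have sets_G[measurable_cong]: "sets G = sets (M \<Otimes>\<^sub>M N)" by (simp add: G_def)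
  have inv: "m i * inverse (m i) = 1" if "m i \<noteq> 0" for i
    using that m_fin[of i] by (simp add: divide_ennreal_def[symmetric] ennreal_divide_self less_top[symmetric])
  \<comment> \<open>Where \<open>m (f x)\<close> vanishes the weight is infinite on the matching
    fibre. These points form a countable union of null sets, so the fibre integrals below need to
    equal 1 only elsewhere.\<close>
  have AE_M: "AE x in M. m (f x) \<noteq> 0"
  proof -
    have "AE x in M. \<forall>i. m i = 0 \<longrightarrow> f x \<noteq> i"
    proof (subst AE_all_countable, intro allI)
      fix i
      have "AE x in M. f x \<noteq> i" if "m i = 0"
        using that by (intro AE_I[where N="{x\<in>space M. f x = i}"]) (auto simp: m_def)
      then show "AE x in M. m i = 0 \<longrightarrow> f x \<noteq> i" by (cases "m i = 0") auto
    qed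
    then show ?thesis by eventually_elim auto
  qed
  have AE_N: "AE x in N. m (g x) \<noteq> 0"
  proof -
    have "AE x in N. \<forall>i. m i = 0 \<longrightarrow> g x \<noteq> i"
    proof (subst AE_all_countable, intro allI)
      fix i
      have "AE x in N. g x \<noteq> i" if "m i = 0"
        using that by (intro AE_I[where N="{x\<in>space N. g x = i}"]) (auto simp: m_N)
      then show "AE x in N. m i = 0 \<longrightarrow> g x \<noteq> i" by (cases "m i = 0") auto
    qed
    then show ?thesis by eventually_elim auto
  qed
  have w_N: "(\<integral>\<^sup>+ y. w (x, y) \<partial>N) = 1" if "m (f x) \<noteq> 0" for x
  proof -
    have "(\<integral>\<^sup>+ y. w (x, y) \<partial>N) = (\<integral>\<^sup>+ y. inverse (m (f x)) * indicator {y\<in>space N. g y = f x} y \<partial>N)"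
      by (intro nn_integral_cong) (simp add: w_def indicator_def)
    also have "\<dots> = 1"
      using inv[OF that] by (subst nn_integral_cmult_indicator) (simp_all add: m_N[symmetric] mult.commute)
    finally show ?thesis .
  qed
  have w_M: "(\<integral>\<^sup>+ x. w (x, y) \<partial>M) = 1" if "m (g y) \<noteq> 0" for y
  proof -
    have "(\<integral>\<^sup>+ x. w (x, y) \<partial>M) = (\<integral>\<^sup>+ x. inverse (m (g y)) * indicator {x\<in>space M. f x = g y} x \<partial>M)"
      by (intro nn_integral_cong) (simp add: w_def indicator_def)
    also have "\<dots> = 1"
      using inv[OF that] by (subst nn_integral_cmult_indicator) (simp_all add: m_def[symmetric] mult.commute)
    finally show ?thesis .
  qed
  have fst_G: "distr G M fst = M"
  proof (rule measure_eqI)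
    fix A assume "A \<in> sets (distr G M fst)"
    then have [measurable]: "A \<in> sets M" by simp
    have "emeasure (distr G M fst) A = (\<integral>\<^sup>+ x. indicator A x \<partial>distr G M fst)"
      by simp
    also have "\<dots> = (\<integral>\<^sup>+ z. indicator A (fst z) \<partial>G)"
      by (rule nn_integral_distr) auto
    also have "\<dots> = (\<integral>\<^sup>+ z. w z * indicator A (fst z) \<partial>(M \<Otimes>\<^sub>M N))"
      unfolding G_def by (subst nn_integral_density) auto
    also have "\<dots> = (\<integral>\<^sup>+ x. (\<integral>\<^sup>+ y. w (x, y) * indicator A x \<partial>N) \<partial>M)"
      by (subst N.nn_integral_fst[symmetric]) auto
    also have "\<dots> = (\<integral>\<^sup>+ x. (\<integral>\<^sup>+ y. w (x, y) \<partial>N) * indicator A x \<partial>M)"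
      by (intro nn_integral_cong nn_integral_multc) auto
    also have "\<dots> = (\<integral>\<^sup>+ x. indicator A x \<partial>M)"
      by (rule nn_integral_cong_AE) (use AE_M in eventually_elim, simp add: w_N)
    finally show "emeasure (distr G M fst) A = emeasure M A" by simp
  qed simp
  have snd_G: "distr G N snd = N"
  proof (rule measure_eqI)
    fix A assume "A \<in> sets (distr G N snd)"
    then have [measurable]: "A \<in> sets N" by simp
    have "emeasure (distr G N snd) A = (\<integral>\<^sup>+ x. indicator A x \<partial>distr G N snd)"
      by simp
    also have "\<dots> = (\<integral>\<^sup>+ z. indicator A (snd z) \<partial>G)"
      by (rule nn_integral_distr) auto
    also have "\<dots> = (\<integral>\<^sup>+ z. w z * indicator A (snd z) \<partial>(M \<Otimes>\<^sub>M N))"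
      unfolding G_def by (subst nn_integral_density) auto
    also have "\<dots> = (\<integral>\<^sup>+ y. (\<integral>\<^sup>+ x. w (x, y) * indicator A y \<partial>M) \<partial>N)"
      by (subst MN.nn_integral_snd[symmetric]) auto
    also have "\<dots> = (\<integral>\<^sup>+ y. (\<integral>\<^sup>+ x. w (x, y) \<partial>M) * indicator A y \<partial>N)"
      by (intro nn_integral_cong nn_integral_multc) auto
    also have "\<dots> = (\<integral>\<^sup>+ y. indicator A y \<partial>N)"
      by (rule nn_integral_cong_AE) (use AE_N in eventually_elim, simp add: w_M)
    finally show "emeasure (distr G N snd) A = emeasure N A" by simp
  qed simp
  have "prob_space G"
  proof (rule prob_spaceI)
    have "emeasure G (space G) = emeasure (distr G M fst) (space M)"
      by (subst emeasure_distr)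
        (auto simp: G_def space_pair_measure intro!: arg_cong[where f="emeasure (density (M \<Otimes>\<^sub>M N) w)"])
    then show "emeasure G (space G) = 1" by (simp add: fst_G M.emeasure_space_1)
  qed
  moreover have "AE z in G. f (fst z) = g (snd z)"
    unfolding G_def by (subst AE_density) (auto simp: w_def)
  ultimately show ?thesis using that[of G] sets_G fst_G snd_G by simp
qed

text \<open>Eventually u is at least c - e/2 and w is below c + e/2, which leaves less than e for v.
  The finiteness of c makes these margins strict. The case distinctions arise because
  \<open>ennreal\<close> sends a negative c - e/2 to 0.\<close>

lemma liminf_ennreal_add_le:
  fixes u v :: "nat \<Rightarrow> ennreal"
  assumes "c \<le> liminf u" and "\<And>n. u n + v n \<le> w n" and "w \<longlonglongrightarrow> c" and "c < \<infinity>"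
  shows "v \<longlonglongrightarrow> 0"
proof (rule tendsto_zero_ennreal)
  fix e :: real assume e: "0 < e"
  define c' where "c' = enn2real c"
  have c: "c = ennreal c'" "0 \<le> c'" using assms(4) by (auto simp: c'_def)
  have 1: "\<forall>\<^sub>F n in sequentially. w n < ennreal (c' + e / 2)"
    using assms(3) e c by (intro order_tendstoD) (auto intro!: ennreal_lessI)
  have 2: "\<forall>\<^sub>F n in sequentially. ennreal (c' - e / 2) \<le> u n"
  proof (cases "c' - e / 2 \<le> 0")
    case True then show ?thesis by (simp add: ennreal_neg)
  next
    case False
    then have "ennreal (c' - e / 2) < liminf u"
      using assms(1) c e by (intro order.strict_trans2[OF _ assms(1)]) (auto intro!: ennreal_lessI)
    from less_LiminfD[OF this] show ?thesis by (rule eventually_mono) simp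
  qed
  have 3: "ennreal (c' + e / 2) \<le> ennreal (c' - e / 2) + ennreal e"
  proof (cases "c' - e / 2 \<le> 0")
    case True
    then have "c' + e / 2 \<le> e" by simp
    then have "ennreal (c' + e / 2) \<le> ennreal e" by (rule ennreal_leI)
    also have "\<dots> \<le> ennreal (c' - e / 2) + ennreal e" by (rule add_increasing) auto
    finally show ?thesis .
  next
    case False
    have "ennreal (c' + e / 2) = ennreal ((c' - e / 2) + e)" by (rule arg_cong[where f=ennreal]) simp
    also have "\<dots> = ennreal (c' - e / 2) + ennreal e" using False e by (intro ennreal_plus) auto
    finally show ?thesis by simp
  qed
  have "v n < ennreal e" if "w n < ennreal (c' + e / 2)" "ennreal (c' - e / 2) \<le> u n" for n
  proof (rule ccontr)
    assume "\<not> v n < ennreal e"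
    then have "ennreal e \<le> v n" by (simp only: not_less)
    then have "ennreal (c' - e / 2) + ennreal e \<le> u n + v n" by (rule add_mono[OF that(2)])
    also have "\<dots> \<le> w n" by (rule assms(2))
    finally have "ennreal (c' + e / 2) \<le> w n" using 3 by (rule order_trans[rotated])
    then show False using that(1) by (simp only: leD)
  qed
  then show "\<forall>\<^sub>F n in sequentially. v n < ennreal e"
    by (rule eventually_elim2[OF 1 2])
qed

text \<open>Dominated convergence with a moving majorant. Fatou's lemma for g n - f n shows that the
  integrals of these differences use up, in the limit, the whole integral of h, so nothing is left
  for f n. The majorants enter only through upper bounds w n, as exact convergence of their
  integrals is not known where the lemma is applied.\<close>

lemma pratt_convergence:
  fixes f g :: "nat \<Rightarrow> 'a \<Rightarrow> real"
  assumes [measurable]: "\<And>n. f n \<in> borel_measurable M" "\<And>n. g n \<in> borel_measurable M" "h \<in> borel_measurable M"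
    and bnd: "\<And>n x. x \<in> space M \<Longrightarrow> 0 \<le> f n x" "\<And>n x. x \<in> space M \<Longrightarrow> f n x \<le> g n x"
    and f: "\<And>x. x \<in> space M \<Longrightarrow> (\<lambda>n. f n x) \<longlonglongrightarrow> 0"
    and g: "\<And>x. x \<in> space M \<Longrightarrow> (\<lambda>n. g n x) \<longlonglongrightarrow> h x"
    and w: "\<And>n. (\<integral>\<^sup>+ x. ennreal (g n x) \<partial>M) \<le> w n"
    and int: "w \<longlonglongrightarrow> (\<integral>\<^sup>+ x. ennreal (h x) \<partial>M)" "(\<integral>\<^sup>+ x. ennreal (h x) \<partial>M) < \<infinity>"
  shows "(\<lambda>n. \<integral>\<^sup>+ x. ennreal (f n x) \<partial>M) \<longlonglongrightarrow> 0"
proof (rule liminf_ennreal_add_le[OF _ _ int])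
  have "(\<integral>\<^sup>+ x. ennreal (h x) \<partial>M) = (\<integral>\<^sup>+ x. liminf (\<lambda>n. ennreal (g n x - f n x)) \<partial>M)"
  proof (rule nn_integral_cong)
    fix x assume x: "x \<in> space M"
    have "(\<lambda>n. ennreal (g n x - f n x)) \<longlonglongrightarrow> ennreal (h x - 0)"
      by (intro tendsto_intros f g x)
    then show "ennreal (h x) = liminf (\<lambda>n. ennreal (g n x - f n x))"
      by (simp add: lim_imp_Liminf)
  qed
  also have "\<dots> \<le> liminf (\<lambda>n. \<integral>\<^sup>+ x. ennreal (g n x - f n x) \<partial>M)"
    by (rule nn_integral_liminf) auto
  finally show "(\<integral>\<^sup>+ x. ennreal (h x) \<partial>M) \<le> liminf (\<lambda>n. \<integral>\<^sup>+ x. ennreal (g n x - f n x) \<partial>M)" .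
  show "(\<integral>\<^sup>+ x. ennreal (g n x - f n x) \<partial>M) + (\<integral>\<^sup>+ x. ennreal (f n x) \<partial>M) \<le> w n" for n
    by (rule order_trans[OF _ w], subst nn_integral_add[symmetric])
      (auto simp: ennreal_plus[symmetric] bnd simp del: ennreal_plus intro!: nn_integral_mono)
qed

section \<open>Borel measures on separable metric spaces\<close>

lemma space_borel_of [simp]: "space (borel_of X) = topspace X"
  unfolding borel_of_def by (rule space_measure_of, rule subsetI, rule PowI, rule openin_subset, simp)

lemma sets_borel_of: "sets (borel_of X) = sigma_sets (topspace X) {U. openin X U}"
  unfolding borel_of_def by (rule sets_measure_of, rule subsetI, rule PowI, rule openin_subset, simp)

lemma borel_of_open: "openin X U \<Longrightarrow> U \<in> sets (borel_of X)"
  unfolding sets_borel_of by (rule sigma_sets.Basic) simp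

lemma borel_of_measurable_continuous:
  assumes "continuous_map X Y f"
  shows "f \<in> measurable (borel_of X) (borel_of Y)"
proof (rule measurable_sigma_sets[OF sets_borel_of])
  show "f \<in> space (borel_of X) \<rightarrow> topspace Y" using assms by (auto simp: continuous_map_def)
  show "{U. openin Y U} \<subseteq> Pow (topspace Y)" by (auto intro: openin_subset[THEN subsetD])
  fix U assume "U \<in> {U. openin Y U}"
  then have "openin X {x\<in>topspace X. f x \<in> U}" using assms by (intro openin_continuous_map_preimage) auto
  then show "f -` U \<inter> space (borel_of X) \<in> sets (borel_of X)"
    by (auto dest!: borel_of_open simp: vimage_def Int_def conj_commute)
qed

lemma borel_measurable_borel_of:
  fixes f :: "'a \<Rightarrow> real"
  assumes "continuous_map X euclideanreal f"
  shows "f \<in> borel_measurable (borel_of X)"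
proof (rule borel_measurableI)
  fix S :: "real set" assume "open S"
  then have "openin X {x \<in> topspace X. f x \<in> S}"
    using assms by (intro openin_continuous_map_preimage) auto
  then show "f -` S \<inter> space (borel_of X) \<in> sets (borel_of X)"
    by (auto dest!: borel_of_open simp: vimage_def Int_def conj_commute)
qed

section \<open>Lipschitz test functions and the Borel measures they determine\<close>

context Metric_space
begin

lemma Lipschitz_imp_borel_measurable:
  assumes "\<And>x y. x \<in> M \<Longrightarrow> y \<in> M \<Longrightarrow> \<bar>f x - f y\<bar> \<le> L * d x y"
  shows "(f :: 'a \<Rightarrow> real) \<in> borel_measurable (borel_of mtopology)"
proof (rule borel_measurable_borel_of)
  define L' where "L' = max 1 L"
  have "0 < L'" by (simp add: L'_def)
  have L'_Lip: "\<bar>f x - f y\<bar> \<le> L' * d x y" if "x \<in> M" "y \<in> M" for x y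
    using assms[OF that] mult_right_mono[of L L' "d x y"] by (simp add: L'_def)
  have "\<forall>x\<in>M. \<forall>e>0. \<exists>\<delta>>0. \<forall>y. y \<in> M \<and> d x y < \<delta> \<longrightarrow> dist (f x) (f y) < e"
  proof safe
    fix x and e :: real assume that: "x \<in> M" "0 < e"
    show "\<exists>\<delta>>0. \<forall>y. y \<in> M \<and> d x y < \<delta> \<longrightarrow> dist (f x) (f y) < e"
    proof (intro exI[of _ "e / L'"] conjI allI impI; (elim conjE)?)
      fix y assume y: "y \<in> M" "d x y < e / L'"
      then have "L' * d x y < e" using \<open>0 < L'\<close> by (simp add: pos_less_divide_eq mult.commute)
      then show "dist (f x) (f y) < e" using L'_Lip[of x y] that y by (simp add: dist_real_def)
    qed (use \<open>0 < L'\<close> that in auto)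
  qed
  then show "continuous_map mtopology euclideanreal f"
    using metric_continuous_map[of UNIV dist f] by (simp add: Met_TC.Metric_space_axioms)
qed

text \<open>These functions serve as test functions for weak convergence. The range [0,1] provides
  the constant 1 as a majorant, and the Lipschitz bound controls differences of integrals by the
  mean distance under a coupling.\<close>

definition lipschitz_test :: "('a \<Rightarrow> real) \<Rightarrow> bool" where
  "lipschitz_test \<phi> \<longleftrightarrow> (\<forall>x\<in>M. 0 \<le> \<phi> x \<and> \<phi> x \<le> 1) \<and>
     (\<exists>L. \<forall>x\<in>M. \<forall>y\<in>M. \<bar>\<phi> x - \<phi> y\<bar> \<le> L * d x y)"

lemma lipschitz_test_measurable: "lipschitz_test \<phi> \<Longrightarrow> \<phi> \<in> borel_measurable (borel_of mtopology)"
  unfolding lipschitz_test_def by (blast intro: Lipschitz_imp_borel_measurable)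

lemma dist_measurable: "d a \<in> borel_measurable (borel_of mtopology)" if "a \<in> M"
  using mdist_reverse_triangle[OF _ that] that
  by (intro Lipschitz_imp_borel_measurable[where L=1]) (auto simp: commute)

text \<open>The distance to the complement is multiplied by k and cut off at 1; openness makes it
  positive on U. For U = M the infimum would range over the empty set, hence the separate constant
  function.\<close>

lemma exists_lipschitz_approx_open:
  assumes U: "openin mtopology U"
  obtains \<psi> where "\<And>k. lipschitz_test (\<psi> k)"
    "\<And>x. x \<in> M \<Longrightarrow> (\<lambda>k::nat. \<psi> k x) \<longlonglongrightarrow> indicator U x"
proof (cases "U = M")
  case True
  then show ?thesis
    by (intro that[of "\<lambda>k x. 1"]) (auto simp: lipschitz_test_def intro!: exI[of _ 0])
next
  case False
  define C where "C = M - U"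
  have C: "C \<noteq> {}" "C \<subseteq> M" using False U openin_subset[OF U] by (auto simp: C_def)
  define s where "s x = (INF y\<in>C. d x y)" for x
  have bdd: "bdd_below (d x ` C)" for x by (intro bdd_belowI[of _ 0]) auto
  have s_nonneg: "0 \<le> s x" for x unfolding s_def using C by (intro cINF_greatest) auto
  have s_le: "s x \<le> d x y + s y" if "x \<in> M" "y \<in> M" for x y
  proof -
    have "s x - d x y \<le> d y z" if "z \<in> C" for z
    proof -
      have "s x \<le> d x z" unfolding s_def by (intro cINF_lower bdd that)
      also have "\<dots> \<le> d x y + d y z" using \<open>x \<in> M\<close> \<open>y \<in> M\<close> that C by (intro triangle) auto
      finally show ?thesis by simp
    qed
    then have "s x - d x y \<le> s y" unfolding s_def[of y] using C by (intro cINF_greatest) auto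
    then show ?thesis by simp
  qed
  have s_Lip: "\<bar>s x - s y\<bar> \<le> d x y" if "x \<in> M" "y \<in> M" for x y
    using s_le[OF that] s_le[OF that(2,1)] by (simp add: commute abs_le_iff)
  have s_pos: "0 < s x" if x: "x \<in> U" for x
  proof -
    obtain r where r: "0 < r" "mball x r \<subseteq> U" using U x unfolding openin_mtopology by blast
    have "x \<in> M" using U x unfolding openin_mtopology by blast
    then have "r \<le> d x y" if "y \<in> C" for y
      using r that by (auto simp: C_def not_less[symmetric])
    then have "r \<le> s x" unfolding s_def using C by (intro cINF_greatest) auto
    then show ?thesis using r by simp
  qed
  have s_zero: "s x = 0" if "x \<in> C" for x
  proof -
    have "s x \<le> d x x" unfolding s_def by (intro cINF_lower bdd that)
    then show ?thesis using s_nonneg[of x] C that by auto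
  qed
  define \<psi> where "\<psi> k x = min 1 (real k * s x)" for k x
  show ?thesis
  proof
    fix k
    have "\<bar>\<psi> k x - \<psi> k y\<bar> \<le> real k * d x y" if "x \<in> M" "y \<in> M" for x y
    proof -
      have "\<bar>real k * s x - real k * s y\<bar> \<le> real k * d x y"
        using mult_left_mono[OF s_Lip[OF that], of "real k"]
        by (simp add: abs_mult right_diff_distrib[symmetric])
      then show ?thesis unfolding \<psi>_def by linarith
    qed
    then show "lipschitz_test (\<psi> k)"
      unfolding lipschitz_test_def by (auto simp: \<psi>_def s_nonneg intro!: exI[of _ "real k"])
  next
    fix x assume x: "x \<in> M"
    show "(\<lambda>k. \<psi> k x) \<longlonglongrightarrow> indicator U x"
    proof (cases "x \<in> U")
      case True
      obtain N :: nat where N: "1 / s x < real N" using reals_Archimedean2 by blast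
      have "\<psi> k x = 1" if "N \<le> k" for k
      proof -
        have "1 / s x \<le> real k" using N that by linarith
        then show ?thesis using s_pos[OF True] by (simp add: \<psi>_def pos_divide_le_eq)
      qed
      then show ?thesis using True by (intro tendsto_eventually) (auto simp: eventually_sequentially)
    next
      case False
      then show ?thesis using s_zero[of x] x by (simp add: \<psi>_def C_def)
    qed
  qed
qed

text \<open>Test functions converging to the indicator of an open set give equality on open sets,
  which form an intersection-stable generator of the Borel sets.\<close>

lemma prob_measure_eqI_lipschitz_test:
  assumes sets: "sets \<mu> = sets (borel_of mtopology)" "sets \<nu> = sets (borel_of mtopology)"
    and prob: "prob_space \<mu>" "prob_space \<nu>"
    and eq: "\<And>\<phi>. lipschitz_test \<phi> \<Longrightarrow> (\<integral>x. \<phi> x \<partial>\<mu>) = (\<integral>x. \<phi> x \<partial>\<nu>)"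
  shows "\<mu> = \<nu>"
proof -
  have open_eq: "emeasure \<mu> U = emeasure \<nu> U" if U: "openin mtopology U" for U
  proof -
    obtain \<psi> where \<psi>: "\<And>k. lipschitz_test (\<psi> k)" "\<And>x. x \<in> M \<Longrightarrow> (\<lambda>k. \<psi> k x) \<longlonglongrightarrow> indicator U x"
      using exists_lipschitz_approx_open[OF U] by blast
    have lim: "(\<lambda>k. \<integral>x. \<psi> k x \<partial>\<kappa>) \<longlonglongrightarrow> measure \<kappa> U"
      if \<kappa>: "sets \<kappa> = sets (borel_of mtopology)" "prob_space \<kappa>" for \<kappa>
    proof -
      interpret prob_space \<kappa> by fact
      have [measurable_cong]: "sets \<kappa> = sets (borel_of mtopology)" by fact
      have sp: "space \<kappa> = M" using sets_eq_imp_space_eq[OF \<kappa>(1)] by simp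
      have [measurable]: "U \<in> sets \<kappa>" using borel_of_open[OF U] \<kappa> by simp
      have [measurable]: "\<psi> k \<in> borel_measurable \<kappa>" for k
        using lipschitz_test_measurable[OF \<psi>(1)] by measurable
      have "(\<lambda>k. \<integral>x. \<psi> k x \<partial>\<kappa>) \<longlonglongrightarrow> (\<integral>x. indicator U x \<partial>\<kappa>)"
        using \<psi> by (intro integral_dominated_convergence[where w="\<lambda>_. 1"])
          (auto simp: sp lipschitz_test_def)
      then show ?thesis by simp
    qed
    have "measure \<mu> U = measure \<nu> U"
      using lim[OF sets(1) prob(1)] lim[OF sets(2) prob(2)] eq[OF \<psi>(1)] LIMSEQ_unique by simp
    then show ?thesis
      using prob by (simp add: finite_measure.emeasure_eq_measure prob_space.finite_measure)
  qed
  show ?thesis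
  proof (rule measure_eqI_generator_eq[where E="{U. openin mtopology U}" and \<Omega>=M and A="\<lambda>_. M"])
    show "Int_stable {U. openin mtopology U}" by (auto simp: Int_stable_def)
    show "emeasure \<mu> M \<noteq> \<infinity>" using prob by (simp add: finite_measure.emeasure_eq_measure prob_space.finite_measure)
    show "{U. openin mtopology U} \<subseteq> Pow M" using openin_subset[of mtopology] by auto
  qed (use sets open_eq in \<open>auto simp: sets_borel_of\<close>)
qed

end

section \<open>Separability: countable bases of balls and joint measurability of the
  distance\<close>

locale separable_metric = Metric_space +
  assumes separable: "separable_space mtopology" and nonempty: "M \<noteq> {}"
begin

lemma dense_sequence:
  obtains a :: "nat \<Rightarrow> 'a" where "\<And>i. a i \<in> M" "\<And>x e. x \<in> M \<Longrightarrow> 0 < e \<Longrightarrow> \<exists>i. d x (a i) < e"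
proof -
  obtain C where C: "countable C" "C \<subseteq> M" "mtopology closure_of C = M"
    using separable by (auto simp: separable_space_def)
  have "C \<noteq> {}" using C nonempty by auto
  then have r: "range (from_nat_into C) = C" using C(1) by (rule range_from_nat_into)
  show ?thesis
  proof
    show "from_nat_into C i \<in> M" for i using r C(2) by auto
    fix x and e :: real assume "x \<in> M" "0 < e"
    then obtain y where "y \<in> C" "d x y < e"
      using C(3) by (auto simp: metric_closure_of)
    then show "\<exists>i. d x (from_nat_into C i) < e" using r by (metis imageE)
  qed
qed

lemma openin_eq_countable_Union_mball:
  assumes a: "\<And>i. a i \<in> M" "\<And>x e. x \<in> M \<Longrightarrow> 0 < e \<Longrightarrow> \<exists>i. d x (a i) < e"
    and U: "openin mtopology U"
  shows "U = (\<Union>(i, n)\<in>{(i :: nat, n :: nat). mball (a i) (1 / Suc n) \<subseteq> U}. mball (a i) (1 / Suc n))"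
    (is "U = ?R")
proof (intro equalityI subsetI)
  fix x assume x: "x \<in> U"
  obtain r where r: "0 < r" "mball x r \<subseteq> U" using U x unfolding openin_mtopology by blast
  have xM: "x \<in> M" using U x unfolding openin_mtopology by blast
  obtain n :: nat where n: "1 / Suc n < r / 2"
    using r nat_approx_posE[of "r / 2"] by auto
  obtain i where i: "d x (a i) < 1 / Suc n" using a(2)[OF xM, of "1 / Suc n"] by auto
  have "mball (a i) (1 / Suc n) \<subseteq> mball x r"
    using i n xM a(1) by (intro mball_subset) (auto simp: commute)
  then show "x \<in> ?R" using r i xM a(1) by (auto simp: commute intro!: bexI[of _ "(i, n)"])
qed auto

text \<open>An open set is a countable union of balls around a dense sequence, so its preimage is a
  countable union of sublevel sets of distances to fixed points.\<close>

lemma measurable_borel_of_dist: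
  assumes f: "f \<in> space N \<rightarrow> M" and [measurable]: "\<And>a. a \<in> M \<Longrightarrow> (\<lambda>x. d a (f x)) \<in> borel_measurable N"
  shows "f \<in> measurable N (borel_of mtopology)"
proof -
  obtain a where a: "\<And>i. a i \<in> M" "\<And>x e. x \<in> M \<Longrightarrow> 0 < e \<Longrightarrow> \<exists>i :: nat. d x (a i) < e"
    using dense_sequence by blast
  show ?thesis
  proof (rule measurable_sigma_sets[OF sets_borel_of])
    fix U assume "U \<in> {U. openin mtopology U}"
    then have U: "openin mtopology U" by simp
    have "f -` U \<inter> space N =
        (\<Union>(i, n)\<in>{(i, n). mball (a i) (1 / Suc n) \<subseteq> U}. {x \<in> space N. d (a i) (f x) < 1 / Suc n})"
    proof -
      have "f x \<in> U \<longleftrightarrow> (\<exists>i n. mball (a i) (1 / Suc n) \<subseteq> U \<and> d (a i) (f x) < 1 / Suc n)" if "x \<in> space N" for x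
        using funcset_mem[OF f that] a(1) arg_cong[OF openin_eq_countable_Union_mball[OF a U], of "\<lambda>U. f x \<in> U"]
        by (simp only: in_mball UN_iff case_prod_unfold Bex_def mem_Collect_eq split_paired_Ex fst_conv snd_conv simp_thms)
      then show ?thesis by auto
    qed
    also have "\<dots> \<in> sets N"
    proof -
      have [measurable]: "(\<lambda>x. d (a i) (f x)) \<in> borel_measurable N" for i using a(1) assms(2) by blast
      show ?thesis by (intro sets.countable_UN'') (auto simp: case_prod_unfold)
    qed
    finally show "f -` U \<inter> space N \<in> sets N" .
  qed (use f openin_subset[of mtopology] in auto)
qed

text \<open>The distance of two points is below r exactly if the detour through some point of the
  dense sequence is. This separates the two variables and yields measurability for the product
  sigma-algebra, not merely for the Borel sets of the product.\<close>

lemma dist_measurable_comp: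
  assumes [measurable]: "f \<in> measurable N (borel_of mtopology)" "g \<in> measurable N (borel_of mtopology)"
  shows "(\<lambda>x. d (f x) (g x)) \<in> borel_measurable N"
proof (rule borel_measurableI_less)
  obtain a where a: "\<And>i. a i \<in> M" "\<And>x e. x \<in> M \<Longrightarrow> 0 < e \<Longrightarrow> \<exists>i :: nat. d x (a i) < e"
    using dense_sequence by blast
  have [measurable]: "d (a i) \<in> borel_measurable (borel_of mtopology)" for i
    using a by (intro dist_measurable)
  have fg: "f x \<in> M" "g x \<in> M" if "x \<in> space N" for x
    using assms[THEN measurable_space, OF that] by auto
  fix r
  have "{x \<in> space N. d (f x) (g x) < r} = {x \<in> space N. \<exists>i. d (a i) (f x) + d (a i) (g x) < r}"
  proof (intro Collect_cong conj_cong refl iffI)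
    fix x assume x: "x \<in> space N" "d (f x) (g x) < r"
    then obtain i where i: "d (f x) (a i) < (r - d (f x) (g x)) / 2"
      using a(2)[OF fg(1)[OF x(1)], of "(r - d (f x) (g x)) / 2"] by auto
    moreover have "d (a i) (g x) \<le> d (f x) (a i) + d (f x) (g x)"
      using triangle[of "a i" "f x" "g x"] fg[OF x(1)] a(1) by (simp add: commute)
    ultimately have "d (a i) (f x) + d (a i) (g x) < r" by (simp add: commute)
    then show "\<exists>i. d (a i) (f x) + d (a i) (g x) < r" ..
  next
    fix x assume x: "x \<in> space N" "\<exists>i. d (a i) (f x) + d (a i) (g x) < r"
    then obtain i where "d (a i) (f x) + d (a i) (g x) < r" by blast
    then show "d (f x) (g x) < r"
      using triangle[of "f x" "a i" "g x"] fg[OF x(1)] a(1) by (simp add: commute)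
  qed
  also have "\<dots> \<in> sets N" by measurable
  finally show "{x \<in> space N. d (f x) (g x) < r} \<in> sets N" .
qed

lemma measurable_limitin:
  assumes f: "\<And>n. f n \<in> measurable N (borel_of mtopology)"
    and lim: "\<And>x. x \<in> space N \<Longrightarrow> limitin mtopology (\<lambda>n. f n x) (g x) sequentially"
  shows "g \<in> measurable N (borel_of mtopology)"
proof (rule measurable_borel_of_dist)
  show "g \<in> space N \<rightarrow> M" using lim limitin_mspace by blast
  fix a assume a: "a \<in> M"
  have [measurable]: "d a \<in> borel_measurable (borel_of mtopology)" using a by (rule dist_measurable)
  note f[measurable]
  show "(\<lambda>x. d a (g x)) \<in> borel_measurable N"
  proof (rule borel_measurable_LIMSEQ_real)
    fix x assume x: "x \<in> space N"
    show "(\<lambda>n. d a (f n x)) \<longlonglongrightarrow> d a (g x)"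
    proof (rule metric_tendsto_imp_tendsto[where f="\<lambda>n. d (f n x) (g x)" and a=0])
      show "(\<lambda>n. d (f n x) (g x)) \<longlonglongrightarrow> 0" using lim[OF x] by (simp add: limitin_metric_dist_null)
      show "\<forall>\<^sub>F n in sequentially. dist (d a (f n x)) (d a (g x)) \<le> dist (d (f n x) (g x)) 0"
      proof (intro always_eventually allI)
        fix n
        have "f n x \<in> M" using measurable_space[OF f x] by simp
        then show "dist (d a (f n x)) (d a (g x)) \<le> dist (d (f n x) (g x)) 0"
          using mdist_reverse_triangle[of "f n x" a "g x"] limitin_mspace[OF lim[OF x]] a
          by (simp add: dist_real_def commute[of "f n x" a])
      qed
    qed
  qed measurable
qed

end

section \<open>Skorohod representation on proper metric spaces\<close>

text \<open>A Cantor-type code: only the digits 0 and 1 occur in base 3. The resulting gaps let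
  digits be read off from approximate values, which binary expansions would not permit because of
  0111... and 1000... .\<close>

definition ternary :: "(nat \<Rightarrow> bool) \<Rightarrow> real" where
  "ternary b = (\<Sum>k. of_bool (b k) * (1 / 3) ^ Suc k)"

lemma geometric_third: "(\<lambda>k. (1 / 3 :: real) ^ Suc k) sums (1 / 2)"
  using sums_mult[OF geometric_sums[of "1/3 :: real"], of "1/3"] by simp

lemma summable_ternary: "summable (\<lambda>k. of_bool (b k) * (1 / 3 :: real) ^ Suc k)"
  by (rule summable_comparison_test'[OF sums_summable[OF geometric_third], of 0]) auto

lemma ternary_bounds: "0 \<le> ternary b" "ternary b \<le> 1 / 2"
proof -
  show "0 \<le> ternary b" unfolding ternary_def by (intro suminf_nonneg summable_ternary) auto
  have "ternary b \<le> (\<Sum>k. (1 / 3 :: real) ^ Suc k)"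
    unfolding ternary_def
    by (intro suminf_le summable_ternary sums_summable[OF geometric_third]) auto
  then show "ternary b \<le> 1 / 2" using sums_unique[OF geometric_third] by simp
qed

text \<open>The first differing digit j contributes \<open>(1 / 3) ^ Suc j\<close>, and all later
  digits together can cancel at most half of that.\<close>

lemma ternary_diff_ge:
  assumes "b j \<noteq> c j" "\<And>i. i < j \<Longrightarrow> b i = c i"
  shows "(1 / 3) ^ Suc j / 2 \<le> \<bar>ternary b - ternary c\<bar>"
proof -
  define e where "e k = (of_bool (b k) - of_bool (c k) :: real) * (1 / 3) ^ Suc k" for k
  have sm: "summable e"
    unfolding e_def left_diff_distrib by (intro summable_diff summable_ternary)
  have "ternary b - ternary c = suminf e"
    unfolding ternary_def e_def left_diff_distrib by (intro suminf_diff summable_ternary)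
  also have "\<dots> = (\<Sum>k. e (k + Suc j)) + (\<Sum>k<Suc j. e k)"
    by (rule suminf_split_initial_segment[OF sm])
  also have "(\<Sum>k<Suc j. e k) = e j"
    using assms(2) by (simp add: e_def)
  finally have 1: "ternary b - ternary c = (\<Sum>k. e (k + Suc j)) + e j" .
  have e_le: "norm (e (k + Suc j)) \<le> (1 / 3) ^ Suc j * (1 / 3) ^ Suc k" for k
    by (auto simp: e_def power_add algebra_simps)
  have s: "(\<lambda>k. (1 / 3) ^ Suc j * (1 / 3 :: real) ^ Suc k) sums ((1 / 3) ^ Suc j * (1 / 2))"
    by (intro sums_mult geometric_third)
  have "norm (\<Sum>k. e (k + Suc j)) \<le> (1 / 3) ^ Suc j * (1 / 2)"
    using e_le s by (metis (no_types, lifting) norm_suminf_le sums_summable sums_unique)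
  moreover have "\<bar>e j\<bar> = (1 / 3) ^ Suc j"
    using assms(1) by (auto simp: e_def)
  ultimately show ?thesis unfolding 1 real_norm_def by linarith
qed

lemma ternary_close_imp_eq:
  assumes "\<bar>ternary b - ternary c\<bar> < (1 / 3) ^ Suc k / 2" "j \<le> k"
  shows "b j = c j"
proof (rule ccontr)
  assume ne: "b j \<noteq> c j"
  define i where "i = (LEAST i. b i \<noteq> c i)"
  have i: "b i \<noteq> c i" "i \<le> j" "\<And>l. l < i \<Longrightarrow> b l = c l"
    using LeastI[of "\<lambda>i. b i \<noteq> c i", OF ne] Least_le[of "\<lambda>i. b i \<noteq> c i", OF ne]
      not_less_Least[of _ "\<lambda>i. b i \<noteq> c i"] unfolding i_def by blast+
  have "(1 / 3 :: real) ^ Suc k \<le> (1 / 3) ^ Suc i"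
    using i assms(2) by (intro power_decreasing) auto
  with ternary_diff_ge[of b i c, OF i(1,3)] assms(1) show False by linarith
qed

section \<open>Proper spaces, their coding by real numbers, and almost sure representations\<close>

locale proper_metric = separable_metric +
  assumes proper: "x \<in> M \<Longrightarrow> compactin mtopology (mcball x r)"
begin

lemma mcomplete_mspace: "mcomplete"
  unfolding mcomplete_def
proof (intro allI impI)
  fix \<sigma> assume \<sigma>: "MCauchy \<sigma>"
  obtain x R where xR: "range \<sigma> \<subseteq> mcball x R"
    using MCauchy_imp_mbounded[OF \<sigma>] mbounded_def by blast
  have "\<sigma> 0 \<in> mcball x R" using xR by blast
  then have "x \<in> M" by simp
  from proper[OF this, of R] xR obtain l r where "strict_mono r" "limitin mtopology (\<sigma> \<circ> r) l sequentially"
    unfolding compactin_sequentially by blast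
  then show "\<exists>x. limitin mtopology \<sigma> x sequentially"
    using MCauchy_convergent_subsequence[OF \<sigma>] by blast
qed

text \<open>The integer part of the code records the distance to the base point, its ternary digits record
  membership in a countable base of balls. As balls are relatively compact, a sequence whose codes
  converge is Cauchy, although the set of codes need not be closed.\<close>

lemma exists_real_code:
  assumes x0: "x0 \<in> M"
  obtains h :: "'a \<Rightarrow> real" and g :: "real \<Rightarrow> 'a"
  where "h \<in> borel_measurable (borel_of mtopology)" "g \<in> measurable borel (borel_of mtopology)"
    "\<And>x. x \<in> M \<Longrightarrow> d x0 x - 1 \<le> h x" "\<And>x. x \<in> M \<Longrightarrow> h x \<le> d x0 x + 1"
    "\<And>x. x \<in> M \<Longrightarrow> g (h x) = x"
    "\<And>\<sigma>. range \<sigma> \<subseteq> M \<Longrightarrow> convergent (\<lambda>n. h (\<sigma> n)) \<Longrightarrow> \<exists>x. limitin mtopology \<sigma> x sequentially"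
proof -
  obtain a where a: "\<And>i. a i \<in> M" "\<And>x e. x \<in> M \<Longrightarrow> 0 < e \<Longrightarrow> \<exists>i :: nat. d x (a i) < e"
    using dense_sequence by blast
  \<comment> \<open>The pairing function lists all balls with a centre in the dense sequence and a
    radius 1/(n+1), so that \<open>prod_encode (i, m)\<close> is the index of the ball of radius
    1/(m+1) around \<open>a i\<close>.\<close>
  define B where "B k = mball (a (fst (prod_decode k))) (1 / Suc (snd (prod_decode k)))" for k
  define h where "h x = of_int \<lfloor>d x0 x\<rfloor> + ternary (\<lambda>k. x \<in> B k)" for x
  have [measurable]: "B k \<in> sets (borel_of mtopology)" for k
    unfolding B_def by (intro borel_of_open openin_mball)
  have [measurable]: "d x0 \<in> borel_measurable (borel_of mtopology)"
    using x0 by (rule dist_measurable)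
  have h_meas: "h \<in> borel_measurable (borel_of mtopology)"
    unfolding h_def ternary_def by measurable
  \<comment> \<open>The digit parts lie in [0, 1/2] and the codes differ by less than 1/6, so the
    integer parts differ by less than 1 and coincide. The digit parts are then as close as the
    codes, and the digits up to k agree.\<close>
  have h_close: "\<lfloor>d x0 x\<rfloor> = \<lfloor>d x0 y\<rfloor>" "\<And>j. j \<le> k \<Longrightarrow> x \<in> B j \<longleftrightarrow> y \<in> B j"
    if "\<bar>h x - h y\<bar> < (1 / 3) ^ Suc k / 2" for x y k
  proof -
    have "(1 / 3 :: real) ^ Suc k \<le> 1 / 3"
      using power_decreasing[of 1 "Suc k" "1 / 3 :: real"] by simp
    then have "\<bar>of_int \<lfloor>d x0 x\<rfloor> - of_int \<lfloor>d x0 y\<rfloor> :: real\<bar> < 1"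
      using that ternary_bounds[of "\<lambda>k. x \<in> B k"] ternary_bounds[of "\<lambda>k. y \<in> B k"]
      unfolding h_def by linarith
    then show fl: "\<lfloor>d x0 x\<rfloor> = \<lfloor>d x0 y\<rfloor>" by linarith
    show "x \<in> B j \<longleftrightarrow> y \<in> B j" if "j \<le> k" for j
      using ternary_close_imp_eq[of "\<lambda>k. x \<in> B k" "\<lambda>k. y \<in> B k" k j] that fl
        \<open>\<bar>h x - h y\<bar> < (1 / 3) ^ Suc k / 2\<close> by (simp add: h_def)
  qed

  \<comment> \<open>The image of \<open>B k\<close> under h need not be visibly Borel; this open
    neighbourhood is, and by the gaps in the code it contains no code of a point outside
    \<open>B k\<close>.\<close>
  define T where "T k = (\<Union>x\<in>B k. ball (h x) ((1 / 3) ^ Suc k / 2))" for k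
  have [measurable]: "T k \<in> sets borel" for k
    unfolding T_def by (intro borel_open open_UN ballI open_ball)
  have T_iff: "h x \<in> T k \<longleftrightarrow> x \<in> B k" for x k
  proof
    assume "h x \<in> T k"
    then obtain y where "y \<in> B k" "\<bar>h y - h x\<bar> < (1 / 3) ^ Suc k / 2"
      by (auto simp: T_def dist_real_def)
    then show "x \<in> B k" using h_close(2)[of y x k k] by blast
  next
    assume "x \<in> B k"
    then show "h x \<in> T k" unfolding T_def by (intro UN_I[of x]) simp_all
  qed
  \<comment> \<open>On a code this reads off the first point of the dense sequence within 1/(m+1) of
    the coded point. On other reals it is some arbitrary index, and \<open>G m t\<close> still lies
    in M.\<close>
  define idx where "idx m t = (LEAST i. t \<in> T (prod_encode (i, m)))" for m t
  define G where "G m t = a (idx m t)" for m t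
  have idx_meas: "idx m \<in> measurable borel (count_space UNIV)" for m
    unfolding idx_def by measurable
  have G_meas[measurable]: "G m \<in> measurable borel (borel_of mtopology)" for m
    unfolding G_def by (rule measurable_compose[OF idx_meas]) (simp add: a)
  have G_M: "G m t \<in> M" for m t by (simp add: G_def a)
  have G_near: "d (G m (h x)) x < 1 / Suc m" if x: "x \<in> M" for x m
  proof -
    obtain i where "d x (a i) < 1 / Suc m" using a(2)[OF x, of "1 / Suc m"] by auto
    then have "h x \<in> T (prod_encode (i, m))"
      using x a(1) by (simp add: T_iff B_def commute)
    then have "h x \<in> T (prod_encode (idx m (h x), m))" unfolding idx_def by (rule LeastI)
    then show ?thesis by (simp add: T_iff B_def G_def)
  qed
  \<comment> \<open>A Borel condition that all codes satisfy and that makes the decoded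
    approximations a Cauchy sequence. It takes the place of the range of h; outside D the decoder g
    takes the default value \<open>x0\<close>.\<close>
  define D where "D = {t. \<forall>m n. d (G m t) (G n t) \<le> 1 / Suc m + 1 / Suc n}"
  have [measurable]: "(\<lambda>t. d (G m t) (G n t)) \<in> borel_measurable borel" for m n
    by (rule dist_measurable_comp) measurable
  have D_meas[measurable]: "D \<in> sets borel"
    unfolding D_def by measurable
  have lim_ex: "\<exists>l. limitin mtopology (\<lambda>m. G m t) l sequentially" if "t \<in> D" for t
  proof -
    have "MCauchy (\<lambda>m. G m t)"
      unfolding MCauchy_def
    proof (intro conjI allI impI)
      fix e :: real assume "0 < e"
      then obtain N where N: "1 / Suc N < e / 2" using nat_approx_posE[of "e / 2"] by auto
      show "\<exists>N. \<forall>n n'. N \<le> n \<longrightarrow> N \<le> n' \<longrightarrow> d (G n t) (G n' t) < e"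
      proof (intro exI[of _ N] allI impI)
        fix n n' assume "N \<le> n" "N \<le> n'"
        then have "1 / Suc n \<le> 1 / Suc N" "1 / Suc n' \<le> 1 / Suc N" by (auto intro!: divide_left_mono)
        moreover have "d (G n t) (G n' t) \<le> 1 / Suc n + 1 / Suc n'" using that unfolding D_def by blast
        ultimately show "d (G n t) (G n' t) < e" using N by linarith
      qed
    qed (use G_M in auto)
    then show ?thesis using mcomplete_mspace mcomplete_def by blast
  qed
  define g where "g t = (if t \<in> D then (SOME l. limitin mtopology (\<lambda>m. G m t) l sequentially) else x0)" for t
  have g_lim: "limitin mtopology (\<lambda>m. if t \<in> D then G m t else x0) (g t) sequentially" for t
    using someI_ex[OF lim_ex, of t] x0 by (simp add: g_def)
  have x0_meas: "(\<lambda>t. x0) \<in> measurable borel (borel_of mtopology)"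
    using x0 by (intro measurable_const) simp
  have g_meas: "g \<in> measurable borel (borel_of mtopology)"
  proof (rule measurable_limitin[OF _ g_lim])
    show "(\<lambda>t. if t \<in> D then G m t else x0) \<in> measurable borel (borel_of mtopology)" for m
      by (intro measurable_If_set G_meas x0_meas) simp
  qed
  have gh: "g (h x) = x" if "x \<in> M" for x
  proof -
    have "h x \<in> D"
      unfolding D_def
    proof safe
      fix m n
      have "d (G m (h x)) (G n (h x)) \<le> d (G m (h x)) x + d (G n (h x)) x"
        by (intro triangle' G_M that)
      then show "d (G m (h x)) (G n (h x)) \<le> 1 / Suc m + 1 / Suc n"
        using G_near[OF that, of m] G_near[OF that, of n] by linarith
    qed
    then have 1: "limitin mtopology (\<lambda>m. G m (h x)) (g (h x)) sequentially"
      using g_lim[of "h x"] by simp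
    have "(\<lambda>m. d (G m (h x)) x) \<longlonglongrightarrow> 0"
      by (rule tendsto_sandwich[OF _ _ tendsto_const LIMSEQ_inverse_real_of_nat])
        (use G_near[OF that] in \<open>auto intro!: always_eventually less_imp_le simp: inverse_eq_divide\<close>)
    then have "limitin mtopology (\<lambda>m. G m (h x)) x sequentially"
      using that G_M by (simp add: limitin_metric_dist_null)
    then show ?thesis using limitin_metric_unique[OF 1] by simp
  qed
  have conv: "\<exists>x. limitin mtopology \<sigma> x sequentially"
    if \<sigma>: "range \<sigma> \<subseteq> M" and c: "convergent (\<lambda>n. h (\<sigma> n))" for \<sigma>
  proof -
    have near: "\<exists>N. \<forall>n\<ge>N. \<forall>n'\<ge>N. \<bar>h (\<sigma> n) - h (\<sigma> n')\<bar> < (1 / 3) ^ Suc k / 2" for k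
    proof -
      have "0 < (1 / 3 :: real) ^ Suc k / 2" by simp
      with convergent_Cauchy[OF c] show ?thesis unfolding Cauchy_def dist_real_def by blast
    qed
    obtain N0 where N0: "\<And>n n'. N0 \<le> n \<Longrightarrow> N0 \<le> n' \<Longrightarrow> \<bar>h (\<sigma> n) - h (\<sigma> n')\<bar> < (1 / 3) ^ Suc 0 / 2"
      using near[of 0] by blast
    define C where "C = mcball x0 (of_int \<lfloor>d x0 (\<sigma> N0)\<rfloor> + 1)"
    have in_C: "\<sigma> n \<in> C" if "N0 \<le> n" for n
    proof -
      have "\<lfloor>d x0 (\<sigma> n)\<rfloor> = \<lfloor>d x0 (\<sigma> N0)\<rfloor>" using h_close(1)[OF N0[OF that order_refl]] .
      then have "d x0 (\<sigma> n) \<le> of_int \<lfloor>d x0 (\<sigma> N0)\<rfloor> + 1" by linarith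
      then show ?thesis using \<sigma> x0 by (auto simp: C_def)
    qed
    have "MCauchy \<sigma>"
      unfolding MCauchy_def
    proof (intro conjI allI impI \<sigma>)
      fix e :: real assume "0 < e"
      then obtain m where m: "1 / Suc m < e / 2" using nat_approx_posE[of "e / 2"] by auto
      \<comment> \<open>From \<open>N0\<close> on all points share one integer part and lie in the
        compact ball C. Finitely many balls of radius 1/(m+1) cover C; once the codes agree in all
        digits up to their largest index K, the sequence cannot leave the ball containing
        \<open>\<sigma> N\<close>.\<close>
      have cov: "C \<subseteq> \<Union> ((\<lambda>i. B (prod_encode (i, m))) ` UNIV)"
      proof
        fix x assume "x \<in> C"
        then have x: "x \<in> M" by (simp add: C_def)
        obtain i where "d x (a i) < 1 / Suc m" using a(2)[OF x, of "1 / Suc m"] by auto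
        then show "x \<in> \<Union> ((\<lambda>i. B (prod_encode (i, m))) ` UNIV)"
          using x a(1) by (auto simp: B_def commute)
      qed
      have "compactin mtopology C" unfolding C_def by (rule proper[OF x0])
      moreover have "openin mtopology U" if "U \<in> (\<lambda>i. B (prod_encode (i, m))) ` UNIV" for U
        using that by (auto simp: B_def)
      ultimately obtain \<F> where \<F>: "finite \<F>" "\<F> \<subseteq> (\<lambda>i. B (prod_encode (i, m))) ` UNIV" "C \<subseteq> \<Union> \<F>"
        using cov unfolding compactin_def by meson
      then obtain F where F: "finite F" "\<F> = (\<lambda>i. B (prod_encode (i, m))) ` F"
        by (meson finite_subset_image)
      obtain K where K: "\<And>i. i \<in> F \<Longrightarrow> prod_encode (i, m) \<le> K"
        using finite_nat_set_iff_bounded_le[of "(\<lambda>i. prod_encode (i, m)) ` F"] F(1) by auto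
      obtain N1 where N1: "\<And>n n'. N1 \<le> n \<Longrightarrow> N1 \<le> n' \<Longrightarrow> \<bar>h (\<sigma> n) - h (\<sigma> n')\<bar> < (1 / 3) ^ Suc K / 2"
        using near[of K] by blast
      define N where "N = max N0 N1"
      obtain i where i: "i \<in> F" "\<sigma> N \<in> B (prod_encode (i, m))"
        using in_C[of N] \<F>(3) F(2) by (auto simp: N_def)
      have "\<sigma> n \<in> B (prod_encode (i, m))" if "N \<le> n" for n
        using h_close(2)[OF N1 K[OF i(1)], of n N] that i(2) by (simp add: N_def)
      then have near_a: "d (a i) (\<sigma> n) < 1 / Suc m" if "N \<le> n" for n
        using that by (auto simp: B_def)
      show "\<exists>N. \<forall>n n'. N \<le> n \<longrightarrow> N \<le> n' \<longrightarrow> d (\<sigma> n) (\<sigma> n') < e"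
      proof (intro exI[of _ N] allI impI)
        fix n n' assume "N \<le> n" "N \<le> n'"
        moreover have "\<sigma> n \<in> M" "\<sigma> n' \<in> M" using \<sigma> by auto
        ultimately show "d (\<sigma> n) (\<sigma> n') < e"
          using near_a[of n] near_a[of n'] triangle''[of "\<sigma> n" "a i" "\<sigma> n'"] a(1)[of i] m by linarith
      qed
    qed
    then show ?thesis using mcomplete_mspace mcomplete_def by blast
  qed
  show ?thesis
  proof (rule that[OF h_meas g_meas _ _ gh conv])
    fix x
    show "d x0 x - 1 \<le> h x"
      using ternary_bounds[of "\<lambda>k. x \<in> B k"] unfolding h_def by linarith
    show "h x \<le> d x0 x + 1"
      using ternary_bounds[of "\<lambda>k. x \<in> B k"] unfolding h_def by linarith
  qed
qed

text \<open>The laws are pushed forward by the code h, represented on one probability space after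
  extraction of a subsequence, and pulled back by g. No continuity of g enters: convergence of the
  codes along a path already forces convergence of the coded points. Redefining the variables as
  \<open>x0\<close> on a null set makes the convergence hold at every point.\<close>

theorem tight_imp_skorohod_representation:
  fixes \<mu> :: "nat \<Rightarrow> 'a measure"
  assumes sets: "\<And>n. sets (\<mu> n) = sets (borel_of mtopology)" and prob: "\<And>n. prob_space (\<mu> n)"
    and x0: "x0 \<in> M"
    and tight: "\<And>e. 0 < e \<Longrightarrow> \<exists>R. \<forall>n. measure (\<mu> n) {x\<in>M. R < d x0 x} < e"
  obtains r :: "nat \<Rightarrow> nat" and \<Omega> :: "real measure" and X Y where
    "strict_mono r" "prob_space \<Omega>"
    "\<And>n. X n \<in> measurable \<Omega> (borel_of mtopology)" "Y \<in> measurable \<Omega> (borel_of mtopology)"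
    "\<And>n. distr \<Omega> (borel_of mtopology) (X n) = \<mu> (r n)"
    "\<And>w. w \<in> space \<Omega> \<Longrightarrow> limitin mtopology (\<lambda>n. X n w) (Y w) sequentially"
proof -
  obtain h :: "'a \<Rightarrow> real" and g :: "real \<Rightarrow> 'a"
    where h[measurable]: "h \<in> borel_measurable (borel_of mtopology)"
      and g[measurable]: "g \<in> measurable borel (borel_of mtopology)"
    and h_bnd: "\<And>x. x \<in> M \<Longrightarrow> d x0 x - 1 \<le> h x" "\<And>x. x \<in> M \<Longrightarrow> h x \<le> d x0 x + 1"
    and gh: "\<And>x. x \<in> M \<Longrightarrow> g (h x) = x"
    and conv: "\<And>\<sigma>. range \<sigma> \<subseteq> M \<Longrightarrow> convergent (\<lambda>n. h (\<sigma> n)) \<Longrightarrow> \<exists>x. limitin mtopology \<sigma> x sequentially"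
    using exists_real_code[OF x0] by metis
  note [measurable_cong] = sets
  have sp: "space (\<mu> n) = M" for n using sets_eq_imp_space_eq[OF sets] by simp
  have hm[measurable]: "h \<in> borel_measurable (\<mu> n)" for n by measurable
  define \<nu> where "\<nu> n = distr (\<mu> n) borel h" for n
  have rd: "real_distribution (\<nu> n)" for n
    unfolding \<nu>_def real_distribution_def real_distribution_axioms_def
    using prob_space.prob_space_distr[OF prob hm] by simp
  have "tight \<nu>"
    unfolding tight_def
  proof (intro conjI allI impI rd)
    fix e :: real assume "0 < e"
    then obtain R where R: "\<And>n. measure (\<mu> n) {x\<in>M. R < d x0 x} < e" using tight by blast
    have [measurable]: "d x0 \<in> borel_measurable (borel_of mtopology)" using x0 by (rule dist_measurable)
    show "\<exists>a b. a < b \<and> (\<forall>n. 1 - e < measure (\<nu> n) {a<..b})"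
    proof (intro exI conjI allI)
      \<comment> \<open>As h differs from the distance to \<open>x0\<close> by at most 1, points at
        distance at most R have codes in [-1, R + 1]. The interval is open on the left, hence -2,
        and \<open>max 0 R\<close> keeps it nondegenerate.\<close>
      show "(-2 :: real) < max 0 R + 1" by linarith
      fix n
      interpret prob_space "\<mu> n" by (rule prob)
      have Rset: "{x\<in>M. R < d x0 x} \<in> sets (\<mu> n)"
      proof -
        have "{x\<in>space (\<mu> n). R < d x0 x} \<in> sets (\<mu> n)" by measurable
        then show ?thesis by (simp add: sp)
      qed
      have "1 - e < 1 - prob {x\<in>M. R < d x0 x}" using R[of n] by simp
      also have "\<dots> = prob (space (\<mu> n) - {x\<in>M. R < d x0 x})"
        using Rset by (simp add: prob_compl)
      also have "\<dots> \<le> prob (h -` {-2<..max 0 R + 1} \<inter> space (\<mu> n))"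
      proof (rule finite_measure_mono)
        show "space (\<mu> n) - {x\<in>M. R < d x0 x} \<subseteq> h -` {-2<..max 0 R + 1} \<inter> space (\<mu> n)"
        proof
          fix x assume "x \<in> space (\<mu> n) - {x\<in>M. R < d x0 x}"
          then have x: "x \<in> M" "d x0 x \<le> R" by (auto simp: sp)
          have "-2 < h x" "h x \<le> max 0 R + 1" using h_bnd[OF x(1)] x(2) nonneg[of x0 x] by linarith+
          then show "x \<in> h -` {-2<..max 0 R + 1} \<inter> space (\<mu> n)"
            using x by (simp add: sp)
        qed
      qed measurable
      also have "\<dots> = measure (\<nu> n) {-2<..max 0 R + 1}"
        unfolding \<nu>_def by (subst measure_distr) auto
      finally show "1 - e < measure (\<nu> n) {-2<..max 0 R + 1}" .
    qed
  qed
  from tight_imp_convergent_subsubsequence[OF this strict_mono_id]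
  obtain r N where r: "strict_mono r" and N: "real_distribution N" "weak_conv_m (\<nu> \<circ> id \<circ> r) N" by blast
  have rd': "real_distribution ((\<nu> \<circ> id \<circ> r) n)" for n using rd by simp
  obtain \<Omega> :: "real measure" and V Z where \<Omega>: "prob_space \<Omega>"
    and V': "\<forall>n. V n \<in> borel_measurable \<Omega>" "\<forall>n. distr \<Omega> borel (V n) = (\<nu> \<circ> id \<circ> r) n"
    and V_lim: "\<forall>w\<in>space \<Omega>. (\<lambda>n. V n w) \<longlonglongrightarrow> (Z w :: real)"
    using Skorohod[OF rd' N] by blast
  have V[measurable]: "V n \<in> borel_measurable \<Omega>" and V_distr: "distr \<Omega> borel (V n) = \<nu> (r n)" for n
    using V' by simp_all
  interpret prob_space \<Omega> by (rule \<Omega>)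
  \<comment> \<open>The paths on which every \<open>V n\<close> is a genuine code. The condition
    \<open>h (g t) = t\<close> is Borel in t and holds on the range of h, so it holds almost surely
    under every law \<open>\<nu> n\<close>, and no measurability of the range is required.\<close>
  define A where "A = {w\<in>space \<Omega>. \<forall>n. h (g (V n w)) = V n w}"
  have A[measurable]: "A \<in> sets \<Omega>" unfolding A_def by measurable
  have AE_A: "AE w in \<Omega>. w \<in> A"
  proof -
    have "AE w in \<Omega>. h (g (V n w)) = V n w" for n
    proof -
      have "AE x in \<mu> (r n). h (g (h x)) = h x" using gh by (intro AE_I2) (simp add: sp)
      then have "AE t in \<nu> (r n). h (g t) = t"
        unfolding \<nu>_def by (subst AE_distr_iff) auto
      then show ?thesis
        unfolding V_distr[symmetric] by (subst (asm) AE_distr_iff) auto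
    qed
    then have "AE w in \<Omega>. \<forall>n. h (g (V n w)) = V n w" by (subst AE_all_countable) simp
    then show ?thesis unfolding A_def by (auto elim: AE_mp)
  qed
  define X where "X n w = (if w \<in> A then g (V n w) else x0)" for n w
  have X[measurable]: "X n \<in> measurable \<Omega> (borel_of mtopology)" for n
    unfolding X_def using x0 by (intro measurable_If_set measurable_const) (auto intro: measurable_compose[OF V g])
  have X_distr: "distr \<Omega> (borel_of mtopology) (X n) = \<mu> (r n)" for n
  proof -
    have "distr \<Omega> (borel_of mtopology) (X n) = distr \<Omega> (borel_of mtopology) (\<lambda>w. g (V n w))"
      using AE_A by (intro distr_cong_AE) (auto simp: X_def elim: AE_mp)
    also have "\<dots> = distr (\<nu> (r n)) (borel_of mtopology) g"
      unfolding V_distr[symmetric] by (subst distr_distr) (auto simp: comp_def)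
    also have "\<dots> = distr (\<mu> (r n)) (borel_of mtopology) (\<lambda>x. g (h x))"
      unfolding \<nu>_def by (subst distr_distr) (auto simp: comp_def)
    also have "\<dots> = distr (\<mu> (r n)) (\<mu> (r n)) (\<lambda>x. x)"
      using gh by (intro distr_cong) (auto simp: sets sp)
    finally show ?thesis by simp
  qed
  have X_conv: "\<exists>l. limitin mtopology (\<lambda>n. X n w) l sequentially" if "w \<in> space \<Omega>" for w
  proof (cases "w \<in> A")
    case True
    have "h (X n w) = V n w" for n using True by (simp add: X_def A_def)
    then have "convergent (\<lambda>n. h (X n w))" using V_lim that by (auto simp: convergent_def)
    moreover have "range (\<lambda>n. X n w) \<subseteq> M" using measurable_space[OF X that] by auto
    ultimately show ?thesis by (intro conv)
  next
    case False
    then show ?thesis using x0 by (auto simp: X_def intro!: exI[of _ x0])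
  qed
  define Y where "Y w = (SOME l. limitin mtopology (\<lambda>n. X n w) l sequentially)" for w
  have Y: "limitin mtopology (\<lambda>n. X n w) (Y w) sequentially" if "w \<in> space \<Omega>" for w
    using someI_ex[OF X_conv[OF that]] by (simp add: Y_def)
  show ?thesis
    using measurable_limitin[OF X Y] by (intro that[OF r \<Omega> X _ X_distr Y])
qed

end

section \<open>Geodesic spaces and products\<close>

context Metric_space
begin

text \<open>Iterated midpoints towards y halve the remaining distance at each step. These points
  replace a geodesic from x to y in what follows.\<close>

lemma exists_point_towards:
  assumes mid: "\<And>x y. x \<in> M \<Longrightarrow> y \<in> M \<Longrightarrow> \<exists>z\<in>M. d x z = d x y / 2 \<and> d z y = d x y / 2"
    and xy: "x \<in> M" "y \<in> M"
  shows "\<exists>z\<in>M. d x z \<le> (1 - (1 / 2) ^ n) * d x y \<and> d z y = (1 / 2) ^ n * d x y"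
proof (induction n)
  case 0
  then show ?case using xy by (intro bexI[of _ x]) auto
next
  case (Suc n)
  then obtain z where z: "z \<in> M" "d x z \<le> (1 - (1 / 2) ^ n) * d x y" "d z y = (1 / 2) ^ n * d x y" by blast
  obtain w where w: "w \<in> M" "d z w = d z y / 2" "d w y = d z y / 2" using mid[OF z(1) xy(2)] by blast
  have "d x w \<le> d x z + d z w" using xy z w by (intro triangle) auto
  also have "\<dots> \<le> (1 - (1 / 2) ^ Suc n) * d x y" using z w by (simp add: algebra_simps)
  finally show ?case using w z by (intro bexI[of _ w]) auto
qed

text \<open>Hopf-Rinow: the supremum \<open>R\<close> of the radii of compact balls around \<open>x0\<close> would be attained, as points at
  distance at most \<open>R\<close> are approximated by points in smaller balls, and then local compactness allows a
  slightly larger radius.\<close>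

lemma hopf_rinow_midpoints:
  assumes mid: "\<And>x y. x \<in> M \<Longrightarrow> y \<in> M \<Longrightarrow> \<exists>z\<in>M. d x z = d x y / 2 \<and> d z y = d x y / 2"
    and complete: mcomplete and lc: "locally_compact_space mtopology" and x0: "x0 \<in> M"
  shows "compactin mtopology (mcball x0 r)"
proof (rule ccontr)
  assume nc: "\<not> compactin mtopology (mcball x0 r)"
  have mono: "compactin mtopology (mcball x0 s)" if "compactin mtopology (mcball x0 t)" "s \<le> t" for s t
    using closed_compactin[OF that(1), of "mcball x0 s"] mcball_subset_concentric[OF that(2)] by blast
  have loc: "\<exists>\<delta>>0. compactin mtopology (mcball x \<delta>)" if x: "x \<in> M" for x
  proof -
    obtain U K where UK: "openin mtopology U" "compactin mtopology K" "x \<in> U" "U \<subseteq> K"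
      using lc x unfolding locally_compact_space_def by force
    then obtain \<delta> where \<delta>: "0 < \<delta>" "mcball x \<delta> \<subseteq> U" unfolding openin_mtopology_mcball by blast
    then show ?thesis
      using closed_compactin[OF UK(2), of "mcball x \<delta>"] UK(4) by blast
  qed
  define A where "A = {s. compactin mtopology (mcball x0 s)}"
  define R where "R = Sup A"
  have bdd: "bdd_above A"
  proof (rule bdd_aboveI[of _ r])
    fix s assume "s \<in> A"
    then show "s \<le> r" using mono[of s r] nc by (force simp: A_def)
  qed
  obtain \<delta>0 where \<delta>0: "0 < \<delta>0" "\<delta>0 \<in> A" using loc[OF x0] by (auto simp: A_def)
  then have R: "0 < R" using cSup_upper[OF \<delta>0(2) bdd] by (simp add: R_def)
  have less_R: "compactin mtopology (mcball x0 s)" if "s < R" for s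
    using less_cSupD[of A s] \<delta>0 that mono by (fastforce simp: A_def R_def)
  have K: "compactin mtopology (mcball x0 R)"
  proof -
    have "mtotally_bounded (mcball x0 R)"
      unfolding mtotally_bounded_def
    proof (intro allI impI)
      fix e :: real assume e: "0 < e"
      \<comment> \<open>The ball of radius (1 - 2^-n) R is compact, and every point of the ball of
        radius R is within e/2 of it. An e/2-net of the smaller ball is thus an e-net of the larger
        one.\<close>
      obtain n where n: "(1 / 2) ^ n < e / (2 * R)"
        using real_arch_pow_inv[of "e / (2 * R)" "1 / 2"] e R by auto
      then have n': "(1 / 2) ^ n * R < e / 2" using R by (simp add: field_simps)
      have "mtotally_bounded (mcball x0 ((1 - (1 / 2) ^ n) * R))"
        using R by (intro compactin_imp_mtotally_bounded less_R) simp
      then obtain F where F: "finite F" "F \<subseteq> mcball x0 ((1 - (1 / 2) ^ n) * R)" "mcball x0 ((1 - (1 / 2) ^ n) * R) \<subseteq> (\<Union>x\<in>F. mball x (e / 2))"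
        using e unfolding mtotally_bounded_def by (metis half_gt_zero)
      have "mcball x0 R \<subseteq> (\<Union>x\<in>F. mball x e)"
      proof
        fix y assume "y \<in> mcball x0 R"
        then have y: "y \<in> M" "d x0 y \<le> R" by auto
        obtain z where z: "z \<in> M" "d x0 z \<le> (1 - (1 / 2) ^ n) * d x0 y" "d z y = (1 / 2) ^ n * d x0 y"
          using exists_point_towards[OF mid x0 y(1), of n] by blast
        have "(1 - (1 / 2) ^ n) * d x0 y \<le> (1 - (1 / 2) ^ n) * R"
          using y(2) by (intro mult_left_mono) (auto simp: power_le_one)
        then have "z \<in> mcball x0 ((1 - (1 / 2) ^ n) * R)" using z x0 by simp
        then obtain w where w: "w \<in> F" "w \<in> M" "d w z < e / 2" using F by auto
        have "(1 / 2) ^ n * d x0 y \<le> (1 / 2) ^ n * R" using y(2) by (intro mult_left_mono) auto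
        then have "d w y < e" using triangle[OF w(2) z(1) y(1)] w z(3) n' by linarith
        then show "y \<in> (\<Union>x\<in>F. mball x e)" using w y by auto
      qed
      moreover have "(1 - (1 / 2) ^ n) * R \<le> R" using R by simp
      then have "F \<subseteq> mcball x0 R" using F(2) mcball_subset_concentric by blast
      ultimately show "\<exists>K. finite K \<and> K \<subseteq> mcball x0 R \<and> mcball x0 R \<subseteq> (\<Union>x\<in>K. mball x e)" using F(1) by blast
    qed
    then have "compactin mtopology (mtopology closure_of (mcball x0 R))"
      using mtotally_bounded_eq_compact_closure_of[OF complete] by blast
    then show ?thesis by (simp add: closure_of_closedin)
  qed
  \<comment> \<open>The Lebesgue number of this cover turns the pointwise radii of local compactness
    into one radius \<epsilon> that works for all points of the compact ball.\<close>
  define \<C> where "\<C> = {mball x \<delta> |x \<delta>. x \<in> M \<and> 0 < \<delta> \<and> compactin mtopology (mcball x \<delta>)}"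
  have \<C>_open: "\<And>U. U \<in> \<C> \<Longrightarrow> openin mtopology U" by (auto simp: \<C>_def)
  have cov: "mcball x0 R \<subseteq> \<Union>\<C>"
  proof
    fix x assume "x \<in> mcball x0 R"
    then have "x \<in> M" by simp
    then obtain \<delta> where "0 < \<delta>" "compactin mtopology (mcball x \<delta>)" using loc by blast
    then show "x \<in> \<Union>\<C>" using \<open>x \<in> M\<close> by (auto simp: \<C>_def intro!: exI[of _ "mball x \<delta>"])
  qed
  obtain \<epsilon> where \<epsilon>: "0 < \<epsilon>" "\<And>x. x \<in> mcball x0 R \<Longrightarrow> \<exists>U\<in>\<C>. mball x \<epsilon> \<subseteq> U"
    using lebesgue_number[OF K cov \<C>_open] by blast
  obtain \<F> where \<F>: "finite \<F>" "\<F> \<subseteq> \<C>" "mcball x0 R \<subseteq> \<Union>\<F>"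
    using K cov \<C>_open unfolding compactin_def by meson
  obtain F where F: "finite F" "F \<subseteq> M" "mcball x0 R \<subseteq> (\<Union>x\<in>F. mball x (\<epsilon> / 2))" "F \<subseteq> mcball x0 R"
    using compactin_imp_mtotally_bounded[OF K] \<epsilon>(1) unfolding mtotally_bounded_def
    by (metis half_gt_zero mcball_subset_mspace subset_trans)
  obtain n where n: "(1 / 2) ^ n < \<epsilon> / (2 * (2 * R))"
    using real_arch_pow_inv[of "\<epsilon> / (2 * (2 * R))" "1 / 2"] \<epsilon>(1) R by auto
  define h :: real where "h = (1 / 2) ^ n"
  have h: "0 < h" "h \<le> 1" "h * (2 * R) < \<epsilon> / 2"
    using n R by (auto simp: h_def power_le_one field_simps)
  have big: "mcball x0 (R + h * R) \<subseteq> (\<Union>x\<in>F. mball x \<epsilon>)"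
  proof
    fix y assume "y \<in> mcball x0 (R + h * R)"
    then have y: "y \<in> M" "d x0 y \<le> R + h * R" by auto
    obtain z where z: "z \<in> M" "d x0 z \<le> (1 - h) * d x0 y" "d z y = h * d x0 y"
      using exists_point_towards[OF mid x0 y(1), of n] by (auto simp: h_def)
    \<comment> \<open>Since (1 - h)(1 + h) \<le> 1, shrinking by the factor 1 - h brings a point of
      the ball of radius (1 + h) R back into the ball of radius R. The distance covered is at most h
      (2 R), which is why n was chosen to make this less than \<epsilon>/2.\<close>
    have "(1 - h) * d x0 y \<le> (1 - h) * (R + h * R)" using y(2) h by (intro mult_left_mono) auto
    also have "\<dots> = R - h * h * R" by (simp add: algebra_simps)
    also have "\<dots> \<le> R" using h R by simp
    finally have "z \<in> mcball x0 R" using z x0 by simp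
    then obtain w where w: "w \<in> F" "w \<in> M" "d w z < \<epsilon> / 2" using F by auto
    have "h * d x0 y \<le> h * (R + h * R)" using y(2) h by (intro mult_left_mono) auto
    also have "\<dots> \<le> h * (2 * R)" using h R by (intro mult_left_mono) (auto simp: mult_left_le_one_le)
    finally have "d w y < \<epsilon>" using triangle[OF w(2) z(1) y(1)] w z(3) h by linarith
    then show "y \<in> (\<Union>x\<in>F. mball x \<epsilon>)" using w y by auto
  qed
  have "\<exists>L. compactin mtopology L \<and> mball x \<epsilon> \<subseteq> L" if "x \<in> F" for x
    using \<epsilon>(2)[of x] that F(4) mball_subset_mcball unfolding \<C>_def by blast
  then obtain L where L: "\<And>x. x \<in> F \<Longrightarrow> compactin mtopology (L x)" "\<And>x. x \<in> F \<Longrightarrow> mball x \<epsilon> \<subseteq> L x" by metis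
  have "compactin mtopology (\<Union>x\<in>F. L x)" using F(1) L(1) by (intro compactin_Union) auto
  moreover have "mcball x0 (R + h * R) \<subseteq> (\<Union>x\<in>F. L x)"
    by (rule order_trans[OF big UN_mono[OF order_refl]]) (rule L(2))
  ultimately have "compactin mtopology (mcball x0 (R + h * R))"
    by (rule closed_compactin) simp
  then have "R + h * R \<le> R" unfolding R_def A_def[symmetric]
    using bdd by (intro cSup_upper) (simp_all add: A_def R_def)
  then show False using mult_pos_pos[OF h(1) R] by linarith
qed

end

text \<open>Couplings are measures on the product sigma-algebra, while almost sure representations
  are available for Borel measures on a proper space. Both settings agree because, by separability,
  open sets of the product are countable unions of boxes.\<close>

lemma proper_metric_prod:
  assumes "proper_metric M1 d1" "proper_metric M2 d2"
  shows "proper_metric (M1 \<times> M2) (prod_dist d1 d2)"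
    and "sets (borel_of (Metric_space.mtopology (M1 \<times> M2) (prod_dist d1 d2)))
      = sets (borel_of (Metric_space.mtopology M1 d1) \<Otimes>\<^sub>M borel_of (Metric_space.mtopology M2 d2))"
proof -
  interpret P1: proper_metric M1 d1 by fact
  interpret P2: proper_metric M2 d2 by fact
  interpret P: Metric_space12 M1 d1 M2 d2 ..
  let ?T = "P.Prod_metric.mtopology"
  obtain a where a: "\<And>i. a i \<in> M1" "\<And>x e. x \<in> M1 \<Longrightarrow> 0 < e \<Longrightarrow> \<exists>i :: nat. d1 x (a i) < e"
    using P1.dense_sequence by blast
  obtain b where b: "\<And>i. b i \<in> M2" "\<And>x e. x \<in> M2 \<Longrightarrow> 0 < e \<Longrightarrow> \<exists>i :: nat. d2 x (b i) < e"
    using P2.dense_sequence by blast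
  have dense: "\<exists>i j. prod_dist d1 d2 (x, y) (a i, b j) < e" if xy: "x \<in> M1" "y \<in> M2" "0 < e" for x y e
  proof -
    obtain i where i: "d1 x (a i) < e / 2" using a(2)[OF xy(1), of "e / 2"] xy(3) by auto
    obtain j where j: "d2 y (b j) < e / 2" using b(2)[OF xy(2), of "e / 2"] xy(3) by auto
    show ?thesis
      using P.prod_metric_le_components[OF xy(1) a(1) xy(2) b(1)] i j
      by (intro exI[of _ i] exI[of _ j]) (smt (verit) field_sum_of_halves)
  qed
  have sep: "separable_space ?T"
    unfolding separable_space_def
  proof (intro exI[of _ "range a \<times> range b"] conjI)
    show "countable (range a \<times> range b)" by simp
    show "range a \<times> range b \<subseteq> topspace ?T" using a(1) b(1) by auto
    show "?T closure_of (range a \<times> range b) = topspace ?T"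
      using dense a(1) b(1) by (auto simp: P.Prod_metric.metric_closure_of)
  qed
  show pm: "proper_metric (M1 \<times> M2) (prod_dist d1 d2)"
  proof (unfold_locales)
    show "separable_space ?T" by (rule sep)
    show "M1 \<times> M2 \<noteq> {}" using P1.nonempty P2.nonempty by auto
    fix x and r :: real assume "x \<in> M1 \<times> M2"
    then obtain x1 x2 where x: "x = (x1, x2)" "x1 \<in> M1" "x2 \<in> M2" by auto
    have "compactin ?T (P1.mcball x1 r \<times> P2.mcball x2 r)"
      unfolding P.mtopology_prod_metric compactin_Times using P1.proper[OF x(2)] P2.proper[OF x(3)] by blast
    then show "compactin ?T (P.Prod_metric.mcball x r)"
      unfolding x(1) by (rule closed_compactin[OF _ P.mcball_prod_metric_subset]) simp
  qed
  show "sets (borel_of ?T) = sets (borel_of P1.mtopology \<Otimes>\<^sub>M borel_of P2.mtopology)" (is "_ = sets ?Q")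
  proof
    show "sets (borel_of ?T) \<subseteq> sets ?Q"
      unfolding sets_borel_of
    proof (rule sets.sigma_sets_subset')
      show "topspace ?T \<in> sets ?Q"
        using sets.top[of ?Q] by (simp add: space_pair_measure)
      show "{U. openin ?T U} \<subseteq> sets ?Q"
      proof safe
        fix U assume U: "openin ?T U"
        define I where "I = {(i, j, n). P1.mball (a i) (1 / Suc n) \<times> P2.mball (b j) (1 / Suc n) \<subseteq> U}"
        have "U = (\<Union>(i, j, n)\<in>I. P1.mball (a i) (1 / Suc n) \<times> P2.mball (b j) (1 / Suc n))"
        proof
          show "U \<subseteq> (\<Union>(i, j, n)\<in>I. P1.mball (a i) (1 / Suc n) \<times> P2.mball (b j) (1 / Suc n))"
          proof
            fix z assume z: "z \<in> U"
            then obtain x y where xy: "z = (x, y)" "x \<in> M1" "y \<in> M2"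
              using openin_subset[OF U] by auto
            obtain e where e: "0 < e" "P.Prod_metric.mball (x, y) e \<subseteq> U"
              using U z xy unfolding P.Prod_metric.openin_mtopology by blast
            obtain n :: nat where n: "1 / Suc n < e / 4" using nat_approx_posE[of "e / 4"] e by auto
            obtain i where i: "d1 x (a i) < 1 / Suc n" using a(2)[OF xy(2), of "1 / Suc n"] by auto
            obtain j where j: "d2 y (b j) < 1 / Suc n" using b(2)[OF xy(3), of "1 / Suc n"] by auto
            have "P1.mball (a i) (1 / Suc n) \<subseteq> P1.mball x (e / 2)"
              using i n xy a(1) by (intro P1.mball_subset) (auto simp: P1.commute)
            moreover have "P2.mball (b j) (1 / Suc n) \<subseteq> P2.mball y (e / 2)"
              using j n xy b(1) by (intro P2.mball_subset) (auto simp: P2.commute)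
            ultimately have "P1.mball (a i) (1 / Suc n) \<times> P2.mball (b j) (1 / Suc n)
                \<subseteq> P1.mball x (e / 2) \<times> P2.mball y (e / 2)" by blast
            also have "\<dots> \<subseteq> P.Prod_metric.mball (x, y) (e / 2 + e / 2)" by (rule P.mball_subset_prod_metric)
            also have "\<dots> \<subseteq> U" using e by simp
            finally have "(i, j, n) \<in> I" by (simp add: I_def)
            moreover have "z \<in> P1.mball (a i) (1 / Suc n) \<times> P2.mball (b j) (1 / Suc n)"
              using i j xy a(1) b(1) by (simp add: P1.commute P2.commute)
            ultimately show "z \<in> (\<Union>(i, j, n)\<in>I. P1.mball (a i) (1 / Suc n) \<times> P2.mball (b j) (1 / Suc n))"
              by blast
          qed
        qed (auto simp: I_def)
        also have "\<dots> \<in> sets ?Q"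
          by (intro sets.countable_UN'')
            (auto simp: case_prod_unfold intro!: pair_measureI borel_of_open)
        finally show "U \<in> sets ?Q" .
      qed
    qed
    show "sets ?Q \<subseteq> sets (borel_of ?T)"
    proof (rule sets_pair_in_sets)
      fix A B assume AB: "A \<in> sets (borel_of P1.mtopology)" "B \<in> sets (borel_of P2.mtopology)"
      have [measurable]: "fst \<in> measurable (borel_of ?T) (borel_of P1.mtopology)"
        unfolding P.mtopology_prod_metric by (intro borel_of_measurable_continuous continuous_map_fst)
      have [measurable]: "snd \<in> measurable (borel_of ?T) (borel_of P2.mtopology)"
        unfolding P.mtopology_prod_metric by (intro borel_of_measurable_continuous continuous_map_snd)
      have "A \<times> B = (fst -` A \<inter> space (borel_of ?T)) \<inter> (snd -` B \<inter> space (borel_of ?T))"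
        using sets.sets_into_space[OF AB(1)] sets.sets_into_space[OF AB(2)] by auto
      also have "\<dots> \<in> sets (borel_of ?T)" using AB by measurable
      finally show "A \<times> B \<in> sets (borel_of ?T)" .
    qed
  qed
qed

section \<open>The Wasserstein metric\<close>

definition cost :: "('a \<Rightarrow> 'a \<Rightarrow> real) \<Rightarrow> real \<Rightarrow> ('a \<times> 'a) measure \<Rightarrow> ennreal" where
  "cost d p \<pi> = (\<integral>\<^sup>+ xy. ennreal (d (fst xy) (snd xy) powr p) \<partial>\<pi>)"

lemma couplingsD:
  assumes "\<pi> \<in> couplings \<mu> \<nu>"
  shows "sets \<pi> = sets (\<mu> \<Otimes>\<^sub>M \<nu>)" "prob_space \<pi>" "distr \<pi> \<mu> fst = \<mu>" "distr \<pi> \<nu> snd = \<nu>"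
    "space \<pi> = space \<mu> \<times> space \<nu>" "fst \<in> measurable \<pi> \<mu>" "snd \<in> measurable \<pi> \<nu>"
proof -
  show 1: "sets \<pi> = sets (\<mu> \<Otimes>\<^sub>M \<nu>)" "prob_space \<pi>" "distr \<pi> \<mu> fst = \<mu>" "distr \<pi> \<nu> snd = \<nu>"
    using assms by (auto simp: couplings_def)
  show "space \<pi> = space \<mu> \<times> space \<nu>" using sets_eq_imp_space_eq[OF 1(1)] by (simp add: space_pair_measure)
  note [measurable_cong] = 1(1)
  show "fst \<in> measurable \<pi> \<mu>" "snd \<in> measurable \<pi> \<nu>" by measurable
qed

lemma distr_pair_in_couplings:
  assumes "prob_space \<Omega>" "sets \<mu> = sets M" "sets \<nu> = sets N"
    and X[measurable]: "X \<in> measurable \<Omega> M" and Y[measurable]: "Y \<in> measurable \<Omega> N"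
    and "distr \<Omega> M X = \<mu>" "distr \<Omega> N Y = \<nu>"
  shows "distr \<Omega> (\<mu> \<Otimes>\<^sub>M \<nu>) (\<lambda>w. (X w, Y w)) \<in> couplings \<mu> \<nu>"
proof -
  interpret prob_space \<Omega> by fact
  note [measurable_cong] = assms(2,3)
  have 1: "(\<lambda>w. (X w, Y w)) \<in> measurable \<Omega> (\<mu> \<Otimes>\<^sub>M \<nu>)" by measurable
  have "distr (distr \<Omega> (\<mu> \<Otimes>\<^sub>M \<nu>) (\<lambda>w. (X w, Y w))) \<mu> fst = distr \<Omega> \<mu> X"
    using 1 by (subst distr_distr) (auto simp: comp_def)
  also have "\<dots> = \<mu>" using assms(6) by (metis assms(2) distr_cong)
  finally have 2: "distr (distr \<Omega> (\<mu> \<Otimes>\<^sub>M \<nu>) (\<lambda>w. (X w, Y w))) \<mu> fst = \<mu>" .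
  have "distr (distr \<Omega> (\<mu> \<Otimes>\<^sub>M \<nu>) (\<lambda>w. (X w, Y w))) \<nu> snd = distr \<Omega> \<nu> Y"
    using 1 by (subst distr_distr) (auto simp: comp_def)
  also have "\<dots> = \<nu>" using assms(7) by (metis assms(3) distr_cong)
  finally have 3: "distr (distr \<Omega> (\<mu> \<Otimes>\<^sub>M \<nu>) (\<lambda>w. (X w, Y w))) \<nu> snd = \<nu>" .
  show ?thesis using 2 3 prob_space_distr[OF 1] by (simp add: couplings_def)
qed

lemma cost_distr_pair:
  assumes [measurable]: "X \<in> measurable \<Omega> \<mu>" "Y \<in> measurable \<Omega> \<nu>"
    and "(\<lambda>z. d (fst z) (snd z)) \<in> borel_measurable (\<mu> \<Otimes>\<^sub>M \<nu>)"
  shows "cost d p (distr \<Omega> (\<mu> \<Otimes>\<^sub>M \<nu>) (\<lambda>w. (X w, Y w))) = (\<integral>\<^sup>+ w. ennreal (d (X w) (Y w) powr p) \<partial>\<Omega>)"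
proof -
  have [measurable]: "(\<lambda>z. d (fst z) (snd z) powr p) \<in> borel_measurable (\<mu> \<Otimes>\<^sub>M \<nu>)"
    by (rule measurable_compose[OF assms(3), of "\<lambda>t. t powr p" borel]) measurable
  show ?thesis unfolding cost_def by (subst nn_integral_distr) simp_all
qed

lemma wass_nonneg [simp]: "0 \<le> wass d p \<mu> \<nu>"
  by (simp add: wass_def)

lemma wass_le:
  assumes "\<pi> \<in> couplings \<mu> \<nu>" "cost d p \<pi> \<le> ennreal (A powr p)" "0 \<le> A" "1 \<le> p"
  shows "wass d p \<mu> \<nu> \<le> A"
proof -
  have "(INF \<pi>\<in>couplings \<mu> \<nu>. cost d p \<pi>) \<le> ennreal (A powr p)"
    using assms by (meson INF_lower order_trans)
  then have "enn2real (INF \<pi>\<in>couplings \<mu> \<nu>. cost d p \<pi>) \<le> A powr p"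
    by (rule enn2real_leI[rotated]) simp
  then have "wass d p \<mu> \<nu> \<le> (A powr p) powr (1 / p)"
    unfolding wass_def cost_def using assms by (intro powr_mono2) auto
  then show ?thesis using assms by (simp add: powr_powr)
qed

text \<open>\<open>wass\<close> is real-valued and reads an infinite infimum as 0, in which case a
  small value would say nothing about couplings. The coupling \<open>\<pi>0\<close> of finite cost
  excludes this.\<close>

lemma wass_less_coupling:
  assumes "\<pi>0 \<in> couplings \<mu> \<nu>" "cost d p \<pi>0 < \<infinity>" "wass d p \<mu> \<nu> < A" "1 \<le> p"
  shows "\<exists>\<pi>\<in>couplings \<mu> \<nu>. cost d p \<pi> \<le> ennreal (A powr p)"
proof -
  define I where "I = (INF \<pi>\<in>couplings \<mu> \<nu>. cost d p \<pi>)"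
  have "I \<le> cost d p \<pi>0" unfolding I_def using assms(1) by (rule INF_lower)
  then have fin: "I < \<infinity>" using assms(2) by (rule order.strict_trans1)
  have "enn2real I powr (1 / p) < A" using assms(3) by (simp add: I_def wass_def cost_def)
  then have "(enn2real I powr (1 / p)) powr p < A powr p"
    using assms(4) by (intro powr_less_mono2) auto
  then have "enn2real I < A powr p" using assms(4) by (simp add: powr_powr)
  then have "I < ennreal (A powr p)"
    using fin by (cases I) (auto simp: ennreal_less_iff)
  then obtain \<pi> where "\<pi> \<in> couplings \<mu> \<nu>" "cost d p \<pi> < ennreal (A powr p)"
    unfolding I_def INF_less_iff by auto
  then show ?thesis using less_imp_le by blast
qed

lemma swap_coupling:
  assumes "\<pi> \<in> couplings \<mu> \<nu>"
  shows "distr \<pi> (\<nu> \<Otimes>\<^sub>M \<mu>) (\<lambda>z. (snd z, fst z)) \<in> couplings \<nu> \<mu>"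
  by (rule distr_pair_in_couplings[OF couplingsD(2)[OF assms] refl refl couplingsD(7)[OF assms]
    couplingsD(6)[OF assms] couplingsD(4)[OF assms] couplingsD(3)[OF assms]])

text \<open>Swapping the coordinates of couplings gives one inequality, and by symmetry the other.
  The cost integrand may be nonmeasurable here, so the change of variables is used only as an
  inequality; this makes the lemma valid for measures on \<open>wp_space\<close> as well.\<close>

lemma wass_commute:
  assumes "\<And>x y. d x y = d y x"
  shows "wass d p \<mu> \<nu> = wass d p \<nu> \<mu>"
proof -
  have *: "(INF \<pi>\<in>couplings \<nu> \<mu>. cost d p \<pi>) \<le> (INF \<pi>\<in>couplings \<mu> \<nu>. cost d p \<pi>)" for \<mu> \<nu>
  proof (rule INF_greatest)
    fix \<pi> assume \<pi>: "\<pi> \<in> couplings \<mu> \<nu>"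
    note [measurable] = couplingsD(6,7)[OF \<pi>]
    have "(INF \<pi>\<in>couplings \<nu> \<mu>. cost d p \<pi>) \<le> cost d p (distr \<pi> (\<nu> \<Otimes>\<^sub>M \<mu>) (\<lambda>z. (snd z, fst z)))"
      by (rule INF_lower[OF swap_coupling[OF \<pi>]])
    also have "\<dots> \<le> (\<integral>\<^sup>+ z. ennreal (d (snd z) (fst z) powr p) \<partial>\<pi>)"
      unfolding cost_def by (rule order_trans[OF nn_integral_distr_le]) auto
    also have "\<dots> = cost d p \<pi>" unfolding cost_def by (subst assms) simp
    finally show "(INF \<pi>\<in>couplings \<nu> \<mu>. cost d p \<pi>) \<le> cost d p \<pi>" .
  qed
  have "(INF \<pi>\<in>couplings \<mu> \<nu>. cost d p \<pi>) = (INF \<pi>\<in>couplings \<nu> \<mu>. cost d p \<pi>)"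
    by (intro antisym *)
  then show ?thesis by (simp add: wass_def cost_def)
qed

lemma nn_integral_coupling_fst:
  assumes "\<pi> \<in> couplings \<mu> \<nu>" "f \<in> borel_measurable \<mu>"
  shows "(\<integral>\<^sup>+ z. f (fst z) \<partial>\<pi>) = (\<integral>\<^sup>+ x. f x \<partial>\<mu>)"
  using assms(2) by (subst nn_integral_distr[OF couplingsD(6)[OF assms(1)], symmetric]) (simp_all only: couplingsD(3)[OF assms(1)])

lemma nn_integral_coupling_snd:
  assumes "\<pi> \<in> couplings \<mu> \<nu>" "f \<in> borel_measurable \<nu>"
  shows "(\<integral>\<^sup>+ z. f (snd z) \<partial>\<pi>) = (\<integral>\<^sup>+ x. f x \<partial>\<nu>)"
  using assms(2) by (subst nn_integral_distr[OF couplingsD(7)[OF assms(1)], symmetric]) (simp_all only: couplingsD(4)[OF assms(1)])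

lemma pair_measure_in_couplings:
  assumes "prob_space \<mu>" "prob_space \<nu>"
  shows "\<mu> \<Otimes>\<^sub>M \<nu> \<in> couplings \<mu> \<nu>"
proof -
  interpret M: prob_space \<mu> by fact
  interpret N: prob_space \<nu> by fact
  interpret pair_prob_space \<mu> \<nu> ..
  have "distr (\<mu> \<Otimes>\<^sub>M \<nu>) \<nu> snd = \<nu>"
  proof (rule measure_eqI)
    fix A assume "A \<in> sets (distr (\<mu> \<Otimes>\<^sub>M \<nu>) \<nu> snd)"
    then have A[measurable]: "A \<in> sets \<nu>" by simp
    have "snd -` A \<inter> space (\<mu> \<Otimes>\<^sub>M \<nu>) = space \<mu> \<times> A"
      using sets.sets_into_space[OF A] by (auto simp: space_pair_measure)
    then show "emeasure (distr (\<mu> \<Otimes>\<^sub>M \<nu>) \<nu> snd) A = emeasure \<nu> A"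
      by (subst emeasure_distr) (auto simp: N.emeasure_pair_measure_Times M.emeasure_space_1)
  qed simp
  moreover have "distr (\<mu> \<Otimes>\<^sub>M \<nu>) \<mu> fst = \<mu>"
  proof (rule measure_eqI)
    fix A assume "A \<in> sets (distr (\<mu> \<Otimes>\<^sub>M \<nu>) \<mu> fst)"
    then have A[measurable]: "A \<in> sets \<mu>" by simp
    have "fst -` A \<inter> space (\<mu> \<Otimes>\<^sub>M \<nu>) = A \<times> space \<nu>"
      using sets.sets_into_space[OF A] by (auto simp: space_pair_measure)
    then show "emeasure (distr (\<mu> \<Otimes>\<^sub>M \<nu>) \<mu> fst) A = emeasure \<mu> A"
      by (subst emeasure_distr) (auto simp: N.emeasure_pair_measure_Times N.emeasure_space_1)
  qed simp
  ultimately show ?thesis by (simp add: couplings_def prob_space_axioms)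
qed

section \<open>Moments, near-optimal couplings, and the distance from a point mass to a
  measure\<close>

context Metric_space
begin

lemma wp_spaceD:
  assumes "\<mu> \<in> wp_space M d p"
  shows "sets \<mu> = sets (borel_of mtopology)" "prob_space \<mu>" "space \<mu> = M" "M \<noteq> {}"
proof -
  show 1: "sets \<mu> = sets (borel_of mtopology)" "prob_space \<mu>" "M \<noteq> {}" using assms by (auto simp: wp_space_def)
  show "space \<mu> = M" using sets_eq_imp_space_eq[OF 1(1)] by simp
qed

lemma dist_measurable_wp: "\<mu> \<in> wp_space M d p \<Longrightarrow> a \<in> M \<Longrightarrow> d a \<in> borel_measurable \<mu>"
  by (subst measurable_cong_sets[OF wp_spaceD(1) refl]) (auto intro: dist_measurable)

lemma wp_space_moment_finite:
  assumes \<mu>: "\<mu> \<in> wp_space M d p" and p: "1 \<le> p" and x: "x \<in> M"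
  shows "(\<integral>\<^sup>+ y. ennreal (d x y powr p) \<partial>\<mu>) < \<infinity>"
proof -
  interpret prob_space \<mu> by (rule wp_spaceD[OF \<mu>])
  obtain x0 where x0: "x0 \<in> M" "(\<integral>\<^sup>+ y. ennreal (d y x0 powr p) \<partial>\<mu>) < \<infinity>"
    using \<mu> by (auto simp: wp_space_def)
  have [measurable]: "(\<lambda>y. d y x0) \<in> borel_measurable \<mu>"
    using dist_measurable_wp[OF \<mu> x0(1)] by (simp add: commute[of _ x0])
  have "(\<integral>\<^sup>+ y. ennreal (d x y powr p) \<partial>\<mu>)
      \<le> (\<integral>\<^sup>+ y. ennreal (2 powr p * d x x0 powr p) + ennreal (2 powr p) * ennreal (d y x0 powr p) \<partial>\<mu>)"
  proof (rule nn_integral_mono)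
    fix y assume "y \<in> space \<mu>"
    then have "d x y \<le> d x x0 + d y x0" using triangle'[of x x0 y] x x0 wp_spaceD(3)[OF \<mu>] by simp
    then have "d x y powr p \<le> (d x x0 + d y x0) powr p" using p by (intro powr_mono2) auto
    also have "\<dots> \<le> 2 powr p * (d x x0 powr p + d y x0 powr p)" using p by (intro powr_add_le) auto
    finally show "ennreal (d x y powr p) \<le> ennreal (2 powr p * d x x0 powr p) + ennreal (2 powr p) * ennreal (d y x0 powr p)"
      by (simp add: ennreal_mult'[symmetric] ennreal_plus[symmetric] distrib_left del: ennreal_plus)
  qed
  also have "\<dots> = ennreal (2 powr p * d x x0 powr p) + ennreal (2 powr p) * (\<integral>\<^sup>+ y. ennreal (d y x0 powr p) \<partial>\<mu>)"
    by (simp add: nn_integral_add nn_integral_cmult emeasure_space_1)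
  also have "\<dots> < \<infinity>" using x0 by (simp add: ennreal_mult_less_top)
  finally show ?thesis .
qed

lemma wp_spaceI:
  assumes "sets \<mu> = sets (borel_of mtopology)" "prob_space \<mu>" "x \<in> M" "(\<integral>\<^sup>+ y. ennreal (d x y powr p) \<partial>\<mu>) < \<infinity>"
  shows "\<mu> \<in> wp_space M d p"
proof -
  have "\<exists>x\<in>M. (\<integral>\<^sup>+ y. ennreal (d y x powr p) \<partial>\<mu>) < \<infinity>"
    using assms(3,4) unfolding commute[of x] by (rule bexI[rotated])
  then show ?thesis using assms(1,2) by (simp add: wp_space_def)
qed

text \<open>The product measure has finite cost by the finite moments, so the infimum is finite and
  is approached by couplings.\<close>

lemma wass_coupling:
  assumes \<mu>: "\<mu> \<in> wp_space M d p" and \<nu>: "\<nu> \<in> wp_space M d p" and p: "1 \<le> p"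
    and less: "wass d p \<mu> \<nu> < A"
  obtains \<pi> where "\<pi> \<in> couplings \<mu> \<nu>" "cost d p \<pi> \<le> ennreal (A powr p)"
proof -
  obtain x where x: "x \<in> M" using wp_spaceD(4)[OF \<mu>] by blast
  have c: "\<mu> \<Otimes>\<^sub>M \<nu> \<in> couplings \<mu> \<nu>"
    using wp_spaceD[OF \<mu>] wp_spaceD[OF \<nu>] by (intro pair_measure_in_couplings)
  note [measurable] = dist_measurable_wp[OF \<mu> x] dist_measurable_wp[OF \<nu> x]
  have "cost d p (\<mu> \<Otimes>\<^sub>M \<nu>)
      \<le> (\<integral>\<^sup>+ z. ennreal (2 powr p) * (ennreal (d x (fst z) powr p) + ennreal (d x (snd z) powr p)) \<partial>(\<mu> \<Otimes>\<^sub>M \<nu>))"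
    unfolding cost_def
  proof (rule nn_integral_mono)
    fix z assume "z \<in> space (\<mu> \<Otimes>\<^sub>M \<nu>)"
    then have "fst z \<in> M" "snd z \<in> M" by (simp_all add: space_pair_measure mem_Times_iff wp_spaceD(3)[OF \<mu>] wp_spaceD(3)[OF \<nu>])
    then have "d (fst z) (snd z) \<le> d x (fst z) + d x (snd z)" using x by (intro triangle'') auto
    then have "d (fst z) (snd z) powr p \<le> (d x (fst z) + d x (snd z)) powr p" using p by (intro powr_mono2) auto
    also have "\<dots> \<le> 2 powr p * (d x (fst z) powr p + d x (snd z) powr p)" using p by (intro powr_add_le) auto
    finally show "ennreal (d (fst z) (snd z) powr p) \<le> ennreal (2 powr p) * (ennreal (d x (fst z) powr p) + ennreal (d x (snd z) powr p))"
      by (simp add: ennreal_mult'[symmetric] ennreal_plus[symmetric] del: ennreal_plus)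
  qed
  also have "\<dots> = ennreal (2 powr p) * ((\<integral>\<^sup>+ y. ennreal (d x y powr p) \<partial>\<mu>) + (\<integral>\<^sup>+ y. ennreal (d x y powr p) \<partial>\<nu>))"
    using nn_integral_coupling_fst[OF c, of "\<lambda>y. ennreal (d x y powr p)"] nn_integral_coupling_snd[OF c, of "\<lambda>y. ennreal (d x y powr p)"]
    by (subst nn_integral_cmult, simp, subst nn_integral_add) auto
  also have "\<dots> < \<infinity>"
    using wp_space_moment_finite[OF \<mu> p x] wp_space_moment_finite[OF \<nu> p x] by (simp add: ennreal_mult_less_top)
  finally show ?thesis using wass_less_coupling[OF c _ less p] that by blast
qed

text \<open>The \<open>L\<^sup>p\<close> distance between the point \<open>x\<close> and \<open>P\<close>, that is, \<open>W\<^sub>p(\<delta>\<^sub>x, P)\<close>.\<close>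

definition pmean :: "real \<Rightarrow> 'a measure \<Rightarrow> 'a \<Rightarrow> real" where
  "pmean p P x = enn2real (\<integral>\<^sup>+ y. ennreal (d x y powr p) \<partial>P) powr (1 / p)"

lemma pmean_nonneg [simp]: "0 \<le> pmean p P x"
  by (simp add: pmean_def)

lemma nn_integral_eq_pmean:
  assumes "P \<in> wp_space M d p" "1 \<le> p" "x \<in> M"
  shows "(\<integral>\<^sup>+ y. ennreal (d x y powr p) \<partial>P) = ennreal (pmean p P x powr p)"
  using wp_space_moment_finite[OF assms] assms(2)
  by (simp add: pmean_def powr_powr less_top[symmetric])

lemma pmean_leI:
  assumes "(\<integral>\<^sup>+ y. ennreal (d x y powr p) \<partial>P) \<le> ennreal (A powr p)" "1 \<le> p" "0 \<le> A"
  shows "pmean p P x \<le> A"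
proof -
  have "enn2real (\<integral>\<^sup>+ y. ennreal (d x y powr p) \<partial>P) \<le> A powr p"
    using assms(1) by (rule enn2real_leI[rotated]) simp
  then have "pmean p P x \<le> (A powr p) powr (1 / p)"
    unfolding pmean_def using assms by (intro powr_mono2) auto
  then show ?thesis using assms by (simp add: powr_powr)
qed

lemma nn_integral_le_if_pmean_less:
  assumes "P \<in> wp_space M d p" "1 \<le> p" "x \<in> M" "pmean p P x < A"
  shows "(\<integral>\<^sup>+ y. ennreal (d x y powr p) \<partial>P) \<le> ennreal (A powr p)"
  unfolding nn_integral_eq_pmean[OF assms(1-3)] using assms(2,4)
  by (intro ennreal_leI powr_mono2) auto

lemma pmean_triangle_measure:
  assumes Q: "Q \<in> wp_space M d p" and P: "P \<in> wp_space M d p" and p: "1 \<le> p" and x: "x \<in> M"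
  shows "pmean p Q x \<le> pmean p P x + wass d p Q P"
proof (rule field_le_epsilon)
  fix e :: real assume e: "0 < e"
  define A where "A = pmean p P x + e / 2"
  define B where "B = wass d p Q P + e / 2"
  have AB: "0 < A" "0 < B" using e by (simp_all add: A_def B_def add_nonneg_pos)
  obtain \<pi> where \<pi>: "\<pi> \<in> couplings Q P" "cost d p \<pi> \<le> ennreal (B powr p)"
    using wass_coupling[OF Q P p, of B] e by (auto simp: B_def)
  note [measurable] = couplingsD(6,7)[OF \<pi>(1)] dist_measurable_wp[OF Q x] dist_measurable_wp[OF P x]
  have sp: "fst z \<in> M" "snd z \<in> M" if "z \<in> space \<pi>" for z
    using that by (simp_all add: couplingsD(5)[OF \<pi>(1)] mem_Times_iff wp_spaceD(3)[OF Q] wp_spaceD(3)[OF P])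
  have "(\<integral>\<^sup>+ y. ennreal (d x y powr p) \<partial>Q) = (\<integral>\<^sup>+ z. ennreal (d x (fst z) powr p) \<partial>\<pi>)"
    by (rule nn_integral_coupling_fst[OF \<pi>(1), symmetric]) simp
  also have "\<dots> \<le> ennreal ((A + B) powr p)"
  proof (rule minkowski_nn_integral_powr[OF p, where f="\<lambda>z. d x (snd z)" and g="\<lambda>z. \<bar>d x (fst z) - d x (snd z)\<bar>"])
    show "(\<integral>\<^sup>+ z. ennreal (d x (snd z) powr p) \<partial>\<pi>) \<le> ennreal (A powr p)"
      using nn_integral_le_if_pmean_less[OF P p x, of A] e
      by (subst nn_integral_coupling_snd[OF \<pi>(1)]) (auto simp: A_def)
    have "(\<integral>\<^sup>+ z. ennreal (\<bar>d x (fst z) - d x (snd z)\<bar> powr p) \<partial>\<pi>) \<le> cost d p \<pi>"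
      unfolding cost_def
    proof (intro nn_integral_mono ennreal_leI powr_mono2)
      fix z assume "z \<in> space \<pi>"
      then show "\<bar>d x (fst z) - d x (snd z)\<bar> \<le> d (fst z) (snd z)"
        using mdist_reverse_triangle[of "fst z" x "snd z"] sp x by (simp add: commute[of _ x])
    qed (use p in auto)
    then show "(\<integral>\<^sup>+ z. ennreal (\<bar>d x (fst z) - d x (snd z)\<bar> powr p) \<partial>\<pi>) \<le> ennreal (B powr p)"
      using \<pi>(2) by (rule order_trans)
  qed (use AB in auto)
  finally have "pmean p Q x \<le> A + B" using AB p by (intro pmean_leI) auto
  then show "pmean p Q x \<le> pmean p P x + wass d p Q P + e" by (simp add: A_def B_def)
qed

lemma pmean_triangle_point:
  assumes P: "P \<in> wp_space M d p" and p: "1 \<le> p" and xy: "x \<in> M" "y \<in> M"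
  shows "pmean p P x \<le> pmean p P y + d x y"
proof (rule field_le_epsilon)
  fix e :: real assume e: "0 < e"
  define A where "A = pmean p P y + e / 2"
  define B where "B = d x y + e / 2"
  have AB: "0 < A" "0 < B" using e by (simp_all add: A_def B_def add_nonneg_pos)
  note [measurable] = dist_measurable_wp[OF P xy(2)]
  have "(\<integral>\<^sup>+ z. ennreal (d x z powr p) \<partial>P) \<le> ennreal ((A + B) powr p)"
  proof (rule minkowski_nn_integral_powr[OF p, where f="d y" and g="\<lambda>_. B"])
    show "AE z in P. d x z \<le> d y z + B"
      using triangle[of x y] xy wp_spaceD(3)[OF P] e by (intro AE_I2) (force simp: B_def)
    show "(\<integral>\<^sup>+ z. ennreal (d y z powr p) \<partial>P) \<le> ennreal (A powr p)"
      using e by (intro nn_integral_le_if_pmean_less[OF P p xy(2)]) (simp add: A_def)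
  qed (use AB prob_space.emeasure_space_1[OF wp_spaceD(2)[OF P]] in auto)
  then have "pmean p P x \<le> A + B" using AB p by (intro pmean_leI) auto
  then show "pmean p P x \<le> pmean p P y + d x y + e" by (simp add: A_def B_def)
qed

text \<open>The constant \<open>d x y\<close> is integrated against P after passing through a random
  third point z. Points with small mean distance to P are thereby close to each other, which later
  bounds the whole sequence of barycenters.\<close>

lemma dist_le_pmean:
  assumes P: "P \<in> wp_space M d p" and p: "1 \<le> p" and xy: "x \<in> M" "y \<in> M"
  shows "d x y \<le> pmean p P x + pmean p P y"
proof (rule field_le_epsilon)
  fix e :: real assume e: "0 < e"
  define A where "A = pmean p P x + e / 2"
  define B where "B = pmean p P y + e / 2"
  have AB: "0 < A" "0 < B" using e by (simp_all add: A_def B_def add_nonneg_pos)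
  note [measurable] = dist_measurable_wp[OF P xy(1)] dist_measurable_wp[OF P xy(2)]
  have "(\<integral>\<^sup>+ z. ennreal (d x y powr p) \<partial>P) \<le> ennreal ((A + B) powr p)"
  proof (rule minkowski_nn_integral_powr[OF p, where f="d x" and g="d y"])
    show "AE z in P. d x y \<le> d x z + d y z"
      using triangle'[of x _ y] xy wp_spaceD(3)[OF P] by (intro AE_I2) auto
    show "(\<integral>\<^sup>+ z. ennreal (d x z powr p) \<partial>P) \<le> ennreal (A powr p)"
      using e by (intro nn_integral_le_if_pmean_less[OF P p xy(1)]) (simp add: A_def)
    show "(\<integral>\<^sup>+ z. ennreal (d y z powr p) \<partial>P) \<le> ennreal (B powr p)"
      using e by (intro nn_integral_le_if_pmean_less[OF P p xy(2)]) (simp add: B_def)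
  qed (use AB in auto)
  then have "d x y powr p \<le> (A + B) powr p"
    using prob_space.emeasure_space_1[OF wp_spaceD(2)[OF P]] by simp
  then have "d x y \<le> A + B"
    using powr_less_mono2[of p "A + B" "d x y"] p AB by (auto simp: not_le[symmetric])
  then show "d x y \<le> pmean p P x + pmean p P y + e" by (simp add: A_def B_def)
qed

end

section \<open>The metric axioms for the Wasserstein distance\<close>

context separable_metric
begin

lemma dist_pair_measurable:
  assumes "sets \<mu> = sets (borel_of mtopology)" "sets \<nu> = sets (borel_of mtopology)"
  shows "(\<lambda>z. d (fst z) (snd z)) \<in> borel_measurable (\<mu> \<Otimes>\<^sub>M \<nu>)"
proof -
  note [measurable_cong] = assms
  show ?thesis by (intro dist_measurable_comp) measurable
qed

lemma wass_triangle:
  assumes p: "1 \<le> p" and \<mu>: "\<mu>1 \<in> wp_space M d p" "\<mu>2 \<in> wp_space M d p" "\<mu>3 \<in> wp_space M d p"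
  shows "wass d p \<mu>1 \<mu>3 \<le> wass d p \<mu>1 \<mu>2 + wass d p \<mu>2 \<mu>3"
proof (rule field_le_epsilon)
  fix e :: real assume e: "0 < e"
  define A where "A = wass d p \<mu>1 \<mu>2 + e / 3"
  define B where "B = wass d p \<mu>2 \<mu>3 + e / 3"
  have AB: "0 < A" "0 < B" using e by (simp_all add: A_def B_def add_nonneg_pos)
  note [measurable_cong] = wp_spaceD(1)[OF \<mu>(1)] wp_spaceD(1)[OF \<mu>(2)] wp_spaceD(1)[OF \<mu>(3)]
  obtain \<pi>12 where \<pi>12: "\<pi>12 \<in> couplings \<mu>1 \<mu>2" "cost d p \<pi>12 \<le> ennreal (A powr p)"
    using wass_coupling[OF \<mu>(1,2) p, of A] e by (auto simp: A_def)
  obtain \<pi>23 where \<pi>23: "\<pi>23 \<in> couplings \<mu>2 \<mu>3" "cost d p \<pi>23 \<le> ennreal (B powr p)"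
    using wass_coupling[OF \<mu>(2,3) p, of B] e by (auto simp: B_def)
  note c12 = couplingsD[OF \<pi>12(1)] and c23 = couplingsD[OF \<pi>23(1)]
  note [measurable_cong] = c12(1) c23(1)
  obtain a where a: "\<And>i. a i \<in> M" "\<And>x e. x \<in> M \<Longrightarrow> 0 < e \<Longrightarrow> \<exists>i :: nat. d x (a i) < e"
    using dense_sequence by blast
  \<comment> \<open>The cells of q have diameter at most e/3. The two middle coordinates of the
    glued measure lie in one cell, so the total error e consists of the slack e/3 of each coupling
    and e/3 for the jump within the cell.\<close>
  define q where "q x = (LEAST i. d (a i) x < e / 6)" for x
  have [measurable]: "d (a i) \<in> borel_measurable (borel_of mtopology)" for i by (rule dist_measurable[OF a(1)])
  have q_meas[measurable]: "q \<in> measurable (borel_of mtopology) (count_space UNIV)"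
    unfolding q_def by measurable
  have q: "d (a (q x)) x < e / 6" if "x \<in> M" for x
  proof -
    have "\<exists>i. d (a i) x < e / 6" using a(2)[OF that, of "e / 6"] e by (simp add: commute)
    then show ?thesis unfolding q_def by (rule LeastI_ex[where P="\<lambda>i. d (a i) x < e / 6"])
  qed
  have eq: "distr \<pi>12 (count_space UNIV) (\<lambda>z. q (snd z)) = distr \<pi>23 (count_space UNIV) (\<lambda>z. q (fst z))"
  proof -
    have "distr \<pi>12 (count_space UNIV) (\<lambda>z. q (snd z)) = distr (distr \<pi>12 \<mu>2 snd) (count_space UNIV) q"
      by (subst distr_distr) (auto simp: comp_def)
    also have "\<dots> = distr (distr \<pi>23 \<mu>2 fst) (count_space UNIV) q"
      by (simp only: c12(4) c23(3))
    also have "\<dots> = distr \<pi>23 (count_space UNIV) (\<lambda>z. q (fst z))"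
      by (subst distr_distr) (auto simp: comp_def)
    finally show ?thesis .
  qed
  obtain G where G: "sets G = sets (\<pi>12 \<Otimes>\<^sub>M \<pi>23)" "prob_space G" "distr G \<pi>12 fst = \<pi>12" "distr G \<pi>23 snd = \<pi>23"
    and AE_G: "AE z in G. q (snd (fst z)) = q (fst (snd z))"
    by (rule discrete_gluing[OF c12(2) c23(2) _ _ eq]) measurable
  note [measurable_cong] = G(1)
  have sp: "fst (fst z) \<in> M" "snd (fst z) \<in> M" "fst (snd z) \<in> M" "snd (snd z) \<in> M" if "z \<in> space G" for z
    using that by (simp_all add: sets_eq_imp_space_eq[OF G(1)] space_pair_measure c12(5) c23(5) mem_Times_iff
        wp_spaceD(3)[OF \<mu>(1)] wp_spaceD(3)[OF \<mu>(2)] wp_spaceD(3)[OF \<mu>(3)])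
  have [measurable]: "(\<lambda>z. d (fst z) (snd z)) \<in> borel_measurable \<pi>12"
    "(\<lambda>z. d (fst z) (snd z)) \<in> borel_measurable \<pi>23"
    by (intro dist_measurable_comp; measurable)+
  have [measurable]: "(\<lambda>z. d (fst (fst z)) (snd (fst z))) \<in> borel_measurable G"
    "(\<lambda>z. d (fst (snd z)) (snd (snd z))) \<in> borel_measurable G"
    by (intro dist_measurable_comp; measurable)+
  have G12: "(\<integral>\<^sup>+ z. ennreal (d (fst (fst z)) (snd (fst z)) powr p) \<partial>G) = cost d p \<pi>12"
  proof -
    have "cost d p \<pi>12 = (\<integral>\<^sup>+ x. ennreal (d (fst x) (snd x) powr p) \<partial>distr G \<pi>12 fst)"
      by (simp add: G(3) cost_def)
    then show ?thesis by (simp add: nn_integral_distr)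
  qed
  have G23: "(\<integral>\<^sup>+ z. ennreal (d (fst (snd z)) (snd (snd z)) powr p) \<partial>G) = cost d p \<pi>23"
  proof -
    have "cost d p \<pi>23 = (\<integral>\<^sup>+ x. ennreal (d (fst x) (snd x) powr p) \<partial>distr G \<pi>23 snd)"
      by (simp add: G(4) cost_def)
    then show ?thesis by (simp add: nn_integral_distr)
  qed
  have le: "(\<integral>\<^sup>+ z. ennreal ((d (fst (fst z)) (snd (fst z)) + e / 3) powr p) \<partial>G) \<le> ennreal ((A + e / 3) powr p)"
    by (rule minkowski_nn_integral_powr[OF p, where f="\<lambda>z. d (fst (fst z)) (snd (fst z))" and g="\<lambda>_. e / 3"])
      (use e AB \<pi>12 G12 prob_space.emeasure_space_1[OF G(2)] in \<open>auto simp: add_nonneg_nonneg\<close>)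
  have le2: "(\<integral>\<^sup>+ z. ennreal (d (fst (fst z)) (snd (snd z)) powr p) \<partial>G) \<le> ennreal ((A + e / 3 + B) powr p)"
  proof (rule minkowski_nn_integral_powr[OF p, where f="\<lambda>z. d (fst (fst z)) (snd (fst z)) + e / 3"
        and g="\<lambda>z. d (fst (snd z)) (snd (snd z))"])
    show "AE z in G. d (fst (fst z)) (snd (snd z)) \<le> d (fst (fst z)) (snd (fst z)) + e / 3 + d (fst (snd z)) (snd (snd z))"
      using AE_G AE_space
    proof eventually_elim
      case (elim z)
      note s = sp[OF elim(2)]
      have "d (snd (fst z)) (fst (snd z)) \<le> d (a (q (snd (fst z)))) (snd (fst z)) + d (a (q (snd (fst z)))) (fst (snd z))"
        by (intro triangle'' s a)
      then have "d (snd (fst z)) (fst (snd z)) \<le> e / 3"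
        using q[OF s(2)] q[OF s(3)] elim(1) by simp
      then show ?case
        using triangle[OF s(1) s(2) s(4)] triangle[OF s(2) s(3) s(4)] by linarith
    qed
  qed (use e AB \<pi>23 G23 le in \<open>auto intro: add_nonneg_nonneg add_pos_pos\<close>)
  define X where "X z = fst (fst z)" for z :: "('a \<times> 'a) \<times> ('a \<times> 'a)"
  define Y where "Y z = snd (snd z)" for z :: "('a \<times> 'a) \<times> ('a \<times> 'a)"
  have XY[measurable]: "X \<in> measurable G \<mu>1" "Y \<in> measurable G \<mu>3"
    unfolding X_def Y_def using c12(6) c23(7) by measurable
  have "distr G \<mu>1 X = distr (distr G \<pi>12 fst) \<mu>1 fst"
    unfolding X_def using c12(6) by (subst distr_distr) (auto simp: comp_def)
  then have dX: "distr G \<mu>1 X = \<mu>1" by (simp only: G(3) c12(3))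
  have "distr G \<mu>3 Y = distr (distr G \<pi>23 snd) \<mu>3 snd"
    unfolding Y_def using c23(7) by (subst distr_distr) (auto simp: comp_def)
  then have dY: "distr G \<mu>3 Y = \<mu>3" by (simp only: G(4) c23(4))
  have "wass d p \<mu>1 \<mu>3 \<le> A + e / 3 + B"
  proof (rule wass_le[OF distr_pair_in_couplings[OF G(2) refl refl XY dX dY] _ _ p])
    show "cost d p (distr G (\<mu>1 \<Otimes>\<^sub>M \<mu>3) (\<lambda>w. (X w, Y w))) \<le> ennreal ((A + e / 3 + B) powr p)"
      using le2 XY wp_spaceD(1)[OF \<mu>(1)] wp_spaceD(1)[OF \<mu>(3)]
      by (subst cost_distr_pair) (auto simp: X_def[abs_def] Y_def[abs_def] intro: dist_pair_measurable)
  qed (use e AB in simp)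
  then show "wass d p \<mu>1 \<mu>3 \<le> wass d p \<mu>1 \<mu>2 + wass d p \<mu>2 \<mu>3 + e"
    by (simp add: A_def B_def)
qed

lemma wass_refl:
  assumes p: "1 \<le> p" and \<mu>: "\<mu> \<in> wp_space M d p"
  shows "wass d p \<mu> \<mu> = 0"
proof -
  have "wass d p \<mu> \<mu> \<le> 0"
  proof (rule wass_le[OF distr_pair_in_couplings[OF wp_spaceD(2)[OF \<mu>], of \<mu> \<mu> \<mu> \<mu> "\<lambda>x. x" "\<lambda>x. x"] _ _ p])
    have "cost d p (distr \<mu> (\<mu> \<Otimes>\<^sub>M \<mu>) (\<lambda>w. (w, w))) = (\<integral>\<^sup>+ w. ennreal (d w w powr p) \<partial>\<mu>)"
      using wp_spaceD(1)[OF \<mu>] by (intro cost_distr_pair dist_pair_measurable) auto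
    also have "\<dots> = (\<integral>\<^sup>+ w. 0 \<partial>\<mu>)" using wp_spaceD(3)[OF \<mu>] by (intro nn_integral_cong) simp
    finally show "cost d p (distr \<mu> (\<mu> \<Otimes>\<^sub>M \<mu>) (\<lambda>w. (w, w))) \<le> ennreal (0 powr p)" by simp
  qed auto
  then show ?thesis by (simp add: antisym)
qed

text \<open>Couplings of cost at most \<open>e powr p\<close> exist for every e > 0, and they make
  the mean distance at most 2 e. Integrals of a Lipschitz function under both marginals therefore
  coincide, without an optimal coupling.\<close>

lemma wass_zero_imp_eq:
  assumes p: "1 \<le> p" and \<mu>: "\<mu> \<in> wp_space M d p" and \<nu>: "\<nu> \<in> wp_space M d p"
    and zero: "wass d p \<mu> \<nu> = 0"
  shows "\<mu> = \<nu>"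
proof (rule prob_measure_eqI_lipschitz_test[OF wp_spaceD(1)[OF \<mu>] wp_spaceD(1)[OF \<nu>] wp_spaceD(2)[OF \<mu>] wp_spaceD(2)[OF \<nu>]])
  fix \<phi> assume \<phi>: "lipschitz_test \<phi>"
  obtain L where L: "\<And>x y. x \<in> M \<Longrightarrow> y \<in> M \<Longrightarrow> \<bar>\<phi> x - \<phi> y\<bar> \<le> L * d x y"
    using \<phi> unfolding lipschitz_test_def by blast
  note [measurable_cong] = wp_spaceD(1)[OF \<mu>] wp_spaceD(1)[OF \<nu>]
  note \<phi>_meas[measurable] = lipschitz_test_measurable[OF \<phi>]
  have bound: "\<bar>(\<integral>x. \<phi> x \<partial>\<mu>) - (\<integral>x. \<phi> x \<partial>\<nu>)\<bar> \<le> max 0 L * (2 * e)" if e: "0 < e" for e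
  proof -
    obtain \<pi> where \<pi>: "\<pi> \<in> couplings \<mu> \<nu>" "cost d p \<pi> \<le> ennreal (e powr p)"
      using wass_coupling[OF \<mu> \<nu> p, of e] e zero by auto
    note c = couplingsD[OF \<pi>(1)]
    note [measurable_cong] = c(1)
    interpret prob_space \<pi> by (rule c(2))
    have sp: "fst z \<in> M" "snd z \<in> M" if "z \<in> space \<pi>" for z
      using that by (simp_all add: c(5) mem_Times_iff wp_spaceD(3)[OF \<mu>] wp_spaceD(3)[OF \<nu>])
    have d_meas[measurable]: "(\<lambda>z. d (fst z) (snd z)) \<in> borel_measurable \<pi>"
      by (intro dist_measurable_comp) measurable
    have \<phi>1: "(\<integral>x. \<phi> x \<partial>\<mu>) = (\<integral>z. \<phi> (fst z) \<partial>\<pi>)"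
      using integral_distr[OF c(6), of \<phi>] c(3) by simp
    have \<phi>2: "(\<integral>x. \<phi> x \<partial>\<nu>) = (\<integral>z. \<phi> (snd z) \<partial>\<pi>)"
      using integral_distr[OF c(7), of \<phi>] c(4) by simp
    have int1: "integrable \<pi> (\<lambda>z. \<phi> (fst z))" and int2: "integrable \<pi> (\<lambda>z. \<phi> (snd z))"
      using \<phi> sp by (auto intro!: integrable_const_bound[where B=1] simp: lipschitz_test_def)
    have "(\<integral>\<^sup>+ z. ennreal (d (fst z) (snd z)) \<partial>\<pi>)
        \<le> (\<integral>\<^sup>+ z. ennreal e + ennreal (e powr (1 - p)) * ennreal (d (fst z) (snd z) powr p) \<partial>\<pi>)"
    proof (rule nn_integral_mono)
      fix z
      define t where "t = d (fst z) (snd z)"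
      have t: "0 \<le> t" by (simp add: t_def)
      \<comment> \<open>An elementary substitute for Hoelder's inequality: above the threshold e,
        the p-th power times \<open>e powr (1 - p)\<close> dominates t. After integration each
        summand contributes at most e.\<close>
      have "t \<le> e + e powr (1 - p) * t powr p"
      proof (cases "t \<le> e")
        case False
        then have "t powr (1 - p) \<le> e powr (1 - p)" using e p by (intro powr_mono2') auto
        then have "t powr (1 - p) * t powr p \<le> e powr (1 - p) * t powr p" by (intro mult_right_mono) auto
        moreover have "t powr (1 - p) * t powr p = t" using False e by (simp add: powr_add[symmetric])
        ultimately show ?thesis using e by simp
      qed (simp add: add_increasing2)
      then show "ennreal (d (fst z) (snd z)) \<le> ennreal e + ennreal (e powr (1 - p)) * ennreal (d (fst z) (snd z) powr p)"
        using e by (simp add: t_def ennreal_mult'[symmetric] ennreal_plus[symmetric] del: ennreal_plus)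
    qed
    also have "\<dots> = ennreal e + ennreal (e powr (1 - p)) * cost d p \<pi>"
      by (simp add: nn_integral_add nn_integral_cmult emeasure_space_1 cost_def)
    also have "\<dots> \<le> ennreal e + ennreal (e powr (1 - p)) * ennreal (e powr p)"
      using \<pi>(2) by (intro add_left_mono mult_left_mono) auto
    also have "\<dots> = ennreal (2 * e)"
      using e by (simp add: ennreal_mult'[symmetric] ennreal_plus[symmetric] powr_add[symmetric] del: ennreal_plus)
    finally have d_le: "(\<integral>\<^sup>+ z. ennreal (d (fst z) (snd z)) \<partial>\<pi>) \<le> ennreal (2 * e)" .
    have d_int: "integrable \<pi> (\<lambda>z. d (fst z) (snd z))"
      using d_le by (intro integrableI_bounded d_meas) (auto simp: top_unique intro: order.strict_trans1)
    have d_int_le: "(\<integral>z. d (fst z) (snd z) \<partial>\<pi>) \<le> 2 * e"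
      using d_le e by (subst integral_eq_nn_integral) (auto intro!: enn2real_leI)
    have "\<bar>(\<integral>x. \<phi> x \<partial>\<mu>) - (\<integral>x. \<phi> x \<partial>\<nu>)\<bar> = \<bar>\<integral>z. \<phi> (fst z) - \<phi> (snd z) \<partial>\<pi>\<bar>"
      unfolding \<phi>1 \<phi>2 using int1 int2 by simp
    also have "\<dots> \<le> (\<integral>z. \<bar>\<phi> (fst z) - \<phi> (snd z)\<bar> \<partial>\<pi>)" by (rule integral_abs_bound)
    also have "\<dots> \<le> (\<integral>z. max 0 L * d (fst z) (snd z) \<partial>\<pi>)"
    proof (rule integral_mono)
      fix z assume "z \<in> space \<pi>"
      then have "\<bar>\<phi> (fst z) - \<phi> (snd z)\<bar> \<le> L * d (fst z) (snd z)" using L sp by blast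
      also have "\<dots> \<le> max 0 L * d (fst z) (snd z)" by (intro mult_right_mono) auto
      finally show "\<bar>\<phi> (fst z) - \<phi> (snd z)\<bar> \<le> max 0 L * d (fst z) (snd z)" .
    qed (use int1 int2 d_int in auto)
    also have "\<dots> \<le> max 0 L * (2 * e)" using d_int_le by (simp add: mult_left_mono)
    finally show ?thesis .
  qed
  have "\<bar>(\<integral>x. \<phi> x \<partial>\<mu>) - (\<integral>x. \<phi> x \<partial>\<nu>)\<bar> \<le> 0"
  proof (rule field_le_epsilon)
    fix e :: real assume e: "0 < e"
    define c where "c = 2 * (max 0 L + 1)"
    have c: "0 < c" by (simp add: c_def add_nonneg_pos)
    have "max 0 L * (2 * (e / c)) \<le> e"
      using e c by (simp add: c_def field_simps)
    then show "\<bar>(\<integral>x. \<phi> x \<partial>\<mu>) - (\<integral>x. \<phi> x \<partial>\<nu>)\<bar> \<le> 0 + e" using bound[of "e / c"] e c by simp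
  qed
  then show "(\<integral>x. \<phi> x \<partial>\<mu>) = (\<integral>x. \<phi> x \<partial>\<nu>)" by simp
qed

theorem wass_Metric_space:
  assumes p: "1 \<le> p"
  shows "Metric_space (wp_space M d p) (wass d p)"
proof
  show "wass d p \<mu> \<nu> = wass d p \<nu> \<mu>" for \<mu> \<nu> by (rule wass_commute[OF commute])
  show "(wass d p \<mu> \<nu> = 0) = (\<mu> = \<nu>)" if "\<mu> \<in> wp_space M d p" "\<nu> \<in> wp_space M d p" for \<mu> \<nu>
    using wass_refl[OF p] wass_zero_imp_eq[OF p] that by auto
qed (use wass_triangle[OF p] in auto)

end

section \<open>Lower semicontinuity of the Wasserstein distance\<close>

text \<open>When all couplings have infinite cost the left-hand side is 0, so no finiteness
  enters.\<close>

lemma wass_powr_le_cost: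
  assumes "\<pi> \<in> couplings \<mu> \<nu>" "1 \<le> p"
  shows "ennreal (wass d p \<mu> \<nu> powr p) \<le> cost d p \<pi>"
proof -
  have "wass d p \<mu> \<nu> powr p = enn2real (INF \<pi>\<in>couplings \<mu> \<nu>. cost d p \<pi>)"
    using assms(2) by (simp add: wass_def cost_def powr_powr)
  then have "ennreal (wass d p \<mu> \<nu> powr p) \<le> (INF \<pi>\<in>couplings \<mu> \<nu>. cost d p \<pi>)"
    by (cases "INF \<pi>\<in>couplings \<mu> \<nu>. cost d p \<pi>") auto
  also have "\<dots> \<le> cost d p \<pi>" using assms(1) by (rule INF_lower)
  finally show ?thesis .
qed

section \<open>Weak convergence and tightness from moment bounds\<close>

context Metric_space
begin

lemma near_optimal_coupling:
  assumes \<mu>: "\<mu> \<in> wp_space M d p" and \<nu>: "\<nu> \<in> wp_space M d p" and p: "1 \<le> p" and e: "0 < e"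
  shows "\<exists>\<pi>\<in>couplings \<mu> \<nu>. cost d p \<pi> \<le> ennreal (wass d p \<mu> \<nu> powr p) + ennreal e"
proof -
  define A where "A = (wass d p \<mu> \<nu> powr p + e) powr (1 / p)"
  have Ap: "A powr p = wass d p \<mu> \<nu> powr p + e"
    using e p by (simp add: A_def powr_powr)
  have "wass d p \<mu> \<nu> < A"
  proof (rule ccontr)
    assume "\<not> ?thesis"
    then have "A powr p \<le> wass d p \<mu> \<nu> powr p" using p by (intro powr_mono2) (auto simp: A_def)
    then show False using Ap e by simp
  qed
  from wass_coupling[OF \<mu> \<nu> p this] show ?thesis
    using Ap e by (metis ennreal_plus less_imp_le powr_ge_zero)
qed

lemma limitin_dist:
  assumes "limitin mtopology X x sequentially" "limitin mtopology Y y sequentially"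
    and "\<And>n. X n \<in> M" "\<And>n. Y n \<in> M"
  shows "(\<lambda>n. d (X n) (Y n)) \<longlonglongrightarrow> d x y"
proof (rule metric_tendsto_imp_tendsto[where f="\<lambda>n. d (X n) x + d (Y n) y" and a=0])
  show "(\<lambda>n. d (X n) x + d (Y n) y) \<longlonglongrightarrow> 0"
    using assms by (intro tendsto_add_zero) (simp_all add: limitin_metric_dist_null)
  have xy: "x \<in> M" "y \<in> M" using assms limitin_mspace by blast+
  show "\<forall>\<^sub>F n in sequentially. dist (d (X n) (Y n)) (d x y) \<le> dist (d (X n) x + d (Y n) y) 0"
  proof (intro always_eventually allI)
    fix n
    have "d (X n) (Y n) \<le> d (X n) x + d x (Y n)" "d x (Y n) \<le> d x y + d (Y n) y"
      using triangle[of "X n" x "Y n"] triangle'[of x y "Y n"] xy assms(3,4) by simp_all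
    moreover have "d x y \<le> d (X n) x + d (X n) y" "d (X n) y \<le> d (X n) (Y n) + d (Y n) y"
      using triangle''[of x "X n" y] triangle[of "X n" "Y n" y] xy assms(3,4) by simp_all
    ultimately show "dist (d (X n) (Y n)) (d x y) \<le> dist (d (X n) x + d (Y n) y) 0"
      by (simp add: dist_real_def abs_le_iff)
  qed
qed

definition weakly_to :: "(nat \<Rightarrow> 'a measure) \<Rightarrow> 'a measure \<Rightarrow> bool" where
  "weakly_to \<mu> \<kappa> \<longleftrightarrow> (\<forall>\<phi>. lipschitz_test \<phi> \<longrightarrow> (\<lambda>n. \<integral>x. \<phi> x \<partial>\<mu> n) \<longlonglongrightarrow> (\<integral>x. \<phi> x \<partial>\<kappa>))"

lemma weakly_to_subseq:
  assumes "weakly_to \<mu> \<kappa>" "strict_mono r"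
  shows "weakly_to (\<lambda>n. \<mu> (r n)) \<kappa>"
  unfolding weakly_to_def
proof (intro allI impI)
  fix \<phi> assume "lipschitz_test \<phi>"
  then have "(\<lambda>n. integral\<^sup>L (\<mu> n) \<phi>) \<longlonglongrightarrow> integral\<^sup>L \<kappa> \<phi>" using assms(1) by (simp add: weakly_to_def)
  from LIMSEQ_subseq_LIMSEQ[OF this assms(2)]
  show "(\<lambda>n. integral\<^sup>L (\<mu> (r n)) \<phi>) \<longlonglongrightarrow> integral\<^sup>L \<kappa> \<phi>" by (simp add: comp_def)
qed

lemma weakly_to_unique:
  assumes "weakly_to \<mu> \<kappa>" "weakly_to \<mu> \<kappa>'" "prob_space \<kappa>" "prob_space \<kappa>'"
    "sets \<kappa> = sets (borel_of mtopology)" "sets \<kappa>' = sets (borel_of mtopology)"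
  shows "\<kappa> = \<kappa>'"
  using assms unfolding weakly_to_def by (intro prob_measure_eqI_lipschitz_test) (auto intro: LIMSEQ_unique)

lemma limitin_imp_weakly_to:
  assumes \<Omega>: "prob_space \<Omega>" and X[measurable]: "\<And>n. X n \<in> measurable \<Omega> (borel_of mtopology)"
    and Y[measurable]: "Y \<in> measurable \<Omega> (borel_of mtopology)"
    and lim: "\<And>w. w \<in> space \<Omega> \<Longrightarrow> limitin mtopology (\<lambda>n. X n w) (Y w) sequentially"
  shows "weakly_to (\<lambda>n. distr \<Omega> (borel_of mtopology) (X n)) (distr \<Omega> (borel_of mtopology) Y)"
  unfolding weakly_to_def
proof (intro allI impI)
  fix \<phi> assume \<phi>: "lipschitz_test \<phi>"
  obtain L where L: "\<And>x y. x \<in> M \<Longrightarrow> y \<in> M \<Longrightarrow> \<bar>\<phi> x - \<phi> y\<bar> \<le> L * d x y"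
    using \<phi> unfolding lipschitz_test_def by blast
  interpret prob_space \<Omega> by (rule \<Omega>)
  note [measurable] = lipschitz_test_measurable[OF \<phi>]
  have sp: "X n w \<in> M" "Y w \<in> M" if "w \<in> space \<Omega>" for n w
    using measurable_space[OF X that] measurable_space[OF Y that] by auto
  have "(\<lambda>n. \<integral>w. \<phi> (X n w) \<partial>\<Omega>) \<longlonglongrightarrow> (\<integral>w. \<phi> (Y w) \<partial>\<Omega>)"
  proof (rule integral_dominated_convergence[where w="\<lambda>_. 1"])
    show "AE w in \<Omega>. (\<lambda>n. \<phi> (X n w)) \<longlonglongrightarrow> \<phi> (Y w)"
    proof (rule AE_I2)
      fix w assume w: "w \<in> space \<Omega>"
      have "(\<lambda>n. L * d (X n w) (Y w)) \<longlonglongrightarrow> 0"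
        using lim[OF w] by (intro tendsto_mult_right_zero) (simp add: limitin_metric_dist_null)
      moreover have "\<forall>\<^sub>F n in sequentially. norm (\<phi> (X n w) - \<phi> (Y w)) \<le> L * d (X n w) (Y w)"
        using L sp[OF w] by (intro always_eventually allI) simp
      ultimately have "(\<lambda>n. \<phi> (X n w) - \<phi> (Y w)) \<longlonglongrightarrow> 0"
        by (rule Lim_null_comparison[rotated])
      then show "(\<lambda>n. \<phi> (X n w)) \<longlonglongrightarrow> \<phi> (Y w)" by (rule LIM_zero_cancel)
    qed
    show "AE w in \<Omega>. norm (\<phi> (X n w)) \<le> 1" for n
      using sp \<phi> by (intro AE_I2) (simp add: lipschitz_test_def)
  qed auto
  then show "(\<lambda>n. \<integral>x. \<phi> x \<partial>distr \<Omega> (borel_of mtopology) (X n)) \<longlonglongrightarrow> (\<integral>x. \<phi> x \<partial>distr \<Omega> (borel_of mtopology) Y)"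
    by (simp add: integral_distr)
qed

text \<open>Markov's inequality. The summand 1 in the threshold R ensures both R \<ge> 1, hence
  \<open>R \<le> R powr p\<close>, and the strict inequality
  \<open>C powr p < R * e\<close>.\<close>

lemma wp_space_tail_bound:
  assumes \<mu>: "\<mu> \<in> wp_space M d p" and p: "1 \<le> p" and x: "x \<in> M" and C: "pmean p \<mu> x \<le> C" and e: "0 < e"
  shows "measure \<mu> {y\<in>M. C powr p / e + 1 < d x y} < e"
proof -
  define R where "R = C powr p / e + 1"
  define A where "A = {y\<in>M. R < d x y}"
  interpret prob_space \<mu> by (rule wp_spaceD[OF \<mu>])
  note [measurable] = dist_measurable_wp[OF \<mu> x]
  have R: "1 \<le> R" using e by (simp add: R_def)
  have A[measurable]: "A \<in> sets \<mu>"
  proof -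
    have "{y\<in>space \<mu>. R < d x y} \<in> sets \<mu>" by measurable
    then show ?thesis by (simp add: A_def wp_spaceD(3)[OF \<mu>])
  qed
  have "ennreal (R * prob A) = ennreal R * emeasure \<mu> A"
    using R by (simp add: emeasure_eq_measure ennreal_mult'')
  also have "\<dots> = (\<integral>\<^sup>+ y. ennreal R * indicator A y \<partial>\<mu>)"
    using A by (simp add: nn_integral_cmult_indicator)
  also have "\<dots> \<le> (\<integral>\<^sup>+ y. ennreal (d x y powr p) \<partial>\<mu>)"
  proof (rule nn_integral_mono)
    fix y
    have "R \<le> d x y powr p" if "y \<in> A"
    proof -
      have "R \<le> R powr p" using powr_mono[of 1 p R] p R by simp
      also have "\<dots> \<le> d x y powr p" using that p R by (intro powr_mono2) (auto simp: A_def)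
      finally show ?thesis .
    qed
    then show "ennreal R * indicator A y \<le> ennreal (d x y powr p)"
      by (auto simp: indicator_def intro: ennreal_leI)
  qed
  also have "\<dots> = ennreal (pmean p \<mu> x powr p)" by (rule nn_integral_eq_pmean[OF \<mu> p x])
  also have "\<dots> \<le> ennreal (C powr p)" using C p by (intro ennreal_leI powr_mono2) auto
  finally have "R * prob A \<le> C powr p" by (simp add: ennreal_le_iff)
  also have "\<dots> < R * e" using e by (simp add: R_def distrib_right)
  finally show ?thesis using R by (simp add: A_def R_def[symmetric])
qed

end

context separable_metric
begin

lemma fatou_dist:
  assumes X[measurable]: "\<And>n. X n \<in> measurable \<Omega> (borel_of mtopology)" "\<And>n. Y n \<in> measurable \<Omega> (borel_of mtopology)"
    and lim: "\<And>w. w \<in> space \<Omega> \<Longrightarrow> limitin mtopology (\<lambda>n. X n w) (X' w) sequentially"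
      "\<And>w. w \<in> space \<Omega> \<Longrightarrow> limitin mtopology (\<lambda>n. Y n w) (Y' w) sequentially"
    and p: "1 \<le> p"
  shows "(\<integral>\<^sup>+ w. ennreal (d (X' w) (Y' w) powr p) \<partial>\<Omega>) \<le> liminf (\<lambda>n. \<integral>\<^sup>+ w. ennreal (d (X n w) (Y n w) powr p) \<partial>\<Omega>)"
proof -
  have "(\<integral>\<^sup>+ w. ennreal (d (X' w) (Y' w) powr p) \<partial>\<Omega>) = (\<integral>\<^sup>+ w. liminf (\<lambda>n. ennreal (d (X n w) (Y n w) powr p)) \<partial>\<Omega>)"
  proof (rule nn_integral_cong)
    fix w assume w: "w \<in> space \<Omega>"
    have "X n w \<in> M" "Y n w \<in> M" for n
      using measurable_space[OF X(1) w] measurable_space[OF X(2) w] by auto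
    then have "(\<lambda>n. ennreal (d (X n w) (Y n w) powr p)) \<longlonglongrightarrow> ennreal (d (X' w) (Y' w) powr p)"
      using p by (intro tendsto_ennrealI tendsto_powr_nonneg limitin_dist lim w) auto
    then show "ennreal (d (X' w) (Y' w) powr p) = liminf (\<lambda>n. ennreal (d (X n w) (Y n w) powr p))"
      by (rule lim_imp_Liminf[OF sequentially_bot, symmetric])
  qed
  also have "\<dots> \<le> liminf (\<lambda>n. \<integral>\<^sup>+ w. ennreal (d (X n w) (Y n w) powr p) \<partial>\<Omega>)"
  proof (rule nn_integral_liminf)
    have [measurable]: "(\<lambda>w. d (X n w) (Y n w)) \<in> borel_measurable \<Omega>" for n
      by (rule dist_measurable_comp) measurable
    show "(\<lambda>w. ennreal (d (X n w) (Y n w) powr p)) \<in> borel_measurable \<Omega>" for n by measurable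
  qed
  finally show ?thesis .
qed

end

section \<open>Weak compactness, joint representation of couplings, and the case of equality in
  lower semicontinuity\<close>

context proper_metric
begin

text \<open>Bounded moments give tightness, and Fatou's lemma keeps the p-th moment of the limit
  finite. Moments may still drop in the limit, so convergence in the Wasserstein distance is not yet
  obtained.\<close>

lemma wp_space_weakly_convergent_subseq:
  fixes \<mu> :: "nat \<Rightarrow> 'a measure"
  assumes \<mu>: "\<And>n. \<mu> n \<in> wp_space M d p" and p: "1 \<le> p" and x: "x \<in> M" and C: "\<And>n. pmean p (\<mu> n) x \<le> C"
  obtains r \<kappa> where "strict_mono r" "\<kappa> \<in> wp_space M d p" "weakly_to (\<lambda>n. \<mu> (r n)) \<kappa>"
proof -
  have tight: "\<exists>R. \<forall>n. measure (\<mu> n) {y\<in>M. R < d x y} < e" if "0 < e" for e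
    using wp_space_tail_bound[OF \<mu> p x C that] by blast
  obtain r :: "nat \<Rightarrow> nat" and \<Omega> :: "real measure" and X Y where r: "strict_mono r" and \<Omega>: "prob_space \<Omega>"
    and X: "\<And>n. X n \<in> measurable \<Omega> (borel_of mtopology)" and Y: "Y \<in> measurable \<Omega> (borel_of mtopology)"
    and dX: "\<And>n. distr \<Omega> (borel_of mtopology) (X n) = \<mu> (r n)"
    and lim: "\<And>w. w \<in> space \<Omega> \<Longrightarrow> limitin mtopology (\<lambda>n. X n w) (Y w) sequentially"
    using tight_imp_skorohod_representation[OF wp_spaceD(1)[OF \<mu>] wp_spaceD(2)[OF \<mu>] x tight] by blast
  define \<kappa> where "\<kappa> = distr \<Omega> (borel_of mtopology) Y"
  have weak: "weakly_to (\<lambda>n. \<mu> (r n)) \<kappa>"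
    using limitin_imp_weakly_to[OF \<Omega> X Y lim] by (simp add: dX \<kappa>_def)
  have dx: "(\<lambda>y. ennreal (d x y powr p)) \<in> borel_measurable (borel_of mtopology)"
    using dist_measurable[OF x] by measurable
  have "(\<integral>\<^sup>+ y. ennreal (d x y powr p) \<partial>\<kappa>) = (\<integral>\<^sup>+ w. ennreal (d x (Y w) powr p) \<partial>\<Omega>)"
    unfolding \<kappa>_def using Y dx by (subst nn_integral_distr) auto
  also have "\<dots> \<le> liminf (\<lambda>n. \<integral>\<^sup>+ w. ennreal (d x (X n w) powr p) \<partial>\<Omega>)"
    using x by (intro fatou_dist X lim p) auto
  also have "\<dots> \<le> liminf (\<lambda>n. ennreal (C powr p))"
  proof (intro Liminf_mono always_eventually allI)
    fix n
    have "(\<integral>\<^sup>+ w. ennreal (d x (X n w) powr p) \<partial>\<Omega>) = (\<integral>\<^sup>+ y. ennreal (d x y powr p) \<partial>\<mu> (r n))"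
      unfolding dX[symmetric] using X dx by (subst nn_integral_distr) auto
    also have "\<dots> = ennreal (pmean p (\<mu> (r n)) x powr p)" by (rule nn_integral_eq_pmean[OF \<mu> p x])
    also have "\<dots> \<le> ennreal (C powr p)" using C p by (intro ennreal_leI powr_mono2) auto
    finally show "(\<integral>\<^sup>+ w. ennreal (d x (X n w) powr p) \<partial>\<Omega>) \<le> ennreal (C powr p)" .
  qed
  also have "\<dots> < \<infinity>" by (simp add: Liminf_const)
  finally have "\<kappa> \<in> wp_space M d p"
    using prob_space.prob_space_distr[OF \<Omega> Y] x by (intro wp_spaceI) (auto simp: \<kappa>_def)
  then show ?thesis using that r weak by blast
qed

text \<open>The couplings themselves are represented, not their marginals, so that the almost sure
  limit keeps the pairing and the costs. The price is that the second coordinate \<open>Y n\<close>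
  varies with n although its law is always \<nu>.\<close>

lemma couplings_skorohod:
  fixes \<mu> :: "nat \<Rightarrow> 'a measure"
  assumes \<mu>: "\<And>n. \<mu> n \<in> wp_space M d p" and \<kappa>: "\<kappa> \<in> wp_space M d p" and \<nu>: "\<nu> \<in> wp_space M d p"
    and p: "1 \<le> p" and x: "x \<in> M" and C: "\<And>n. pmean p (\<mu> n) x \<le> C"
    and weak: "weakly_to \<mu> \<kappa>" and \<pi>: "\<And>n. \<pi> n \<in> couplings (\<mu> n) \<nu>"
  obtains s :: "nat \<Rightarrow> nat" and \<Omega> :: "real measure" and X Y X' Y' where
    "strict_mono s" "prob_space \<Omega>"
    "\<And>n. X n \<in> measurable \<Omega> (borel_of mtopology)" "\<And>n. Y n \<in> measurable \<Omega> (borel_of mtopology)"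
    "X' \<in> measurable \<Omega> (borel_of mtopology)" "Y' \<in> measurable \<Omega> (borel_of mtopology)"
    "\<And>n. distr \<Omega> (borel_of mtopology) (X n) = \<mu> (s n)" "\<And>n. distr \<Omega> (borel_of mtopology) (Y n) = \<nu>"
    "distr \<Omega> (borel_of mtopology) X' = \<kappa>" "distr \<Omega> (borel_of mtopology) Y' = \<nu>"
    "\<And>w. w \<in> space \<Omega> \<Longrightarrow> limitin mtopology (\<lambda>n. X n w) (X' w) sequentially"
    "\<And>w. w \<in> space \<Omega> \<Longrightarrow> limitin mtopology (\<lambda>n. Y n w) (Y' w) sequentially"
    "\<And>n. (\<integral>\<^sup>+ w. ennreal (d (X n w) (Y n w) powr p) \<partial>\<Omega>) = cost d p (\<pi> (s n))"
proof -
  let ?B = "borel_of mtopology"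
  interpret P: proper_metric "M \<times> M" "prod_dist d d"
    by (rule proper_metric_prod) unfold_locales
  interpret PP: Metric_space12 M d M d ..
  have sets_P: "sets (borel_of P.mtopology) = sets (?B \<Otimes>\<^sub>M ?B)"
    by (rule proper_metric_prod) unfold_locales
  have sets_\<pi>: "sets (\<pi> n) = sets (?B \<Otimes>\<^sub>M ?B)" for n
    using couplingsD(1)[OF \<pi>] sets_pair_measure_cong[OF wp_spaceD(1)[OF \<mu>] wp_spaceD(1)[OF \<nu>]] by simp
  then have sets_\<pi>': "sets (\<pi> n) = sets (borel_of P.mtopology)" for n by (simp add: sets_P)
  have xx: "(x, x) \<in> M \<times> M" using x by simp
  define D where "D = max C (pmean p \<nu> x)"
  have tight: "\<exists>R. \<forall>n. measure (\<pi> n) {z\<in>M \<times> M. R < prod_dist d d (x, x) z} < e" if e: "0 < e" for e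
  proof (intro exI allI)
    fix n
    define R where "R = D powr p / (e / 2) + 1"
    define A where "A = {y\<in>M. R < d x y}"
    interpret prob_space "\<pi> n" by (rule couplingsD[OF \<pi>])
    note [measurable] = couplingsD(6,7)[OF \<pi>, of n]
    have A: "A \<in> sets (\<mu> n)" "A \<in> sets \<nu>"
    proof -
      have "{y\<in>space ?B. R < d x y} \<in> sets ?B" using dist_measurable[OF x] by measurable
      then show "A \<in> sets (\<mu> n)" "A \<in> sets \<nu>" by (simp_all add: A_def wp_spaceD(1)[OF \<mu>] wp_spaceD(1)[OF \<nu>])
    qed
    \<comment> \<open>The product distance is at most the sum of the coordinate distances, so beyond
      2 R one coordinate is beyond R. Each marginal tail is below e/2, with D as a moment bound
      common to both.\<close>
    have "measure (\<pi> n) {z\<in>M \<times> M. 2 * R < prod_dist d d (x, x) z}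
        \<le> measure (\<pi> n) ((fst -` A \<inter> space (\<pi> n)) \<union> (snd -` A \<inter> space (\<pi> n)))"
    proof (rule finite_measure_mono)
      show "{z\<in>M \<times> M. 2 * R < prod_dist d d (x, x) z} \<subseteq> (fst -` A \<inter> space (\<pi> n)) \<union> (snd -` A \<inter> space (\<pi> n))"
      proof safe
        fix a b assume ab: "2 * R < prod_dist d d (x, x) (a, b)" "a \<in> M" "b \<in> M"
          "(a, b) \<notin> snd -` A"
        then have "\<not> R < d x b" by (simp add: A_def)
        moreover have "prod_dist d d (x, x) (a, b) \<le> d x a + d x b"
          using ab x by (intro PP.prod_metric_le_components)
        ultimately show "(a, b) \<in> fst -` A" using ab by (simp add: A_def)
      qed (auto simp: couplingsD(5)[OF \<pi>] wp_spaceD(3)[OF \<mu>] wp_spaceD(3)[OF \<nu>])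
    qed (use A in measurable)
    also have "\<dots> \<le> measure (\<pi> n) (fst -` A \<inter> space (\<pi> n)) + measure (\<pi> n) (snd -` A \<inter> space (\<pi> n))"
      by (rule measure_Un_le) (use A in measurable)
    also have "measure (\<pi> n) (fst -` A \<inter> space (\<pi> n)) = measure (\<mu> n) A"
      using measure_distr[OF couplingsD(6)[OF \<pi>] A(1)] by (simp only: couplingsD(3)[OF \<pi>])
    also have "measure (\<pi> n) (snd -` A \<inter> space (\<pi> n)) = measure \<nu> A"
      using measure_distr[OF couplingsD(7)[OF \<pi>, of n] A(2)] by (simp only: couplingsD(4)[OF \<pi>])
    also have "measure (\<mu> n) A + measure \<nu> A < e / 2 + e / 2"
      unfolding A_def R_def
    proof (intro add_strict_mono wp_space_tail_bound[OF _ p x])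
      show "pmean p (\<mu> n) x \<le> D" using C[of n] by (simp add: D_def)
    qed (use e \<mu> \<nu> in \<open>auto simp: D_def\<close>)
    finally show "measure (\<pi> n) {z\<in>M \<times> M. 2 * (D powr p / (e / 2) + 1) < prod_dist d d (x, x) z} < e"
      by (simp add: R_def)
  qed
  obtain s :: "nat \<Rightarrow> nat" and \<Omega> :: "real measure" and Z Z' where s: "strict_mono s" and \<Omega>: "prob_space \<Omega>"
    and Z: "\<And>n. Z n \<in> measurable \<Omega> (borel_of P.mtopology)" "Z' \<in> measurable \<Omega> (borel_of P.mtopology)"
    and dZ: "\<And>n. distr \<Omega> (borel_of P.mtopology) (Z n) = \<pi> (s n)"
    and lim: "\<And>w. w \<in> space \<Omega> \<Longrightarrow> limitin P.mtopology (\<lambda>n. Z n w) (Z' w) sequentially"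
    using P.tight_imp_skorohod_representation[OF sets_\<pi>' couplingsD(2)[OF \<pi>] xx tight] by blast
  have Zm[measurable]: "Z n \<in> measurable \<Omega> (?B \<Otimes>\<^sub>M ?B)" "Z' \<in> measurable \<Omega> (?B \<Otimes>\<^sub>M ?B)" for n
    using Z measurable_cong_sets[OF refl sets_P] by blast+
  have dZ': "distr \<Omega> (?B \<Otimes>\<^sub>M ?B) (Z n) = \<pi> (s n)" for n
    unfolding dZ[symmetric] by (rule distr_cong) (simp_all add: sets_P)
  define X where "X n w = fst (Z n w)" for n w
  define Y where "Y n w = snd (Z n w)" for n w
  define X' where "X' w = fst (Z' w)" for w
  define Y' where "Y' w = snd (Z' w)" for w
  have X: "X n \<in> measurable \<Omega> ?B" and Y: "Y n \<in> measurable \<Omega> ?B" for n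
    unfolding X_def Y_def by measurable
  have X': "X' \<in> measurable \<Omega> ?B" and Y': "Y' \<in> measurable \<Omega> ?B"
    unfolding X'_def Y'_def by measurable
  have dX: "distr \<Omega> ?B (X n) = \<mu> (s n)" for n
  proof -
    have "distr \<Omega> ?B (X n) = distr (distr \<Omega> (?B \<Otimes>\<^sub>M ?B) (Z n)) ?B fst"
      unfolding X_def by (subst distr_distr) (auto simp: comp_def)
    also have "\<dots> = distr (\<pi> (s n)) (\<mu> (s n)) fst"
      unfolding dZ' by (rule distr_cong) (simp_all add: wp_spaceD(1)[OF \<mu>])
    finally show ?thesis by (simp add: couplingsD(3)[OF \<pi>])
  qed
  have dY: "distr \<Omega> ?B (Y n) = \<nu>" for n
  proof -
    have "distr \<Omega> ?B (Y n) = distr (distr \<Omega> (?B \<Otimes>\<^sub>M ?B) (Z n)) ?B snd"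
      unfolding Y_def by (subst distr_distr) (auto simp: comp_def)
    also have "\<dots> = distr (\<pi> (s n)) \<nu> snd"
      unfolding dZ' by (rule distr_cong) (simp_all add: wp_spaceD(1)[OF \<nu>])
    finally show ?thesis by (simp add: couplingsD(4)[OF \<pi>])
  qed
  have lims: "limitin mtopology (\<lambda>n. X n w) (X' w) sequentially" "limitin mtopology (\<lambda>n. Y n w) (Y' w) sequentially"
    if "w \<in> space \<Omega>" for w
    using lim[OF that] by (auto simp: PP.mtopology_prod_metric limitin_pairwise X_def Y_def X'_def Y'_def comp_def)
  have "weakly_to (\<lambda>n. \<mu> (s n)) (distr \<Omega> ?B X')"
    using limitin_imp_weakly_to[OF \<Omega> X X' lims(1)] by (simp add: dX)
  then have dX': "distr \<Omega> ?B X' = \<kappa>"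
    using weakly_to_subseq[OF weak s] prob_space.prob_space_distr[OF \<Omega> X'] wp_spaceD(1,2)[OF \<kappa>]
    by (intro weakly_to_unique) auto
  have "weakly_to (\<lambda>n. \<nu>) (distr \<Omega> ?B Y')"
    using limitin_imp_weakly_to[OF \<Omega> Y Y' lims(2)] by (simp add: dY)
  then have dY': "distr \<Omega> ?B Y' = \<nu>"
    using prob_space.prob_space_distr[OF \<Omega> Y'] wp_spaceD(1,2)[OF \<nu>]
    by (intro weakly_to_unique[of "\<lambda>n. \<nu>"]) (auto simp: weakly_to_def)
  have cost: "(\<integral>\<^sup>+ w. ennreal (d (X n w) (Y n w) powr p) \<partial>\<Omega>) = cost d p (\<pi> (s n))" for n
  proof -
    have [measurable]: "(\<lambda>z. d (fst z) (snd z)) \<in> borel_measurable (?B \<Otimes>\<^sub>M ?B)"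
      by (rule dist_pair_measurable) simp_all
    show ?thesis
      unfolding cost_def dZ'[symmetric] X_def Y_def by (subst nn_integral_distr) simp_all
  qed
  show ?thesis by (rule that[OF s \<Omega> X Y X' Y' dX dY dX' dY' lims cost])
qed

text \<open>The limit pair couples \<kappa> and \<nu>, and by Fatou its cost I satisfies
  \<open>wass d p \<kappa> \<nu> powr p\<close> \<le> I \<le> L. Equality of the ends means that no
  cost is lost in the limit. The pairs of \<open>X n\<close> and \<open>X'\<close> are couplings of
  \<open>\<mu> (s n)\<close> and \<kappa>, and their cost then vanishes by
  \<open>pratt_convergence\<close>.\<close>

lemma wass_lower_semicontinuous:
  fixes \<mu> :: "nat \<Rightarrow> 'a measure"
  assumes \<mu>: "\<And>n. \<mu> n \<in> wp_space M d p" and \<kappa>: "\<kappa> \<in> wp_space M d p" and \<nu>: "\<nu> \<in> wp_space M d p"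
    and p: "1 \<le> p" and x: "x \<in> M" and C: "\<And>n. pmean p (\<mu> n) x \<le> C"
    and weak: "weakly_to \<mu> \<kappa>" and L: "(\<lambda>n. ennreal (wass d p (\<mu> n) \<nu> powr p)) \<longlonglongrightarrow> L"
  shows "ennreal (wass d p \<kappa> \<nu> powr p) \<le> L"
    and "L \<le> ennreal (wass d p \<kappa> \<nu> powr p) \<Longrightarrow> \<exists>s. strict_mono s \<and> (\<lambda>n. wass d p (\<mu> (s n)) \<kappa>) \<longlonglongrightarrow> 0"
proof -
  let ?B = "borel_of mtopology"
  have "\<exists>\<pi>\<in>couplings (\<mu> n) \<nu>. cost d p \<pi> \<le> ennreal (wass d p (\<mu> n) \<nu> powr p) + ennreal (1 / Suc n)" for n
    by (rule near_optimal_coupling[OF \<mu> \<nu> p]) simp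
  then obtain \<pi> where \<pi>: "\<And>n. \<pi> n \<in> couplings (\<mu> n) \<nu>"
    and cost_\<pi>: "\<And>n. cost d p (\<pi> n) \<le> ennreal (wass d p (\<mu> n) \<nu> powr p) + ennreal (1 / Suc n)" by metis
  obtain s :: "nat \<Rightarrow> nat" and \<Omega> :: "real measure" and X Y X' Y' where
    s: "strict_mono s" and \<Omega>: "prob_space \<Omega>"
    and X[measurable]: "\<And>n. X n \<in> measurable \<Omega> ?B" and Y[measurable]: "\<And>n. Y n \<in> measurable \<Omega> ?B"
    and X'[measurable]: "X' \<in> measurable \<Omega> ?B" and Y'[measurable]: "Y' \<in> measurable \<Omega> ?B"
    and dX: "\<And>n. distr \<Omega> ?B (X n) = \<mu> (s n)" and dY: "\<And>n. distr \<Omega> ?B (Y n) = \<nu>"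
    and dX': "distr \<Omega> ?B X' = \<kappa>" and dY': "distr \<Omega> ?B Y' = \<nu>"
    and limX: "\<And>w. w \<in> space \<Omega> \<Longrightarrow> limitin mtopology (\<lambda>n. X n w) (X' w) sequentially"
    and limY: "\<And>w. w \<in> space \<Omega> \<Longrightarrow> limitin mtopology (\<lambda>n. Y n w) (Y' w) sequentially"
    and cost: "\<And>n. (\<integral>\<^sup>+ w. ennreal (d (X n w) (Y n w) powr p) \<partial>\<Omega>) = cost d p (\<pi> (s n))"
    using couplings_skorohod[OF \<mu> \<kappa> \<nu> p x C weak \<pi>] by blast
  define b where "b n = ennreal (wass d p (\<mu> (s n)) \<nu> powr p) + ennreal (1 / Suc (s n))" for n
  have "(\<lambda>n. ennreal (1 / Suc n)) \<longlonglongrightarrow> ennreal 0"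
    using LIMSEQ_inverse_real_of_nat by (intro tendsto_ennrealI) (simp add: inverse_eq_divide)
  then have "(\<lambda>n. ennreal (wass d p (\<mu> n) \<nu> powr p) + ennreal (1 / Suc n)) \<longlonglongrightarrow> L + ennreal 0"
    by (intro tendsto_add L)
  then have b: "b \<longlonglongrightarrow> L"
    using LIMSEQ_subseq_LIMSEQ[OF _ s] unfolding b_def comp_def by fastforce
  have cost_b: "(\<integral>\<^sup>+ w. ennreal (d (X n w) (Y n w) powr p) \<partial>\<Omega>) \<le> b n" for n
    unfolding cost b_def by (rule cost_\<pi>)
  define I where "I = (\<integral>\<^sup>+ w. ennreal (d (X' w) (Y' w) powr p) \<partial>\<Omega>)"
  have dmeas: "(\<lambda>w. d (U w) (V w)) \<in> borel_measurable \<Omega>"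
    if "U \<in> measurable \<Omega> ?B" "V \<in> measurable \<Omega> ?B" for U V
    using that by (rule dist_measurable_comp)
  have wass_le_int: "ennreal (wass d p \<mu>1 \<mu>2 powr p) \<le> (\<integral>\<^sup>+ w. ennreal (d (U w) (V w) powr p) \<partial>\<Omega>)"
    if UV[measurable]: "U \<in> measurable \<Omega> ?B" "V \<in> measurable \<Omega> ?B" and d: "distr \<Omega> ?B U = \<mu>1" "distr \<Omega> ?B V = \<mu>2"
    for U V \<mu>1 \<mu>2
  proof -
    have s12: "sets \<mu>1 = sets ?B" "sets \<mu>2 = sets ?B" using d by auto
    note [measurable_cong] = s12
    have "distr \<Omega> (\<mu>1 \<Otimes>\<^sub>M \<mu>2) (\<lambda>w. (U w, V w)) \<in> couplings \<mu>1 \<mu>2"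
      by (rule distr_pair_in_couplings[OF \<Omega> s12 UV d])
    from wass_powr_le_cost[OF this p, of d] show ?thesis
      by (subst (asm) cost_distr_pair[OF _ _ dist_pair_measurable[OF s12]]) measurable
  qed
  have I_ge: "ennreal (wass d p \<kappa> \<nu> powr p) \<le> I"
    unfolding I_def by (rule wass_le_int[OF X' Y' dX' dY'])
  have "I \<le> liminf (\<lambda>n. \<integral>\<^sup>+ w. ennreal (d (X n w) (Y n w) powr p) \<partial>\<Omega>)"
    unfolding I_def by (rule fatou_dist[OF X Y limX limY p])
  also have "\<dots> \<le> liminf b" by (intro Liminf_mono always_eventually allI cost_b)
  also have "\<dots> = L" using b by (simp add: lim_imp_Liminf)
  finally have I_le: "I \<le> L" .
  show "ennreal (wass d p \<kappa> \<nu> powr p) \<le> L" using I_ge I_le by (rule order_trans)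
  assume "L \<le> ennreal (wass d p \<kappa> \<nu> powr p)"
  then have LI: "L = I" and fin: "I < \<infinity>"
    using I_ge I_le by (auto intro: antisym order.trans order.strict_trans1)
  note [measurable] = dmeas[OF X Y] dmeas[OF X' Y'] dmeas[OF X X'] dist_measurable[OF x]
  define m where "m = (\<integral>\<^sup>+ y. ennreal (d x y powr p) \<partial>\<nu>)"
  define k where "k = (\<integral>\<^sup>+ y. ennreal (d x y powr p) \<partial>\<kappa>)"
  have mk: "m < \<infinity>" "k < \<infinity>" unfolding m_def k_def using wp_space_moment_finite p x \<nu> \<kappa> by blast+
  have int_x: "(\<integral>\<^sup>+ w. ennreal (d x (U w) powr p) \<partial>\<Omega>) = (\<integral>\<^sup>+ y. ennreal (d x y powr p) \<partial>\<mu>1)"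
    if "U \<in> measurable \<Omega> ?B" "distr \<Omega> ?B U = \<mu>1" for U \<mu>1
    unfolding that(2)[symmetric] using that(1) by (subst nn_integral_distr) simp_all
  define c where "c = ennreal (3 powr p)"
  \<comment> \<open>The majorant comes from the path \<open>X n\<close>, \<open>Y n\<close>, x,
    \<open>X'\<close>. Its last two terms have the constant integrals m and k, since the laws of
    \<open>Y n\<close> and \<open>X'\<close> do not depend on n; only the first term relies on
    convergence of the costs.\<close>
  define g where "g n w = 3 powr p * (d (X n w) (Y n w) powr p + d x (Y n w) powr p + d x (X' w) powr p)" for n w
  define h where "h w = 3 powr p * (d (X' w) (Y' w) powr p + d x (Y' w) powr p + d x (X' w) powr p)" for w
  have split: "(\<integral>\<^sup>+ w. ennreal (3 powr p * (F1 w + F2 w + F3 w)) \<partial>\<Omega>)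
      = c * ((\<integral>\<^sup>+ w. ennreal (F1 w) \<partial>\<Omega>) + (\<integral>\<^sup>+ w. ennreal (F2 w) \<partial>\<Omega>) + (\<integral>\<^sup>+ w. ennreal (F3 w) \<partial>\<Omega>))"
    if [measurable]: "F1 \<in> borel_measurable \<Omega>" "F2 \<in> borel_measurable \<Omega>" "F3 \<in> borel_measurable \<Omega>"
      and nn: "\<And>w. 0 \<le> F1 w" "\<And>w. 0 \<le> F2 w" "\<And>w. 0 \<le> F3 w" for F1 F2 F3
    unfolding c_def using nn
    by (simp add: ennreal_mult nn_integral_cmult nn_integral_add)
  have "(\<lambda>n. \<integral>\<^sup>+ w. ennreal (d (X n w) (X' w) powr p) \<partial>\<Omega>) \<longlonglongrightarrow> 0"
  proof (rule pratt_convergence[where g=g and h=h and w="\<lambda>n. c * (b n + m + k)"])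
    show "(\<lambda>w. d (X n w) (X' w) powr p) \<in> borel_measurable \<Omega>" for n by measurable
    show "g n \<in> borel_measurable \<Omega>" for n unfolding g_def by measurable
    show "h \<in> borel_measurable \<Omega>" unfolding h_def by measurable
    fix n w assume w: "w \<in> space \<Omega>"
    have sp: "X n w \<in> M" "Y n w \<in> M" "X' w \<in> M" for n
      using measurable_space[OF X w] measurable_space[OF Y w] measurable_space[OF X' w] by auto
    show "0 \<le> d (X n w) (X' w) powr p" by simp
    have "d (X n w) (X' w) \<le> d (X n w) (Y n w) + d (Y n w) (X' w)" using sp by (intro triangle)
    moreover have "d (Y n w) (X' w) \<le> d x (Y n w) + d x (X' w)" using sp x by (intro triangle'')
    ultimately have "d (X n w) (X' w) powr p \<le> (d (X n w) (Y n w) + d x (Y n w) + d x (X' w)) powr p"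
      using p by (intro powr_mono2) auto
    also have "\<dots> \<le> g n w" unfolding g_def using p by (intro powr_add3_le) auto
    finally show "d (X n w) (X' w) powr p \<le> g n w" .
  next
    fix w assume w: "w \<in> space \<Omega>"
    have sp: "X n w \<in> M" "Y n w \<in> M" "X' w \<in> M" for n
      using measurable_space[OF X w] measurable_space[OF Y w] measurable_space[OF X' w] by auto
    have "(\<lambda>n. d (X n w) (X' w)) \<longlonglongrightarrow> d (X' w) (X' w)"
      using sp by (intro limitin_dist limX w) auto
    then have "(\<lambda>n. d (X n w) (X' w) powr p) \<longlonglongrightarrow> d (X' w) (X' w) powr p"
      using p by (intro tendsto_powr_nonneg) auto
    then show "(\<lambda>n. d (X n w) (X' w) powr p) \<longlonglongrightarrow> 0" using sp by simp
    show "(\<lambda>n. g n w) \<longlonglongrightarrow> h w"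
      unfolding g_def h_def using sp x p
      by (intro tendsto_mult tendsto_add tendsto_const tendsto_powr_nonneg limitin_dist limX limY w) auto
  next
    fix n
    have "(\<integral>\<^sup>+ w. ennreal (g n w) \<partial>\<Omega>) = c * (cost d p (\<pi> (s n)) + m + k)"
      unfolding g_def m_def k_def by (subst split) (simp_all add: cost int_x[OF Y dY] int_x[OF X' dX'])
    also have "\<dots> \<le> c * (b n + m + k)"
      using cost_b[of n] unfolding cost by (intro mult_left_mono add_right_mono) auto
    finally show "(\<integral>\<^sup>+ w. ennreal (g n w) \<partial>\<Omega>) \<le> c * (b n + m + k)" .
  next
    have h: "(\<integral>\<^sup>+ w. ennreal (h w) \<partial>\<Omega>) = c * (I + m + k)"
      unfolding h_def m_def k_def I_def by (subst split) (simp_all add: int_x[OF Y' dY'] int_x[OF X' dX'])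
    show "(\<lambda>n. c * (b n + m + k)) \<longlonglongrightarrow> (\<integral>\<^sup>+ w. ennreal (h w) \<partial>\<Omega>)"
      unfolding h LI[symmetric] by (intro ennreal_tendsto_cmult tendsto_add b tendsto_const) (simp add: c_def)
    show "(\<integral>\<^sup>+ w. ennreal (h w) \<partial>\<Omega>) < \<infinity>"
      unfolding h using fin mk by (simp add: c_def ennreal_mult_less_top)
  qed
  from tendsto_sandwich[OF _ _ tendsto_const this]
  have "(\<lambda>n. ennreal (wass d p (\<mu> (s n)) \<kappa> powr p)) \<longlonglongrightarrow> 0"
    using wass_le_int[OF X X' dX dX'] by simp
  then have "(\<lambda>n. ennreal (wass d p (\<mu> (s n)) \<kappa> powr p)) \<longlonglongrightarrow> ennreal 0" by simp
  then have *: "(\<lambda>n. wass d p (\<mu> (s n)) \<kappa> powr p) \<longlonglongrightarrow> 0"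
    by (rule tendsto_ennrealD) auto
  have "(\<lambda>n. (wass d p (\<mu> (s n)) \<kappa> powr p) powr (1 / p)) \<longlonglongrightarrow> 0 powr (1 / p)"
    using p by (intro tendsto_powr' * tendsto_const) auto
  then have "(\<lambda>n. wass d p (\<mu> (s n)) \<kappa>) \<longlonglongrightarrow> 0"
    using p by (simp add: powr_powr)
  then show "\<exists>s. strict_mono s \<and> (\<lambda>n. wass d p (\<mu> (s n)) \<kappa>) \<longlonglongrightarrow> 0" using s by blast
qed

end

section \<open>Barycenters\<close>

lemma geodesic_imp_proper_metric:
  assumes "geodesic_space E d" "separable_space (Metric_space.mtopology E d)"
    "locally_compact_space (Metric_space.mtopology E d)" "E \<noteq> {}"
  shows "proper_metric E d"
proof -
  interpret Metric_space E d using assms(1) by (simp add: geodesic_space_def)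
  show ?thesis
  proof unfold_locales
    show "compactin mtopology (mcball x r)" if "x \<in> E" for x r
      using assms(1) that by (intro hopf_rinow_midpoints assms(3)) (auto simp: geodesic_space_def)
  qed (use assms in auto)
qed

context Metric_space
begin

lemma pmean_le_iff:
  assumes "P \<in> wp_space M d p" "1 \<le> p" "x \<in> M" "y \<in> M"
  shows "(\<integral>\<^sup>+ z. ennreal (d x z powr p) \<partial>P) \<le> (\<integral>\<^sup>+ z. ennreal (d y z powr p) \<partial>P) \<longleftrightarrow> pmean p P x \<le> pmean p P y"
proof -
  have "pmean p P x powr p \<le> pmean p P y powr p \<longleftrightarrow> pmean p P x \<le> pmean p P y"
    using powr_less_mono2[of p "pmean p P y" "pmean p P x"] powr_mono2[of p "pmean p P x" "pmean p P y"] assms(2)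
    by (auto simp: not_le[symmetric])
  then show ?thesis using assms by (simp add: nn_integral_eq_pmean)
qed

end

locale barycenter_sequence = proper_metric +
  fixes p :: real and PP :: "nat \<Rightarrow> 'a measure measure" and P :: "'a measure measure" and \<mu> :: "nat \<Rightarrow> 'a measure"
  assumes p: "1 \<le> p"
    and PP: "\<And>j. PP j \<in> wp_space (wp_space M d p) (wass d p) p"
    and bary: "\<And>j. barycenter M d p (PP j) (\<mu> j)"
    and P: "P \<in> wp_space (wp_space M d p) (wass d p) p"
    and conv: "(\<lambda>j. wass (wass d p) p (PP j) P) \<longlonglongrightarrow> 0"
begin

sublocale W: Metric_space "wp_space M d p" "wass d p"
  by (rule wass_Metric_space[OF p])

lemma \<mu>_wp: "\<mu> j \<in> wp_space M d p"
  using bary by (simp add: barycenter_def)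

text \<open>Each \<mu> j almost minimizes the functional of P: minimality is used under
  \<open>PP j\<close>, and the factor 2 pays for passing from P to \<open>PP j\<close> at \<mu> j
  and back at \<nu>.\<close>

lemma pmean_le:
  assumes \<nu>: "\<nu> \<in> wp_space M d p"
  shows "W.pmean p P (\<mu> j) \<le> W.pmean p P \<nu> + 2 * wass (wass d p) p (PP j) P"
proof -
  have "W.pmean p P (\<mu> j) \<le> W.pmean p (PP j) (\<mu> j) + wass (wass d p) p P (PP j)"
    by (rule W.pmean_triangle_measure[OF P PP p \<mu>_wp])
  also have "wass (wass d p) p P (PP j) = wass (wass d p) p (PP j) P"
    by (rule wass_commute[OF W.commute])
  also have "W.pmean p (PP j) (\<mu> j) \<le> W.pmean p (PP j) \<nu>"
  proof (rule iffD1[OF W.pmean_le_iff[OF PP p \<mu>_wp \<nu>]])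
    show "(\<integral>\<^sup>+ \<kappa>. ennreal (wass d p (\<mu> j) \<kappa> powr p) \<partial>PP j) \<le> (\<integral>\<^sup>+ \<kappa>. ennreal (wass d p \<nu> \<kappa> powr p) \<partial>PP j)"
      using bary[of j] \<nu> unfolding barycenter_def by blast
  qed
  also have "\<dots> \<le> W.pmean p P \<nu> + wass (wass d p) p (PP j) P"
    by (rule W.pmean_triangle_measure[OF PP P p \<nu>])
  finally show ?thesis by simp
qed

lemma limit_is_barycenter:
  assumes r: "strict_mono r" and lim: "limitin W.mtopology (\<mu> \<circ> r) \<nu> sequentially"
  shows "barycenter M d p P \<nu>"
  unfolding barycenter_def
proof (intro conjI ballI)
  show \<nu>: "\<nu> \<in> wp_space M d p" using lim by (rule W.limitin_mspace)
  fix \<nu>' assume \<nu>': "\<nu>' \<in> wp_space M d p"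
  have "W.pmean p P \<nu> \<le> W.pmean p P \<nu>' + 2 * 0 + 0"
  proof (rule LIMSEQ_le_const)
    show "(\<lambda>n. W.pmean p P \<nu>' + 2 * wass (wass d p) p (PP (r n)) P + wass d p (\<mu> (r n)) \<nu>)
        \<longlonglongrightarrow> W.pmean p P \<nu>' + 2 * 0 + 0"
    proof (intro tendsto_add tendsto_mult tendsto_const)
      show "(\<lambda>n. wass (wass d p) p (PP (r n)) P) \<longlonglongrightarrow> 0"
        using LIMSEQ_subseq_LIMSEQ[OF conv r] by (simp add: comp_def)
      show "(\<lambda>n. wass d p (\<mu> (r n)) \<nu>) \<longlonglongrightarrow> 0"
        using lim by (simp add: W.limitin_metric_dist_null)
    qed
    show "\<exists>N. \<forall>n\<ge>N. W.pmean p P \<nu> \<le> W.pmean p P \<nu>' + 2 * wass (wass d p) p (PP (r n)) P + wass d p (\<mu> (r n)) \<nu>"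
    proof (intro exI allI impI)
      fix n
      have "W.pmean p P \<nu> \<le> W.pmean p P (\<mu> (r n)) + wass d p \<nu> (\<mu> (r n))"
        by (rule W.pmean_triangle_point[OF P p \<nu> \<mu>_wp])
      then show "W.pmean p P \<nu> \<le> W.pmean p P \<nu>' + 2 * wass (wass d p) p (PP (r n)) P + wass d p (\<mu> (r n)) \<nu>"
        using pmean_le[OF \<nu>', of "r n"] W.commute[of \<nu> "\<mu> (r n)"] by linarith
    qed
  qed
  then show "(\<integral>\<^sup>+ \<mu>. ennreal (wass d p \<nu> \<mu> powr p) \<partial>P) \<le> (\<integral>\<^sup>+ \<mu>. ennreal (wass d p \<nu>' \<mu> powr p) \<partial>P)"
    using W.pmean_le_iff[OF P p \<nu> \<nu>'] by simp
qed

text \<open>A weak subsequential limit \<open>\<kappa>\<close> has \<open>W\<^sub>p(\<kappa>, \<nu>) \<le> liminf W\<^sub>p(\<mu>\<^sub>j, \<nu>)\<close> for all \<open>\<nu>\<close>. Minimality of the \<open>\<mu>\<^sub>j\<close>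
  and Fatou's lemma force equality for some \<open>\<nu>\<close>, which rules out that mass escapes.\<close>

lemma convergent_subseq:
  assumes r: "strict_mono (r :: nat \<Rightarrow> nat)"
  shows "\<exists>s \<kappa>. strict_mono s \<and> \<kappa> \<in> wp_space M d p \<and> (\<lambda>n. wass d p (\<mu> (r (s n))) \<kappa>) \<longlonglongrightarrow> 0"
proof -
  obtain x where x: "x \<in> M" using nonempty by blast
  define \<delta> where "\<delta> j = wass (wass d p) p (PP j) P" for j
  obtain D where D: "\<And>j. \<delta> j \<le> D"
    using convergent_imp_bounded[OF conv] unfolding bounded_iff \<delta>_def by fastforce
  \<comment> \<open>The distance of \<mu> j from \<mu> 0 is bounded through P by the sum of their
    \<open>pmean\<close> values; the value at \<mu> j exceeds the one at \<mu> 0 by at most 2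
    D.\<close>
  define C where "C = pmean p (\<mu> 0) x + (2 * W.pmean p P (\<mu> 0) + 2 * D)"
  have C: "pmean p (\<mu> j) x \<le> C" for j
  proof -
    have "pmean p (\<mu> j) x \<le> pmean p (\<mu> 0) x + wass d p (\<mu> j) (\<mu> 0)"
      by (rule pmean_triangle_measure[OF \<mu>_wp \<mu>_wp p x])
    moreover have "wass d p (\<mu> j) (\<mu> 0) \<le> W.pmean p P (\<mu> j) + W.pmean p P (\<mu> 0)"
      by (rule W.dist_le_pmean[OF P p \<mu>_wp \<mu>_wp])
    ultimately show ?thesis
      using pmean_le[OF \<mu>_wp[of 0], of j] D[of j] by (simp add: C_def \<delta>_def)
  qed
  obtain s1 \<kappa> where s1: "strict_mono s1" and \<kappa>: "\<kappa> \<in> wp_space M d p"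
    and weak: "weakly_to (\<lambda>n. \<mu> (r (s1 n))) \<kappa>"
    using wp_space_weakly_convergent_subseq[of "\<lambda>n. \<mu> (r n)", OF \<mu>_wp p x C] by metis
  define m where "m n = \<mu> (r (s1 n))" for n
  have m: "m n \<in> wp_space M d p" "pmean p (m n) x \<le> C" for n using \<mu>_wp C by (simp_all add: m_def)
  define F where "F n \<nu> = ennreal (wass d p (m n) \<nu> powr p)" for n \<nu>
  have sub: "\<exists>t. strict_mono t \<and> weakly_to (\<lambda>n. m (t n)) \<kappa> \<and>
      (\<lambda>n. ennreal (wass d p (m (t n)) \<nu> powr p)) \<longlonglongrightarrow> liminf (\<lambda>n. F n \<nu>)" for \<nu>
    using liminf_subseq_lim[of "\<lambda>n. F n \<nu>"] weakly_to_subseq[OF weak]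
    unfolding F_def m_def comp_def by blast
  have lsc: "ennreal (wass d p \<kappa> \<nu> powr p) \<le> liminf (\<lambda>n. F n \<nu>)" if \<nu>: "\<nu> \<in> wp_space M d p" for \<nu>
  proof -
    obtain t where "weakly_to (\<lambda>n. m (t n)) \<kappa>"
      "(\<lambda>n. ennreal (wass d p (m (t n)) \<nu> powr p)) \<longlonglongrightarrow> liminf (\<lambda>n. F n \<nu>)" using sub by blast
    then show ?thesis by (rule wass_lower_semicontinuous(1)[OF m(1) \<kappa> \<nu> p x m(2)])
  qed
  have meas: "(\<lambda>\<nu>. ennreal (wass d p \<mu>' \<nu> powr p)) \<in> borel_measurable P" if "\<mu>' \<in> wp_space M d p" for \<mu>'
    using W.dist_measurable_wp[OF P that] by measurable
  have \<delta>: "(\<lambda>n. \<delta> (r (s1 n))) \<longlonglongrightarrow> 0"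
    using LIMSEQ_subseq_LIMSEQ[OF conv strict_mono_o[OF r s1]] by (simp add: comp_def \<delta>_def)
  have "(\<integral>\<^sup>+ \<nu>. liminf (\<lambda>n. F n \<nu>) \<partial>P) \<le> liminf (\<lambda>n. \<integral>\<^sup>+ \<nu>. F n \<nu> \<partial>P)"
    unfolding F_def by (intro nn_integral_liminf meas m)
  also have "\<dots> \<le> liminf (\<lambda>n. ennreal ((W.pmean p P \<kappa> + 2 * \<delta> (r (s1 n))) powr p))"
  proof (intro Liminf_mono always_eventually allI)
    fix n
    have "(\<integral>\<^sup>+ \<nu>. F n \<nu> \<partial>P) = ennreal (W.pmean p P (m n) powr p)"
      unfolding F_def by (rule W.nn_integral_eq_pmean[OF P p m(1)])
    also have "\<dots> \<le> ennreal ((W.pmean p P \<kappa> + 2 * \<delta> (r (s1 n))) powr p)"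
      \<comment> \<open>The competitor is the weak limit \<kappa> itself, so the bound tends to the
        functional of P at \<kappa>.\<close>
      using p pmean_le[OF \<kappa>, of "r (s1 n)"] by (intro ennreal_leI powr_mono2) (auto simp: m_def \<delta>_def)
    finally show "(\<integral>\<^sup>+ \<nu>. F n \<nu> \<partial>P) \<le> ennreal ((W.pmean p P \<kappa> + 2 * \<delta> (r (s1 n))) powr p)" .
  qed
  also have "\<dots> = ennreal ((W.pmean p P \<kappa> + 2 * 0) powr p)"
  proof (rule lim_imp_Liminf)
    show "(\<lambda>n. ennreal ((W.pmean p P \<kappa> + 2 * \<delta> (r (s1 n))) powr p)) \<longlonglongrightarrow> ennreal ((W.pmean p P \<kappa> + 2 * 0) powr p)"
      using p by (intro tendsto_ennrealI tendsto_powr_nonneg tendsto_add tendsto_mult tendsto_const \<delta>) (auto simp: \<delta>_def)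
  qed simp
  also have "\<dots> = (\<integral>\<^sup>+ \<nu>. ennreal (wass d p \<kappa> \<nu> powr p) \<partial>P)"
    by (simp add: W.nn_integral_eq_pmean[OF P p \<kappa>])
  finally have le: "(\<integral>\<^sup>+ \<nu>. liminf (\<lambda>n. F n \<nu>) \<partial>P) \<le> (\<integral>\<^sup>+ \<nu>. ennreal (wass d p \<kappa> \<nu> powr p) \<partial>P)" .
  \<comment> \<open>By \<open>lsc\<close> the liminf dominates pointwise, yet its integral is no
    larger and the smaller integral is finite, so the two functions agree almost everywhere.\<close>
  have "AE \<nu> in P. liminf (\<lambda>n. F n \<nu>) \<le> ennreal (wass d p \<kappa> \<nu> powr p)"
  proof (rule ccontr)
    assume nAE: "\<not> ?thesis"
    have "(\<integral>\<^sup>+ \<nu>. ennreal (wass d p \<kappa> \<nu> powr p) \<partial>P) < (\<integral>\<^sup>+ \<nu>. liminf (\<lambda>n. F n \<nu>) \<partial>P)"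
    proof (rule nn_integral_less[OF meas[OF \<kappa>] _ _ _ nAE])
      show "(\<lambda>\<nu>. liminf (\<lambda>n. F n \<nu>)) \<in> borel_measurable P"
        unfolding F_def by (intro borel_measurable_liminf meas m)
      show "(\<integral>\<^sup>+ \<nu>. ennreal (wass d p \<kappa> \<nu> powr p) \<partial>P) \<noteq> \<infinity>"
        by (simp add: W.nn_integral_eq_pmean[OF P p \<kappa>])
      show "AE \<nu> in P. ennreal (wass d p \<kappa> \<nu> powr p) \<le> liminf (\<lambda>n. F n \<nu>)"
        using lsc W.wp_spaceD(3)[OF P] by (intro AE_I2) simp
    qed
    with le show False by simp
  qed
  then have ae: "AE \<nu> in P. liminf (\<lambda>n. F n \<nu>) \<le> ennreal (wass d p \<kappa> \<nu> powr p)" .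
  have "\<exists>\<nu>\<in>wp_space M d p. liminf (\<lambda>n. F n \<nu>) \<le> ennreal (wass d p \<kappa> \<nu> powr p)"
  proof (rule ccontr)
    assume none: "\<not> ?thesis"
    interpret P: prob_space P by (rule W.wp_spaceD[OF P])
    have "AE \<nu> in P. False"
      using ae AE_space by eventually_elim (use none W.wp_spaceD(3)[OF P] in auto)
    then show False by simp
  qed
  then obtain \<nu> where \<nu>: "\<nu> \<in> wp_space M d p" "liminf (\<lambda>n. F n \<nu>) \<le> ennreal (wass d p \<kappa> \<nu> powr p)"
    by blast
  obtain t where t: "strict_mono t" "weakly_to (\<lambda>n. m (t n)) \<kappa>"
    "(\<lambda>n. ennreal (wass d p (m (t n)) \<nu> powr p)) \<longlonglongrightarrow> liminf (\<lambda>n. F n \<nu>)" using sub by blast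
  obtain s2 where s2: "strict_mono s2" "(\<lambda>n. wass d p (m (t (s2 n))) \<kappa>) \<longlonglongrightarrow> 0"
    using wass_lower_semicontinuous(2)[OF m(1) \<kappa> \<nu>(1) p x m(2) t(2,3) \<nu>(2)] by blast
  have "strict_mono (s1 \<circ> (t \<circ> s2))" by (intro strict_mono_o s1 t s2)
  then show ?thesis using s2(2) \<kappa> by (intro exI[of _ "s1 \<circ> (t \<circ> s2)"] exI[of _ \<kappa>]) (simp add: m_def)
qed

lemma compact_closure_range: "compactin W.mtopology (W.mtopology closure_of (range \<mu>))"
  unfolding W.compact_closure_of_eq_Bolzano_Weierstrass
proof (intro allI impI; elim conjE)
  fix T assume T: "infinite T" "T \<subseteq> range \<mu>" "T \<subseteq> wp_space M d p"
  \<comment> \<open>One index is chosen for each point of T, so that enumerating J in increasing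
    order yields a genuine subsequence with pairwise distinct terms.\<close>
  define J where "J = (\<lambda>t. LEAST j. \<mu> j = t) ` T"
  have \<mu>_Least: "\<mu> (LEAST j. \<mu> j = t) = t" if "t \<in> T" for t
    using T(2) that by (intro LeastI_ex[where P="\<lambda>j. \<mu> j = t"]) blast
  have "inj_on (\<lambda>t. LEAST j. \<mu> j = t) T" by (rule inj_on_inverseI[where g=\<mu>]) (rule \<mu>_Least)
  then have "infinite J" using T(1) by (simp add: J_def finite_image_iff)
  define r where "r = enumerate J"
  have r: "strict_mono r" unfolding r_def by (rule strict_mono_enumerate[OF \<open>infinite J\<close>])
  have rJ: "r n \<in> J" for n unfolding r_def by (rule enumerate_in_set[OF \<open>infinite J\<close>])
  have \<mu>_T: "\<mu> (r n) \<in> T" for n using rJ[of n] \<mu>_Least by (auto simp: J_def)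
  have inj: "n = k" if "\<mu> (r n) = \<mu> (r k)" for n k
  proof -
    have "(LEAST j. \<mu> j = \<mu> i) = i" if "i \<in> J" for i using that \<mu>_Least by (auto simp: J_def)
    then have "r n = r k" using rJ that by metis
    then show ?thesis using r by (simp add: strict_mono_eq)
  qed
  obtain s \<kappa> where s: "strict_mono s" and \<kappa>: "\<kappa> \<in> wp_space M d p"
    and lim: "(\<lambda>n. wass d p (\<mu> (r (s n))) \<kappa>) \<longlonglongrightarrow> 0"
    using convergent_subseq[OF r] by blast
  have "\<kappa> \<in> W.mtopology derived_set_of T"
    unfolding W.metric_derived_set_of
  proof (intro CollectI conjI allI impI \<kappa>)
    fix e :: real assume "0 < e"
    then have "\<forall>\<^sub>F n in sequentially. wass d p (\<mu> (r (s n))) \<kappa> < e" by (intro order_tendstoD(2)[OF lim])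
    then obtain N where N: "\<And>n. N \<le> n \<Longrightarrow> wass d p (\<mu> (r (s n))) \<kappa> < e"
      unfolding eventually_sequentially by blast
    \<comment> \<open>An accumulation point requires nearby points of T other than \<kappa>. Of two
      distinct consecutive terms at least one differs from \<kappa>.\<close>
    have "\<mu> (r (s N)) \<noteq> \<mu> (r (s (Suc N)))"
      using inj[of "s N" "s (Suc N)"] s by (auto simp: strict_mono_eq)
    then obtain n where "N \<le> n" "\<mu> (r (s n)) \<noteq> \<kappa>" by (metis le_refl le_SucI)
    then show "\<exists>y\<in>T. y \<noteq> \<kappa> \<and> y \<in> W.mball \<kappa> e"
      using N[of n] \<mu>_T \<mu>_wp \<kappa> W.commute[of \<kappa>] by (intro bexI[of _ "\<mu> (r (s n))"]) simp_all
  qed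
  then show "W.mtopology derived_set_of T \<noteq> {}" by blast
qed

end

theorem theorem2:
  fixes E :: "'a set" and d :: "'a \<Rightarrow> 'a \<Rightarrow> real" and p :: real
    and PP :: "nat \<Rightarrow> 'a measure measure" and P :: "'a measure measure"
    and \<mu> :: "nat \<Rightarrow> 'a measure"
  assumes p: "p \<ge> 1"
    and geo: "geodesic_space E d"
    and sep: "separable_space (Metric_space.mtopology E d)"
    and lc: "locally_compact_space (Metric_space.mtopology E d)"
    and PP: "\<And>j. PP j \<in> wp_space (wp_space E d p) (wass d p) p"
    and bary: "\<And>j. barycenter E d p (PP j) (\<mu> j)"
    and P: "P \<in> wp_space (wp_space E d p) (wass d p) p"
    and conv: "(\<lambda>j. wass (wass d p) p (PP j) P) \<longlonglongrightarrow> 0"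
  shows "compactin (Metric_space.mtopology (wp_space E d p) (wass d p))
           ((Metric_space.mtopology (wp_space E d p) (wass d p)) closure_of (range \<mu>))
         \<and> (\<forall>r \<nu>. strict_mono r \<and>
              limitin (Metric_space.mtopology (wp_space E d p) (wass d p)) (\<mu> \<circ> r) \<nu> sequentially
              \<longrightarrow> barycenter E d p P \<nu>)"
proof -
  \<comment> \<open>The finite moment of a barycenter is taken at a base point, which is a point of
    E.\<close>
  have "E \<noteq> {}" using bary[of 0] by (auto simp: barycenter_def wp_space_def)
  then interpret proper_metric E d using geo sep lc by (intro geodesic_imp_proper_metric)
  interpret barycenter_sequence E d p PP P \<mu>
    by unfold_locales (rule p PP bary P conv)+
  show ?thesis using compact_closure_range limit_is_barycenter by blast
qed

end
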